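(* Let $X\subset\mathbb{P}^4$ be a cubic threefold with $2\mathsf D_4$-singularities, given by $x_1x_2x_3+f_3(x_3,x_4,x_5)=0$ for a cubic form $f_3$. Let $n\ge 2$, let $a=\zeta_{2n}\in k$ be a primitive $2n$-th root of unity, and let $G=\langle\sigma_{(12)},\tau_a\rangle\simeq\mathfrak D_{2n}\subset\mathrm{Aut}(X)$, where $$\sigma_{(12)}:(x_1,x_2,x_3,x_4,x_5)\mapsto(x_2,x_1,x_3,x_4,x_5),\qquad \tau_a:(x_1,x_2,x_3,x_4,x_5)\mapsto(ax_1,a^{-1}x_2,x_3,x_4,x_5).$$ Then the $G$-action on $X$ is not linearizable.
   Context: The ground field $k$ is an uncountable algebraically closed field of characteristic zero. "$X$ has $2\mathsf D_4$-singularities" means that the singular locus of $X$ consists of exactly two points, both of type $\mathsf D_4$; up to isomorphism every such $X$ is given by an equation of the displayed form, with singular points $[1:0:0:0:0]$ and $[0:1:0:0:0]$. $\mathfrak D_{2n}$ is the dihedral group of order $4n$. The $G$-action on $X$ is linearizable if $X$ is $G$-equivariantly birational to $\mathbb{P}(V)$ for some linear representation $V$ of $G$. *)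

theory Defs
  imports
    "HOL-Library.Poly_Mapping"
    "HOL-Library.Countable_Set"
    "HOL-Computational_Algebra.Polynomial"
    "HOL-Computational_Algebra.Formal_Power_Series"
    "HOL-Algebra.Elementary_Groups"
    "Jordan_Normal_Form.Matrix"
begin

section \<open>Polynomials in variables indexed by natural numbers\<close>

text \<open>The variables are numbered from 0, so the coordinates $x_1,\dots,x_5$ on projective 4-space
  carry the indices 0, 1, 2, 3, 4.\<close>

type_synonym 'a mpoly = "(nat \<Rightarrow>\<^sub>0 nat) \<Rightarrow>\<^sub>0 'a"

definition Var :: "nat \<Rightarrow> 'a::zero_neq_one mpoly" where
  "Var i = Poly_Mapping.single (Poly_Mapping.single i 1) 1"

definition vars :: "'a::zero mpoly \<Rightarrow> nat set" where
  "vars p = (\<Union>m\<in>Poly_Mapping.keys p. Poly_Mapping.keys m)"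

definition homogeneous :: "nat \<Rightarrow> 'a::zero mpoly \<Rightarrow> bool" where
  "homogeneous d p \<longleftrightarrow>
     (\<forall>m\<in>Poly_Mapping.keys p. (\<Sum>i\<in>Poly_Mapping.keys m. Poly_Mapping.lookup m i) = d)"

text \<open>Evaluation at a point with values in an algebra whose structure map is \<open>h\<close>.\<close>

definition eval_mpoly :: "('a::zero \<Rightarrow> 'b::comm_ring_1) \<Rightarrow> (nat \<Rightarrow> 'b) \<Rightarrow> 'a mpoly \<Rightarrow> 'b" where
  "eval_mpoly h x p = (\<Sum>m\<in>Poly_Mapping.keys p.
     h (Poly_Mapping.lookup p m) * (\<Prod>i\<in>Poly_Mapping.keys m. x i ^ Poly_Mapping.lookup m i))"

abbreviation eval_vec :: "'a::comm_ring_1 mpoly \<Rightarrow> 'a vec \<Rightarrow> 'a" where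
  "eval_vec p x \<equiv> eval_mpoly (\<lambda>c. c) (\<lambda>i. x $ i) p"

definition partial_deriv :: "nat \<Rightarrow> 'a::comm_semiring_1 mpoly \<Rightarrow> 'a mpoly" where
  "partial_deriv i p = (\<Sum>m\<in>Poly_Mapping.keys p.
     Poly_Mapping.single (m - Poly_Mapping.single i 1)
       (of_nat (Poly_Mapping.lookup m i) * Poly_Mapping.lookup p m))"


section \<open>Projective varieties in homogeneous coordinates\<close>

text \<open>A point of the projective space of dimension \<open>N - 1\<close> is a nonzero vector of dimension \<open>N\<close>,
  taken up to \<open>same_point\<close>.  A closed subset is represented by the set of all nonzero vectors lying
  over it.\<close>

definition proj_space :: "nat \<Rightarrow> 'a::zero vec set" where
  "proj_space N = carrier_vec N - {0\<^sub>v N}"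

definition same_point :: "'a::field vec \<Rightarrow> 'a vec \<Rightarrow> bool" where
  "same_point x y \<longleftrightarrow> (\<exists>c. c \<noteq> 0 \<and> y = c \<cdot>\<^sub>v x)"

definition hypersurface :: "nat \<Rightarrow> 'a::field mpoly \<Rightarrow> 'a vec set" where
  "hypersurface N F = {x \<in> proj_space N. eval_vec F x = 0}"

definition singular_locus :: "nat \<Rightarrow> 'a::field mpoly \<Rightarrow> 'a vec set" where
  "singular_locus N F =
     {x \<in> hypersurface N F. \<forall>i<N. eval_vec (partial_deriv i F) x = 0}"


section \<open>Singularities of type $D_4$ on threefolds in projective 4-space\<close>

text \<open>The ring $k[[t_0,t_1,t_2,t_3]]$, built by iterating the univariate construction; \<open>t_0\<close> is the
  innermost variable.\<close>

type_synonym 'a ps4 = "'a fps fps fps fps"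

definition const4 :: "'a::zero \<Rightarrow> 'a ps4" where
  "const4 c = fps_const (fps_const (fps_const (fps_const c)))"

definition t4 :: "nat \<Rightarrow> 'a::comm_ring_1 ps4" where
  "t4 j = (if j = 0 then fps_const (fps_const (fps_const fps_X))
           else if j = 1 then fps_const (fps_const fps_X)
           else if j = 2 then fps_const fps_X
           else fps_X)"

text \<open>The germ at \<open>p\<close> of the equation \<open>F = 0\<close> in the affine chart where the \<open>i\<close>-th coordinate is 1;
  the other four affine coordinates are expanded around those of \<open>p\<close>.\<close>

definition local_equation :: "'a::field mpoly \<Rightarrow> 'a vec \<Rightarrow> nat \<Rightarrow> 'a ps4" where
  "local_equation F p i = eval_mpoly const4
     (\<lambda>j. if j = i then 1
          else const4 (p $ j / p $ i) + t4 (if j < i then j else j - 1)) F"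

text \<open>Contact equivalence of germs of hypersurfaces: some automorphism of the \<open>k\<close>-algebra of formal
  power series (automatically local and continuous, hence a formal change of coordinates) maps one
  equation to a unit times the other, i.e. one principal ideal onto the other.\<close>

definition contact_equivalent :: "'a::field ps4 \<Rightarrow> 'a ps4 \<Rightarrow> bool" where
  "contact_equivalent f g \<longleftrightarrow> (\<exists>\<phi> :: 'a ps4 \<Rightarrow> 'a ps4.
     bij \<phi> \<and> (\<forall>u v. \<phi> (u + v) = \<phi> u + \<phi> v) \<and> (\<forall>u v. \<phi> (u * v) = \<phi> u * \<phi> v) \<and>
     (\<forall>c. \<phi> (const4 c) = const4 c) \<and> \<phi> f dvd g \<and> g dvd \<phi> f)"

definition D4_normal_form :: "'a::field ps4" where
  "D4_normal_form = t4 0 ^ 2 + t4 1 ^ 2 + t4 2 ^ 2 * t4 3 + t4 3 ^ 3"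

text \<open>The condition does not depend on the affine chart containing the point.\<close>

definition D4_point :: "'a::field mpoly \<Rightarrow> 'a vec \<Rightarrow> bool" where
  "D4_point F p \<longleftrightarrow>
     (\<exists>i<5. p $ i \<noteq> 0 \<and> contact_equivalent (local_equation F p i) D4_normal_form)"

definition has_2D4_singularities :: "'a::field mpoly \<Rightarrow> bool" where
  "has_2D4_singularities F \<longleftrightarrow> (\<exists>p\<in>proj_space 5. \<exists>q\<in>proj_space 5.
     \<not> same_point p q \<and>
     singular_locus 5 F = {x. same_point p x \<or> same_point q x} \<and>
     D4_point F p \<and> D4_point F q)"


section \<open>Equivariant birational maps and linearizability\<close>

text \<open>The forms \<open>\<phi> 0, \<dots>, \<phi> (N - 1)\<close> in \<open>M\<close> variables and of a common degree are the
  components of a rational map; it is defined by them at the points where they do not all vanish.\<close>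

definition forms_map :: "nat \<Rightarrow> nat \<Rightarrow> (nat \<Rightarrow> 'a::zero mpoly) \<Rightarrow> bool" where
  "forms_map M N \<phi> \<longleftrightarrow> (\<exists>d. \<forall>j<N. homogeneous d (\<phi> j) \<and> vars (\<phi> j) \<subseteq> {..<M})"

definition apply_forms :: "nat \<Rightarrow> (nat \<Rightarrow> 'a::comm_ring_1 mpoly) \<Rightarrow> 'a vec \<Rightarrow> 'a vec" where
  "apply_forms N \<phi> x = vec N (\<lambda>j. eval_vec (\<phi> j) x)"

definition zariski_dense :: "nat \<Rightarrow> 'a::comm_ring_1 vec set \<Rightarrow> 'a vec set \<Rightarrow> bool" where
  "zariski_dense N U X \<longleftrightarrow> U \<subseteq> X \<and>
     (\<forall>d F. homogeneous d F \<longrightarrow> vars F \<subseteq> {..<N} \<longrightarrow>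
        (\<forall>x\<in>U. eval_vec F x = 0) \<longrightarrow> (\<forall>x\<in>X. eval_vec F x = 0))"

text \<open>\<open>X\<close> and \<open>Y\<close> are closed subvarieties of projective spaces with homogeneous coordinates of
  dimensions \<open>M\<close> and \<open>N\<close>, on which \<open>G\<close> acts through the matrices \<open>\<alpha> g\<close> and \<open>\<beta> g\<close>.  The
  rational maps \<open>\<phi>\<close> and \<open>\<psi>\<close> are mutually inverse on dense open subsets; equivariance of \<open>\<psi>\<close>
  follows from that of \<open>\<phi>\<close>.\<close>

definition equivariantly_birational ::
  "('g, 'z) monoid_scheme \<Rightarrow> nat \<Rightarrow> ('g \<Rightarrow> 'a::field mat) \<Rightarrow> 'a vec set \<Rightarrow>
   nat \<Rightarrow> ('g \<Rightarrow> 'a mat) \<Rightarrow> 'a vec set \<Rightarrow> bool" where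
  "equivariantly_birational G M \<alpha> X N \<beta> Y \<longleftrightarrow> (\<exists>\<phi> \<psi>.
     forms_map M N \<phi> \<and> forms_map N M \<psi> \<and>
     (\<forall>x\<in>X. apply_forms N \<phi> x \<noteq> 0\<^sub>v N \<longrightarrow> apply_forms N \<phi> x \<in> Y) \<and>
     (\<forall>y\<in>Y. apply_forms M \<psi> y \<noteq> 0\<^sub>v M \<longrightarrow> apply_forms M \<psi> y \<in> X) \<and>
     zariski_dense M {x\<in>X. apply_forms N \<phi> x \<noteq> 0\<^sub>v N \<and>
                           apply_forms M \<psi> (apply_forms N \<phi> x) \<noteq> 0\<^sub>v M} X \<and>
     zariski_dense N {y\<in>Y. apply_forms M \<psi> y \<noteq> 0\<^sub>v M \<and>
                           apply_forms N \<phi> (apply_forms M \<psi> y) \<noteq> 0\<^sub>v N} Y \<and>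
     (\<forall>x\<in>X. apply_forms N \<phi> x \<noteq> 0\<^sub>v N \<longrightarrow>
        apply_forms M \<psi> (apply_forms N \<phi> x) \<noteq> 0\<^sub>v M \<longrightarrow>
        same_point x (apply_forms M \<psi> (apply_forms N \<phi> x))) \<and>
     (\<forall>y\<in>Y. apply_forms M \<psi> y \<noteq> 0\<^sub>v M \<longrightarrow>
        apply_forms N \<phi> (apply_forms M \<psi> y) \<noteq> 0\<^sub>v N \<longrightarrow>
        same_point y (apply_forms N \<phi> (apply_forms M \<psi> y))) \<and>
     (\<forall>g\<in>carrier G. \<forall>x\<in>X. apply_forms N \<phi> x \<noteq> 0\<^sub>v N \<longrightarrow>
        apply_forms N \<phi> (\<alpha> g *\<^sub>v x) \<noteq> 0\<^sub>v N \<longrightarrow>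
        same_point (\<beta> g *\<^sub>v apply_forms N \<phi> x) (apply_forms N \<phi> (\<alpha> g *\<^sub>v x))))"

definition GL :: "nat \<Rightarrow> 'a::field mat monoid" where
  "GL N = units_of (ring_mat TYPE('a) N ())"

text \<open>A linear representation of \<open>G\<close> of dimension \<open>d\<close> is, after the choice of a basis, a
  homomorphism to \<open>GL d\<close>.\<close>

definition linearizable ::
  "('g, 'z) monoid_scheme \<Rightarrow> nat \<Rightarrow> ('g \<Rightarrow> 'a::field mat) \<Rightarrow> 'a vec set \<Rightarrow> bool" where
  "linearizable G M \<alpha> X \<longleftrightarrow>
     (\<exists>d \<rho>. \<rho> \<in> hom G (GL d) \<and> equivariantly_birational G M \<alpha> X d \<rho> (proj_space d))"


section \<open>The cubic threefolds and the dihedral group\<close>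

definition cubic_2D4 :: "'a::field mpoly \<Rightarrow> 'a mpoly" where
  "cubic_2D4 f3 = Var 0 * Var 1 * Var 2 + f3"

definition sigma12 :: "'a::field mat" where
  "sigma12 = mat_of_rows_list 5
     [[0, 1, 0, 0, 0],
      [1, 0, 0, 0, 0],
      [0, 0, 1, 0, 0],
      [0, 0, 0, 1, 0],
      [0, 0, 0, 0, 1]]"

definition tau :: "'a::field \<Rightarrow> 'a mat" where
  "tau a = mat_of_rows_list 5
     [[a, 0, 0, 0, 0],
      [0, inverse a, 0, 0, 0],
      [0, 0, 1, 0, 0],
      [0, 0, 0, 1, 0],
      [0, 0, 0, 0, 1]]"

lemma in_GL_if_mult:
  assumes "A \<in> carrier_mat N N" "B \<in> carrier_mat N N" "A * B = 1\<^sub>m N" "B * A = 1\<^sub>m N"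
  shows "A \<in> carrier (GL N)"
  using assms unfolding GL_def units_of_def Units_def ring_mat_def by fastforce

lemma mat_mult_5:
  "mat 5 5 f * mat 5 5 g = mat 5 5 (\<lambda>(i, j). \<Sum>k = 0..<5. f (i, k) * (g (k, j) :: 'a::field))"
  by (rule eq_matI) (simp_all add: scalar_prod_def)

lemma sum_below_5: "(\<Sum>k = 0..<5. f k) = (f 0 + f 1 + f 2 + f 3 + f (4 :: nat) :: 'a :: field)"
  by (simp add: eval_nat_numeral)

lemma less_5_cases: "i < 5 \<Longrightarrow> i = 0 \<or> i = 1 \<or> i = 2 \<or> i = 3 \<or> i = (4 :: nat)"
  by arith

lemma sigma12_mat: "sigma12 = mat 5 5 (\<lambda>(i, j). [[0, 1, 0, 0, 0], [1, 0, 0, 0, 0],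
      [0, 0, 1, 0, 0], [0, 0, 0, 1, 0], [0, 0, 0, 0, 1]] ! i ! j)"
  by (simp add: sigma12_def mat_of_rows_list_def eval_nat_numeral)

lemma tau_mat: "tau a = mat 5 5 (\<lambda>(i, j). [[a, 0, 0, 0, 0], [0, inverse a, 0, 0, 0],
      [0, 0, 1, 0, 0], [0, 0, 0, 1, 0], [0, 0, 0, 0, 1]] ! i ! j)"
  by (simp add: tau_def mat_of_rows_list_def eval_nat_numeral)

lemma sigma12_carrier: "sigma12 \<in> carrier_mat 5 5"
  unfolding sigma12_mat by simp

lemma tau_carrier: "tau a \<in> carrier_mat 5 5"
  unfolding tau_mat by simp

lemma sigma12_sq: "sigma12 * sigma12 = (1\<^sub>m 5 :: 'a::field mat)"
  unfolding sigma12_mat mat_mult_5 one_mat_def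
  apply (rule cong_mat[OF refl refl])
  apply (drule less_5_cases)+
  apply (elim disjE; hypsubst)
  apply (simp_all only: prod.case sum_below_5)
  apply simp_all
  done

lemma tau_mult_inverse:
  assumes "a \<noteq> 0"
  shows "tau a * tau (inverse a) = 1\<^sub>m 5"
  unfolding tau_mat mat_mult_5 one_mat_def
  apply (rule cong_mat[OF refl refl])
  apply (drule less_5_cases)+
  apply (elim disjE; hypsubst)
  apply (simp_all only: prod.case sum_below_5)
  apply (simp_all add: assms)
  done

lemma sigma12_in_GL: "sigma12 \<in> carrier (GL 5)"
  by (rule in_GL_if_mult[OF sigma12_carrier sigma12_carrier sigma12_sq sigma12_sq])

lemma tau_in_GL: assumes "a \<noteq> 0" shows "tau a \<in> carrier (GL 5)"
proof -
  have "tau (inverse a) * tau a = 1\<^sub>m 5"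
    using tau_mult_inverse[of "inverse a"] assms by simp
  then show ?thesis
    using in_GL_if_mult[OF tau_carrier tau_carrier tau_mult_inverse[OF assms]] by blast
qed

text \<open>Both generators fix the last three coordinates, so the group they generate contains no
  nontrivial scalar matrix and is identified with its image in the projective linear group.\<close>

definition dihedral_group :: "'a::field \<Rightarrow> 'a mat monoid" where
  "dihedral_group a = subgroup_generated (GL 5) {sigma12, tau a}"

definition primitive_root_of_unity :: "nat \<Rightarrow> 'a::field \<Rightarrow> bool" where
  "primitive_root_of_unity m a \<longleftrightarrow> 0 < m \<and> a ^ m = 1 \<and> (\<forall>l. 0 < l \<and> l < m \<longrightarrow> a ^ l \<noteq> 1)"

end

theory Submission
  imports Defs
    "HOL-Computational_Algebra.Polynomial_FPS"
    "Jordan_Normal_Form.Determinant"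
begin

text \<open>Since the singular locus consists of two points, the plane curve \<open>E = {f = 0}\<close> is a smooth
  cubic.  It is fixed pointwise by the dihedral group, and blowing it up gives a divisor on which the
  central involution acts trivially, while the rotation moves the points of the exceptional lines.

  In a linear representation of dimension 4 choose conjugate eigenforms \<open>l\<^sub>0\<close>, \<open>l\<^sub>1\<close> of the rotation
  and a form \<open>l\<^sub>2\<close> on which the central involution has the opposite sign.  Along the exceptional divisor
  the order of \<open>l\<^sub>0 / l\<^sub>1\<close> vanishes because the reflection inverts this function, its value is not
  constant on the exceptional lines because the rotation multiplies it by a nontrivial scalar, and the
  order of \<open>l\<^sub>2 / l\<^sub>1\<close> is odd.  Hence a general point of \<open>E\<close> is the limit of an arc along which
  \<open>l\<^sub>0 / l\<^sub>1\<close> is a fixed number and \<open>l\<^sub>2 / l\<^sub>1\<close> is, after a change of the parameter, a power of the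
  parameter.  Let \<open>K\<close> be a countable algebraically closed field of definition.  Then the limit lies
  in \<open>E(K(z))\<close> for a single transcendental \<open>z\<close>, thus in \<open>E(K)\<close>, since \<open>E\<close> contains no rational
  curve.  But the ground field is uncountable, so \<open>E\<close> has points outside \<open>E(K)\<close>.\<close>

section \<open>Evaluation of polynomials\<close>

text \<open>The limit of an arc is forced into \<open>E(K)\<close> only if the coordinates along the
  arc involve at most one element transcendental over \<open>K((s))\<close>, so three of four
  coordinates have to be normalized. The equation between the first two forms uses a natural number,
  which lies in \<open>K\<close> whatever \<open>K\<close> is. Different orders of the second and
  third form allow a parameter in which both are powers times the same unit, and homogeneity removes
  the unit. Only the fourth form stays arbitrary.

  The divisor itself is never constructed. Its order and residue are the order in \<open>s\<close>
  and the reduction modulo \<open>s\<close> of polynomials in \<open>t\<close> over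
  \<open>k[[s]]\<close>, where \<open>t\<close> is the position on an exceptional line. Identities
  known at the points of \<open>X\<close> reach these rings through arcs that are polynomial in
  \<open>s\<close> and \<open>t\<close>.

  A general point of \<open>E\<close> is made explicit by lines of a fixed direction \<delta> in
  \<open>K\<close>, numbered by \<alpha> outside \<open>K\<close>: a point of such a line with
  coordinates in \<open>K\<close> would put \<alpha> into \<open>K\<close>.

  The dimension of the representation is not prescribed; a tangent argument bounds it by 4.\<close>

abbreviation value_at :: "(nat \<Rightarrow> 'a::comm_ring_1) \<Rightarrow> 'a mpoly \<Rightarrow> 'a" where
  "value_at \<equiv> eval_mpoly (\<lambda>c. c)"

abbreviation subst_polys :: "(nat \<Rightarrow> 'a::comm_ring_1 poly) \<Rightarrow> 'a mpoly \<Rightarrow> 'a poly" where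
  "subst_polys \<equiv> eval_mpoly (\<lambda>c. [:c:])"

lemma comm_ring_hom_id: "comm_ring_hom (\<lambda>c. c :: 'a::comm_ring_1)"
  by unfold_locales auto

lemma comm_ring_hom_const_poly: "comm_ring_hom (\<lambda>c :: 'a::comm_ring_1. [:c:])"
  by unfold_locales (auto simp: one_pCons)

lemma comm_ring_hom_fps_const: "comm_ring_hom (fps_const :: 'a::comm_ring_1 \<Rightarrow> 'a fps)"
  by unfold_locales auto

lemma comm_ring_hom_comp:
  assumes "comm_ring_hom f" "comm_ring_hom g"
  shows "comm_ring_hom (\<lambda>c. f (g c))"
proof -
  interpret f: comm_ring_hom f by fact
  interpret g: comm_ring_hom g by fact
  show ?thesis
    by unfold_locales (simp_all add: g.hom_add f.hom_add g.hom_mult f.hom_mult)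
qed

lemma comm_ring_hom_poly_eval: "comm_ring_hom (\<lambda>p. poly p (c :: 'a::comm_ring_1))"
  by unfold_locales auto

text \<open>Evaluating at a point, reducing modulo \<open>s\<close> and passing from polynomials to
  power series are all ring homomorphisms, so this one rule moves every such specialization inside a
  form.\<close>

lemma eval_mpoly_hom:
  assumes "comm_ring_hom g"
  shows "g (eval_mpoly h x p) = eval_mpoly (\<lambda>c. g (h c)) (\<lambda>i. g (x i)) p"
proof -
  interpret g: comm_ring_hom g by fact
  show ?thesis
    unfolding eval_mpoly_def by (simp add: g.hom_sum g.hom_mult g.hom_prod g.hom_power)
qed

lemma eval_mpoly_cong:
  assumes "\<And>i. i \<in> vars p \<Longrightarrow> x i = y i" "\<And>c. h c = k c"
  shows "eval_mpoly h x p = eval_mpoly k y p"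
  unfolding eval_mpoly_def
  by (intro sum.cong prod.cong arg_cong2[of _ _ _ _ "(*)"] refl)
     (use assms in \<open>auto simp: vars_def intro!: arg_cong2[of _ _ _ _ "(^)"]\<close>)

lemma eval_mpoly_scale:
  assumes "homogeneous d p"
  shows "eval_mpoly h (\<lambda>i. c * x i) p = c ^ d * eval_mpoly h x p"
proof -
  have "(\<Prod>i\<in>Poly_Mapping.keys m. (c * x i) ^ Poly_Mapping.lookup m i) =
      c ^ d * (\<Prod>i\<in>Poly_Mapping.keys m. x i ^ Poly_Mapping.lookup m i)"
    if "m \<in> Poly_Mapping.keys p" for m
  proof -
    have "d = (\<Sum>i\<in>Poly_Mapping.keys m. Poly_Mapping.lookup m i)"
      using assms that unfolding homogeneous_def by auto
    then show ?thesis
      by (simp add: power_mult_distrib prod.distrib power_sum)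
  qed
  then show ?thesis
    unfolding eval_mpoly_def sum_distrib_left by (intro sum.cong) auto
qed

lemma eval_mpoly_superset:
  assumes "finite A" "Poly_Mapping.keys p \<subseteq> A" "h 0 = 0"
  shows "eval_mpoly h x p = (\<Sum>m\<in>A. h (Poly_Mapping.lookup p m) *
    (\<Prod>i\<in>Poly_Mapping.keys m. x i ^ Poly_Mapping.lookup m i))"
  unfolding eval_mpoly_def
  by (rule sum.mono_neutral_left) (use assms in \<open>auto simp: in_keys_iff\<close>)

lemma eval_mpoly_add:
  assumes "comm_ring_hom h"
  shows "eval_mpoly h x (p + q) = eval_mpoly h x p + eval_mpoly h x q"
proof -
  interpret comm_ring_hom h by fact
  let ?A = "Poly_Mapping.keys p \<union> Poly_Mapping.keys q"
  have "finite ?A" by simp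
  note e = eval_mpoly_superset[where h = h and x = x, OF this _ hom_zero]
  show ?thesis
    by (subst (1 2 3) e)
       (auto simp: keys_add lookup_add hom_add distrib_right sum.distrib
         dest: subsetD[OF keys_add])
qed

lemma eval_mpoly_zero [simp]: "eval_mpoly h x 0 = 0"
  by (simp add: eval_mpoly_def)

lemma eval_mpoly_sum:
  assumes "comm_ring_hom h"
  shows "eval_mpoly h x (\<Sum>m\<in>A. f m) = (\<Sum>m\<in>A. eval_mpoly h x (f m))"
  by (induction A rule: infinite_finite_induct) (auto simp: eval_mpoly_add[OF assms])

lemma eval_mpoly_single:
  assumes "h 0 = 0"
  shows "eval_mpoly h x (Poly_Mapping.single m c) =
    h c * (\<Prod>i\<in>Poly_Mapping.keys m. x i ^ Poly_Mapping.lookup m i)"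
  by (cases "c = 0") (auto simp: eval_mpoly_def assms)

section \<open>The monomial of the cubic threefold\<close>

lemma monomial_3:
  "Var 0 * Var 1 * Var 2 = (Poly_Mapping.single
    (Poly_Mapping.single 0 1 + Poly_Mapping.single 1 1 + Poly_Mapping.single 2 1) 1
    :: 'a::comm_ring_1 mpoly)"
  by (simp add: Var_def mult_single)

lemma keys_monomial_3:
  "Poly_Mapping.keys (Poly_Mapping.single 0 1 + Poly_Mapping.single 1 1 +
     Poly_Mapping.single 2 1 :: nat \<Rightarrow>\<^sub>0 nat) = {0, 1, 2}"
  by (auto simp: in_keys_iff lookup_add lookup_single when_def split: if_splits)

lemma eval_monomial_3:
  assumes "comm_ring_hom h"
  shows "eval_mpoly h x (Var 0 * Var 1 * Var 2) = x 0 * x 1 * x 2"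
proof -
  interpret comm_ring_hom h by fact
  show ?thesis
    unfolding monomial_3
    by (subst eval_mpoly_single, rule hom_zero, unfold keys_monomial_3)
       (simp add: lookup_add lookup_single when_def mult.assoc)
qed

lemma homogeneous_monomial_3: "homogeneous 3 (Var 0 * Var 1 * Var 2 :: 'a::comm_ring_1 mpoly)"
  unfolding monomial_3 homogeneous_def keys_single
  by (simp add: keys_monomial_3[unfolded One_nat_def] lookup_add lookup_single when_def)

lemma vars_monomial_3: "vars (Var 0 * Var 1 * Var 2 :: 'a::comm_ring_1 mpoly) \<subseteq> {0, 1, 2}"
  unfolding monomial_3 vars_def keys_single
  by (simp add: keys_monomial_3[unfolded One_nat_def])

lemma eval_cubic_2D4:
  assumes "comm_ring_hom h"
  shows "eval_mpoly h x (cubic_2D4 f) = x 0 * x 1 * x 2 + eval_mpoly h x f"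
  unfolding cubic_2D4_def by (simp only: eval_mpoly_add[OF assms] eval_monomial_3[OF assms])

text \<open>Substitution uses only ring operations, hence respects congruences modulo
  \<open>m\<close>. Taken modulo the square of a parameter, it becomes a first-order
  calculation.\<close>

lemma eval_mpoly_diff_dvd:
  fixes m :: "'b::comm_ring_1"
  assumes "\<And>i. i \<in> vars p \<Longrightarrow> m dvd x i - y i"
  shows "m dvd eval_mpoly h x p - eval_mpoly h y p"
proof -
  have pow: "m dvd a ^ n - b ^ n" if "m dvd a - b" for a b :: 'b and n
  proof (induction n)
    case (Suc n)
    have "a ^ Suc n - b ^ Suc n = a * (a ^ n - b ^ n) + (a - b) * b ^ n"
      by (simp add: algebra_simps)
    then show ?case using Suc that by (auto intro: dvd_add dvd_mult dvd_mult2)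
  qed auto
  have prd: "m dvd (\<Prod>i\<in>A. f i) - (\<Prod>i\<in>A. g i)" if "\<And>i. i \<in> A \<Longrightarrow> m dvd f i - g i"
    for A :: "nat set" and f g :: "nat \<Rightarrow> 'b"
    using that
  proof (induction A rule: infinite_finite_induct)
    case (insert i A)
    have "f i * prod f A - g i * prod g A = f i * (prod f A - prod g A) + (f i - g i) * prod g A"
      by (simp add: algebra_simps)
    then show ?case using insert by (auto intro: dvd_add dvd_mult dvd_mult2)
  qed auto
  show ?thesis
    unfolding eval_mpoly_def sum_subtractf[symmetric] right_diff_distrib[symmetric]
    by (intro dvd_sum dvd_mult prd pow) (use assms in \<open>auto simp: vars_def\<close>)
qed

section \<open>Partial derivatives, chain rule and Euler identity\<close>

lemma eval_partial_deriv:
  assumes "comm_ring_hom h"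
  shows "eval_mpoly h x (partial_deriv i p) = (\<Sum>m\<in>Poly_Mapping.keys p.
    of_nat (Poly_Mapping.lookup m i) * h (Poly_Mapping.lookup p m) *
    (x i ^ (Poly_Mapping.lookup m i - 1) *
      (\<Prod>j\<in>Poly_Mapping.keys m - {i}. x j ^ Poly_Mapping.lookup m j)))"
proof -
  interpret comm_ring_hom h by fact
  \<comment> \<open>Subtraction of exponents is truncated: if \<open>i\<close> does not occur in
    \<open>m\<close>, the monomial stays \<open>m\<close>, and its coefficient
    \<open>of_nat 0\<close> removes it from the derivative.\<close>
  have aux: "(\<Prod>j\<in>Poly_Mapping.keys (m - Poly_Mapping.single i 1).
      x j ^ Poly_Mapping.lookup (m - Poly_Mapping.single i 1) j) =
    x i ^ (Poly_Mapping.lookup m i - 1) *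
      (\<Prod>j\<in>Poly_Mapping.keys m - {i}. x j ^ Poly_Mapping.lookup m j)"
    for m :: "nat \<Rightarrow>\<^sub>0 nat"
  proof -
    let ?m = "m - Poly_Mapping.single i 1"
    let ?B = "insert i (Poly_Mapping.keys m)"
    have "(\<Prod>j\<in>Poly_Mapping.keys ?m. x j ^ Poly_Mapping.lookup ?m j) =
        (\<Prod>j\<in>?B. x j ^ Poly_Mapping.lookup ?m j)"
      by (rule prod.mono_neutral_left) (auto simp: in_keys_iff lookup_minus)
    also have "\<dots> = x i ^ Poly_Mapping.lookup ?m i *
        (\<Prod>j\<in>Poly_Mapping.keys m - {i}. x j ^ Poly_Mapping.lookup ?m j)"
      by (subst prod.insert_remove) auto
    also have "(\<Prod>j\<in>Poly_Mapping.keys m - {i}. x j ^ Poly_Mapping.lookup ?m j) =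
        (\<Prod>j\<in>Poly_Mapping.keys m - {i}. x j ^ Poly_Mapping.lookup m j)"
      by (rule prod.cong) (auto simp: lookup_minus lookup_single when_def)
    finally show ?thesis by (simp add: lookup_minus)
  qed
  show ?thesis
    unfolding partial_deriv_def eval_mpoly_sum[OF assms] eval_mpoly_single[of h, OF hom_zero] aux
    by (simp add: hom_mult hom_of_nat mult.assoc)
qed

lemma pderiv_finite_sum: "pderiv (\<Sum>i\<in>A. f i) = (\<Sum>i\<in>A. pderiv (f i))"
  by (induction A rule: infinite_finite_induct) (auto simp: pderiv_add)

text \<open>The chain rule along a polynomial arc. Statements on gradients are read off from
  derivatives in one variable through it.\<close>

lemma pderiv_eval_mpoly:
  fixes x :: "nat \<Rightarrow> 'a::{comm_ring_1, semiring_no_zero_divisors, field_char_0} poly"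
  assumes "finite I" "vars p \<subseteq> I"
  shows "pderiv (subst_polys x p) =
    (\<Sum>i\<in>I. subst_polys x (partial_deriv i p) * pderiv (x i))"
proof -
  have mono: "pderiv (\<Prod>j\<in>Poly_Mapping.keys m. x j ^ Poly_Mapping.lookup m j) =
     (\<Sum>i\<in>I. of_nat (Poly_Mapping.lookup m i) * (x i ^ (Poly_Mapping.lookup m i - 1) *
      (\<Prod>j\<in>Poly_Mapping.keys m - {i}. x j ^ Poly_Mapping.lookup m j)) * pderiv (x i))"
    if m: "m \<in> Poly_Mapping.keys p" for m
  proof -
    have sub: "Poly_Mapping.keys m \<subseteq> I" using m assms(2) by (auto simp: vars_def)
    have "pderiv (\<Prod>j\<in>Poly_Mapping.keys m. x j ^ Poly_Mapping.lookup m j) =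
      (\<Sum>i\<in>Poly_Mapping.keys m. prod (\<lambda>j. x j ^ Poly_Mapping.lookup m j)
         (Poly_Mapping.keys m - {i}) * pderiv (x i ^ Poly_Mapping.lookup m i))"
      by (rule pderiv_prod)
    also have "\<dots> = (\<Sum>i\<in>Poly_Mapping.keys m. of_nat (Poly_Mapping.lookup m i) *
      (x i ^ (Poly_Mapping.lookup m i - 1) *
      (\<Prod>j\<in>Poly_Mapping.keys m - {i}. x j ^ Poly_Mapping.lookup m j)) * pderiv (x i))"
    proof (rule sum.cong[OF refl])
      fix i assume "i \<in> Poly_Mapping.keys m"
      then obtain k where "Poly_Mapping.lookup m i = Suc k"
        by (metis in_keys_iff not0_implies_Suc)
      then show "prod (\<lambda>j. x j ^ Poly_Mapping.lookup m j) (Poly_Mapping.keys m - {i}) *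
          pderiv (x i ^ Poly_Mapping.lookup m i) = of_nat (Poly_Mapping.lookup m i) *
        (x i ^ (Poly_Mapping.lookup m i - 1) *
        (\<Prod>j\<in>Poly_Mapping.keys m - {i}. x j ^ Poly_Mapping.lookup m j)) * pderiv (x i)"
        by (simp add: pderiv_power_Suc of_nat_poly ac_simps del: of_nat_Suc power_Suc)
    qed
    also have "\<dots> = (\<Sum>i\<in>I. of_nat (Poly_Mapping.lookup m i) *
      (x i ^ (Poly_Mapping.lookup m i - 1) *
      (\<Prod>j\<in>Poly_Mapping.keys m - {i}. x j ^ Poly_Mapping.lookup m j)) * pderiv (x i))"
      by (rule sum.mono_neutral_left) (use assms(1) sub in \<open>auto simp: in_keys_iff\<close>)
    finally show ?thesis .
  qed
  have "pderiv (subst_polys x p) = (\<Sum>m\<in>Poly_Mapping.keys p.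
     [:Poly_Mapping.lookup p m:] *
     pderiv (\<Prod>j\<in>Poly_Mapping.keys m. x j ^ Poly_Mapping.lookup m j))"
    unfolding eval_mpoly_def by (simp add: pderiv_finite_sum pderiv_smult)
  also have "\<dots> = (\<Sum>i\<in>I. \<Sum>m\<in>Poly_Mapping.keys p. [:Poly_Mapping.lookup p m:] *
      (of_nat (Poly_Mapping.lookup m i) * (x i ^ (Poly_Mapping.lookup m i - 1) *
      (\<Prod>j\<in>Poly_Mapping.keys m - {i}. x j ^ Poly_Mapping.lookup m j)) * pderiv (x i)))"
    by (subst sum.swap, rule sum.cong[OF refl]) (simp only: mono sum_distrib_left)
  also have "\<dots> = (\<Sum>i\<in>I. subst_polys x (partial_deriv i p) * pderiv (x i))"
    unfolding eval_partial_deriv[OF comm_ring_hom_const_poly] sum_distrib_right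
    by (intro sum.cong refl) (simp only: ac_simps)
  finally show ?thesis .
qed

lemma homogeneous_partial_deriv:
  assumes "homogeneous (Suc d) p"
  shows "homogeneous d (partial_deriv i p)"
  unfolding homogeneous_def
proof
  fix m assume "m \<in> Poly_Mapping.keys (partial_deriv i p)"
  then have "Poly_Mapping.lookup (partial_deriv i p) m \<noteq> 0" by (simp add: in_keys_iff)
  then obtain n where n: "n \<in> Poly_Mapping.keys p"
    "Poly_Mapping.lookup (Poly_Mapping.single (n - Poly_Mapping.single i 1)
       (of_nat (Poly_Mapping.lookup n i) * Poly_Mapping.lookup p n)) m \<noteq> 0"
    unfolding partial_deriv_def lookup_sum by (meson sum.not_neutral_contains_not_neutral)
  then have m: "m = n - Poly_Mapping.single i 1" and i: "Poly_Mapping.lookup n i \<noteq> 0"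
    using n(2) by (auto simp: lookup_single when_def split: if_splits intro!: gr0I)
  have "(\<Sum>j\<in>Poly_Mapping.keys m. Poly_Mapping.lookup m j) =
    (\<Sum>j\<in>Poly_Mapping.keys n. Poly_Mapping.lookup m j)"
    by (rule sum.mono_neutral_left) (auto simp: m in_keys_iff lookup_minus)
  moreover have "i \<in> Poly_Mapping.keys n" using i by (simp add: in_keys_iff)
  then have "(\<Sum>j\<in>Poly_Mapping.keys n. Poly_Mapping.lookup n j) =
      Poly_Mapping.lookup n i + (\<Sum>j\<in>Poly_Mapping.keys n - {i}. Poly_Mapping.lookup n j)"
    "(\<Sum>j\<in>Poly_Mapping.keys n. Poly_Mapping.lookup m j) =
      Poly_Mapping.lookup m i + (\<Sum>j\<in>Poly_Mapping.keys n - {i}. Poly_Mapping.lookup m j)"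
    by (auto simp: sum.remove)
  moreover have "(\<Sum>j\<in>Poly_Mapping.keys n - {i}. Poly_Mapping.lookup m j) =
     (\<Sum>j\<in>Poly_Mapping.keys n - {i}. Poly_Mapping.lookup n j)"
    by (rule sum.cong) (auto simp: m lookup_minus lookup_single)
  moreover have "(\<Sum>j\<in>Poly_Mapping.keys n. Poly_Mapping.lookup n j) = Suc d"
    using assms n(1) by (auto simp: homogeneous_def)
  moreover have "Poly_Mapping.lookup m i = Poly_Mapping.lookup n i - 1"
    by (simp add: m lookup_minus)
  ultimately show "(\<Sum>j\<in>Poly_Mapping.keys m. Poly_Mapping.lookup m j) = d"
    using i by simp
qed

lemma vars_partial_deriv: "vars (partial_deriv i p) \<subseteq> vars p"
proof
  fix j assume "j \<in> vars (partial_deriv i p)"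
  then obtain m where m: "m \<in> Poly_Mapping.keys (partial_deriv i p)" "j \<in> Poly_Mapping.keys m"
    by (auto simp: vars_def)
  then have "Poly_Mapping.lookup (partial_deriv i p) m \<noteq> 0" by (simp add: in_keys_iff)
  then obtain n where n: "n \<in> Poly_Mapping.keys p"
    "Poly_Mapping.lookup (Poly_Mapping.single (n - Poly_Mapping.single i 1)
       (of_nat (Poly_Mapping.lookup n i) * Poly_Mapping.lookup p n)) m \<noteq> 0"
    unfolding partial_deriv_def lookup_sum by (meson sum.not_neutral_contains_not_neutral)
  then have "m = n - Poly_Mapping.single i 1"
    by (auto simp: lookup_single when_def split: if_splits)
  with m(2) have "j \<in> Poly_Mapping.keys n" by (auto simp: in_keys_iff lookup_minus)
  with n(1) show "j \<in> vars p" by (auto simp: vars_def)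
qed

section \<open>Smooth plane cubics contain no rational curves\<close>

lemma alg_closed_root:
  fixes p :: "'a::alg_closed_field poly"
  assumes "degree p > 0"
  shows "\<exists>z. poly p z = 0"
  using assms alg_closed_imp_poly_has_root by blast

text \<open>Common roots are divided out one at a time while the degree of the nonzero member
  \<open>P i0\<close> drops. Coprimality is expressed by the absence of common roots, so that the
  \<open>p i\<close> define a projective point for every parameter value.\<close>

lemma common_factor:
  fixes P :: "nat \<Rightarrow> 'a::field poly"
  assumes "i0 \<in> I" "P i0 \<noteq> 0"
  shows "\<exists>H p. H \<noteq> 0 \<and> (\<forall>i\<in>I. P i = H * p i) \<and> (\<forall>z. \<exists>i\<in>I. poly (p i) z \<noteq> 0)"
  using assms(2)
proof (induction "degree (P i0)" arbitrary: P rule: less_induct)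
  case less
  show ?case
  proof (cases "\<forall>z. \<exists>i\<in>I. poly (P i) z \<noteq> 0")
    case True
    then show ?thesis by (intro exI[of _ 1] exI[of _ P]) auto
  next
    case False
    then obtain z where z: "\<And>i. i \<in> I \<Longrightarrow> poly (P i) z = 0" by auto
    define Q where "Q i = P i div [:-z, 1:]" for i
    have Q: "P i = [:-z, 1:] * Q i" if "i \<in> I" for i
      using z[OF that] unfolding Q_def poly_eq_0_iff_dvd by (metis dvd_mult_div_cancel)
    have "Q i0 \<noteq> 0" using Q[OF assms(1)] less.prems by auto
    then have "degree (Q i0) < degree (P i0)"
      unfolding Q[OF assms(1)] by (subst degree_mult_eq) auto
    from less.hyps[of Q, OF this \<open>Q i0 \<noteq> 0\<close>] obtain H p where
      "H \<noteq> 0" "\<forall>i\<in>I. Q i = H * p i" "\<forall>z. \<exists>i\<in>I. poly (p i) z \<noteq> 0" by auto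
    then show ?thesis
      by (intro exI[of _ "[:-z, 1:] * H"] exI[of _ p]) (auto simp: Q mult.assoc simp del: mult_pCons_left)
  qed
qed

text \<open>A root of \<open>q\<close> is a root of \<open>w\<close>, because some
  \<open>g i\<close> does not vanish there; the linear factor is cancelled and the degree of
  \<open>q\<close> drops.\<close>

lemma dvd_if_no_common_root:
  fixes q w :: "'a::alg_closed_field poly"
  assumes "\<And>z. \<exists>i\<in>I. poly (g i) z \<noteq> 0" "\<And>i. i \<in> I \<Longrightarrow> q dvd w * g i"
  shows "q dvd w"
  using assms(2)
proof (induction "degree q" arbitrary: q w rule: less_induct)
  case less
  show ?case
  proof (cases "degree q = 0")
    case True
    show ?thesis
    proof (cases "q = 0")
      case True
      obtain i where "i \<in> I" "poly (g i) 0 \<noteq> 0" using assms(1) by blast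
      then show ?thesis using less.prems[of i] True by auto
    next
      case False
      then show ?thesis using True by (metis is_unit_iff_degree unit_imp_dvd)
    qed
  next
    case False
    then obtain z where z: "poly q z = 0" using alg_closed_root by blast
    obtain i where i: "i \<in> I" "poly (g i) z \<noteq> 0" using assms(1) by blast
    have "poly (w * g i) z = 0" using less.prems[OF i(1)] z by (metis dvdE mult_zero_left poly_mult)
    then have "poly w z = 0" using i by simp
    then obtain w' where w': "w = [:-z, 1:] * w'" by (auto simp: poly_eq_0_iff_dvd)
    obtain q' where q': "q = [:-z, 1:] * q'" using z by (auto simp: poly_eq_0_iff_dvd)
    have "q' \<noteq> 0" using False q' by auto
    then have "degree q' < degree q" unfolding q' by (subst degree_mult_eq) auto
    moreover have "q' dvd w' * g i" if "i \<in> I" for i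
    proof -
      have "[:-z, 1:] * q' dvd [:-z, 1:] * (w' * g i)"
        using less.prems[OF that] unfolding q' w' by (simp only: mult.assoc)
      then show ?thesis by (subst (asm) dvd_mult_cancel_left) auto
    qed
    ultimately have "q' dvd w'" using less.hyps by blast
    then show ?thesis unfolding q' w' by (simp only: mult_dvd_mono dvd_refl)
  qed
qed

text \<open>Here \<open>a\<close> and \<open>b\<close> are only bounds for the degrees, so the
  coefficients may vanish. This allows coordinates of different degrees to be compared at
  infinity.\<close>

lemma coeff_mult_bounded:
  assumes "degree p \<le> a" "degree q \<le> b"
  shows "degree (p * q) \<le> a + b" "coeff (p * q) (a + b) = coeff p a * (coeff q b :: 'a::comm_ring_1)"
proof -
  show "degree (p * q) \<le> a + b" using degree_mult_le[of p q] assms by linarith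
  have "coeff (p * q) (a + b) = (\<Sum>i\<le>a + b. coeff p i * coeff q (a + b - i))"
    by (simp add: coeff_mult)
  also have "\<dots> = (\<Sum>i\<in>{a}. coeff p i * coeff q (a + b - i))"
  proof (rule sum.mono_neutral_right)
    show "\<forall>i\<in>{..a + b} - {a}. coeff p i * coeff q (a + b - i) = 0"
    proof
      fix i assume "i \<in> {..a + b} - {a}"
      then have "i > a \<or> a + b - i > b" by auto
      then show "coeff p i * coeff q (a + b - i) = 0"
        using assms by (auto simp: coeff_eq_0)
    qed
  qed auto
  finally show "coeff (p * q) (a + b) = coeff p a * coeff q b" by simp
qed

lemma coeff_power_bounded:
  assumes "degree p \<le> (a::nat)"
  shows "degree (p ^ n) \<le> n * a \<and> coeff (p ^ n) (n * a) = (coeff p a :: 'a::comm_ring_1) ^ n"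
proof (induction n)
  case (Suc n)
  then show ?case using coeff_mult_bounded[OF assms, of "p ^ n" "n * a"] by simp
qed auto

lemma coeff_prod_bounded:
  assumes "finite A" "\<And>i. i \<in> A \<Longrightarrow> degree (f i) \<le> (n i :: nat)"
  shows "degree (\<Prod>i\<in>A. f i) \<le> (\<Sum>i\<in>A. n i) \<and>
    coeff (\<Prod>i\<in>A. f i) (\<Sum>i\<in>A. n i) = (\<Prod>i\<in>A. coeff (f i) (n i) :: 'a::comm_ring_1)"
  using assms
proof (induction A rule: finite_induct)
  case (insert i A)
  then show ?case using coeff_mult_bounded[of "f i" "n i" "prod f A" "sum n A"] by simp
qed auto

text \<open>The coefficients of the \<open>x i\<close> in the common degree \<open>m\<close> are the
  coordinates of the point at infinity of the parametrized curve; the formula is the value of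
  \<open>p\<close> at that point.\<close>

lemma eval_mpoly_top_coeff:
  fixes x :: "nat \<Rightarrow> 'a::comm_ring_1 poly"
  assumes hom: "homogeneous e p" and deg: "\<And>i. i \<in> vars p \<Longrightarrow> degree (x i) \<le> m"
  shows "coeff (subst_polys x p) (e * m) = value_at (\<lambda>i. coeff (x i) m) p"
proof -
  have "coeff (\<Prod>i\<in>Poly_Mapping.keys n. x i ^ Poly_Mapping.lookup n i) (e * m) =
      (\<Prod>i\<in>Poly_Mapping.keys n. coeff (x i) m ^ Poly_Mapping.lookup n i)"
    if n: "n \<in> Poly_Mapping.keys p" for n
  proof -
    have e: "(\<Sum>i\<in>Poly_Mapping.keys n. Poly_Mapping.lookup n i) = e"
      using hom n by (auto simp: homogeneous_def)
    have d: "degree (x i) \<le> m" if "i \<in> Poly_Mapping.keys n" for i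
      using deg n that by (auto simp: vars_def)
    have "coeff (\<Prod>i\<in>Poly_Mapping.keys n. x i ^ Poly_Mapping.lookup n i)
        (\<Sum>i\<in>Poly_Mapping.keys n. Poly_Mapping.lookup n i * m) =
      (\<Prod>i\<in>Poly_Mapping.keys n. coeff (x i ^ Poly_Mapping.lookup n i) (Poly_Mapping.lookup n i * m))"
      using coeff_prod_bounded[of "Poly_Mapping.keys n" "\<lambda>i. x i ^ Poly_Mapping.lookup n i"
          "\<lambda>i. Poly_Mapping.lookup n i * m"] coeff_power_bounded[OF d] by auto
    also have "\<dots> = (\<Prod>i\<in>Poly_Mapping.keys n. coeff (x i) m ^ Poly_Mapping.lookup n i)"
      using coeff_power_bounded[OF d] by (intro prod.cong) auto
    finally show ?thesis by (simp add: sum_distrib_right[symmetric] e)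
  qed
  then show ?thesis unfolding eval_mpoly_def by (simp add: coeff_sum)
qed

lemma poly_eqI_infinite:
  fixes p q :: "'a::field_char_0 poly"
  assumes "\<And>z. poly p z = poly q z"
  shows "p = q"
  using assms poly_eq_poly_eq_iff[of p q] by auto

text \<open>Differentiate \<open>p(s x) = s^e p(x)\<close> with respect to \<open>s\<close> and put
  \<open>s = 1\<close>.\<close>

lemma euler_identity:
  fixes x :: "nat \<Rightarrow> 'a::field_char_0"
  assumes "finite I" "vars p \<subseteq> I" "homogeneous e p"
  shows "(\<Sum>i\<in>I. value_at x (partial_deriv i p) * x i) =
    of_nat e * value_at x p"
proof -
  let ?x = "\<lambda>i. [:0, 1:] * [:x i:]"
  have "subst_polys ?x p = [:0, 1:] ^ e * subst_polys (\<lambda>i. [:x i:]) p"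
    by (rule eval_mpoly_scale) fact
  also have "subst_polys (\<lambda>i. [:x i:]) p = [:value_at x p:]"
    by (rule eval_mpoly_hom[OF comm_ring_hom_const_poly, symmetric])
  finally have "pderiv ([:0, 1:] ^ e * [:value_at x p:]) =
     (\<Sum>i\<in>I. subst_polys ?x (partial_deriv i p) * pderiv (?x i))"
    using pderiv_eval_mpoly[OF assms(1,2), of ?x] by simp
  then have "poly (pderiv ([:0, 1:] ^ e * [:value_at x p:])) 1 =
     (\<Sum>i\<in>I. poly (subst_polys ?x (partial_deriv i p)) 1 * poly (pderiv (?x i)) 1)"
    by (simp add: poly_sum)
  also have "\<dots> = (\<Sum>i\<in>I. value_at x (partial_deriv i p) * x i)"
    by (subst eval_mpoly_hom[OF comm_ring_hom_poly_eval]) (simp add: pderiv_pCons)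
  also have "poly (pderiv ([:0, 1:] ^ e * [:value_at x p:])) 1 =
      of_nat e * value_at x p"
    by (cases e) (simp_all add: pderiv_mult pderiv_smult pderiv_power_Suc pderiv_pCons del: power_Suc of_nat_Suc)
  finally show ?thesis by simp
qed

text \<open>A critical point of \<open>f\<close> is automatically a zero of \<open>f\<close>, by the
  Euler identity in characteristic 0, so \<open>smooth\<close> says that the projective plane curve
  is smooth.\<close>

locale smooth_cubic =
  fixes f :: "'k::{alg_closed_field, field_char_0} mpoly"
  assumes hom: "homogeneous 3 f" and vars: "vars f \<subseteq> {2, 3, 4}"
    and smooth: "\<And>x. (\<And>i. i \<in> {2, 3, 4} \<Longrightarrow>
      value_at x (partial_deriv i f) = 0) \<Longrightarrow> x 2 = 0 \<and> x 3 = 0 \<and> x 4 = 0"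
begin

lemma hom_deriv: "homogeneous 2 (partial_deriv i f)"
  using homogeneous_partial_deriv[of 2 f i] hom by (simp add: numeral_3_eq_3 numeral_2_eq_2)

lemma vars_deriv: "vars (partial_deriv i f) \<subseteq> {2, 3, 4}"
  using vars_partial_deriv[of i f] vars by auto

text \<open>In essence, the regular differential of the cubic pulls back to the projective line,
  which carries none. For coprime coordinates \<open>p\<close>, both \<open>p\<close> and its
  derivative are orthogonal to the gradient \<open>g\<close> along \<open>p\<close>, so their cross
  product \<open>W\<close> is a multiple of \<open>g\<close>. By smoothness \<open>g\<close> has no
  zeros, and none at infinity either, where it has full degree \<open>2 * m\<close>; but
  \<open>W\<close> has degree below \<open>2 * m\<close>. Hence \<open>W = 0\<close>. The degree 3
  enters because the partial derivatives have degree 2.\<close>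

theorem rational_point_constant:
  fixes P :: "nat \<Rightarrow> 'k poly"
  assumes zero: "subst_polys P f = 0" and nz: "P 2 \<noteq> 0"
  shows "\<exists>H c. \<forall>i\<in>{2, 3, 4}. P i = Polynomial.smult (c i) H"
proof -
  obtain H p where H: "H \<noteq> 0" and P: "\<And>i. i \<in> {2, 3, 4} \<Longrightarrow> P i = H * p i"
    and coprime: "\<And>z. \<exists>i\<in>{2, 3, 4}. poly (p i) z \<noteq> 0"
    using common_factor[of 2 "{2, 3, 4}" P] nz by auto
  have "subst_polys P f = subst_polys (\<lambda>i. H * p i) f"
    by (rule eval_mpoly_cong) (use P vars in auto)
  then have fp: "subst_polys p f = 0"
    using zero H eval_mpoly_scale[OF hom, of "\<lambda>c. [:c:]" H p] by simp
  define g where "g i = subst_polys p (partial_deriv i f)" for i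
  have g_eval: "poly (g i) z = value_at (\<lambda>i. poly (p i) z) (partial_deriv i f)" for i z
    unfolding g_def by (subst eval_mpoly_hom[OF comm_ring_hom_poly_eval]) simp
  have gp': "g 2 * pderiv (p 2) + g 3 * pderiv (p 3) + g 4 * pderiv (p 4) = 0"
    using pderiv_eval_mpoly[OF _ vars, of p] fp by (simp add: g_def add.assoc)
  have gp: "g 2 * p 2 + g 3 * p 3 + g 4 * p 4 = 0"
  proof (rule poly_eqI_infinite)
    fix z
    have "value_at (\<lambda>i. poly (p i) z) f = poly (subst_polys p f) z"
      by (subst eval_mpoly_hom[OF comm_ring_hom_poly_eval]) simp
    then show "poly (g 2 * p 2 + g 3 * p 3 + g 4 * p 4) z = poly 0 z"
      using euler_identity[OF _ vars hom, of "\<lambda>i. poly (p i) z"] fp by (simp add: g_eval add.assoc)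
  qed
  have g_coprime: "\<exists>i\<in>{2, 3, 4}. poly (g i) z \<noteq> 0" for z
  proof (rule ccontr)
    assume "\<not> ?thesis"
    then have "poly (p 2) z = 0 \<and> poly (p 3) z = 0 \<and> poly (p 4) z = 0"
      by (intro smooth) (auto simp: g_eval)
    then show False using coprime[of z] by auto
  qed
  define w where "w a b = p a * pderiv (p b) - p b * pderiv (p a)" for a b
  define W where "W = (\<lambda>i::nat. if i = 2 then w 3 4 else if i = 3 then w 4 2 else w 2 3)"
  have Wg: "W i * g j = W j * g i" if "i \<in> {2, 3, 4}" "j \<in> {2, 3, 4}" for i j
  proof -
    let ?a = "g 2" and ?b = "g 3" and ?c = "g 4"
    have e1: "p 2 * (?a * pderiv (p 2) + ?b * pderiv (p 3) + ?c * pderiv (p 4)) -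
        pderiv (p 2) * (?a * p 2 + ?b * p 3 + ?c * p 4) = 0"
      "p 3 * (?a * pderiv (p 2) + ?b * pderiv (p 3) + ?c * pderiv (p 4)) -
        pderiv (p 3) * (?a * p 2 + ?b * p 3 + ?c * p 4) = 0"
      "p 4 * (?a * pderiv (p 2) + ?b * pderiv (p 3) + ?c * pderiv (p 4)) -
        pderiv (p 4) * (?a * p 2 + ?b * p 3 + ?c * p 4) = 0"
      using gp gp' by simp_all
    show ?thesis using that e1 by (auto simp: W_def w_def algebra_simps)
  qed
  define m where "m = Max ((\<lambda>i. degree (p i)) ` {2, 3, 4})"
  have deg: "degree (p i) \<le> m" if "i \<in> {2, 3, 4}" for i
    unfolding m_def using that by (intro Max_ge) auto
  have W0: "W i = 0" if "i \<in> {2, 3, 4}" for i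
  proof (cases "m = 0")
    case True
    then have "pderiv (p i) = 0" if "i \<in> {2, 3, 4}" for i
      using deg[OF that] by (simp add: pderiv_eq_0_iff)
    then show ?thesis by (auto simp: W_def w_def)
  next
    case False
    have "m \<in> (\<lambda>i. degree (p i)) ` {2, 3, 4}" unfolding m_def by (intro Max_in) auto
    then obtain i0 where i0: "i0 \<in> {2, 3, 4}" "m = degree (p i0)" by auto
    have "coeff (p i0) m \<noteq> 0" using i0 False by auto
    then have "\<not> (coeff (p 2) m = 0 \<and> coeff (p 3) m = 0 \<and> coeff (p 4) m = 0)" using i0(1) by auto
    then obtain j where j: "j \<in> {2, 3, 4}"
      "value_at (\<lambda>i. coeff (p i) m) (partial_deriv j f) \<noteq> 0"
      using smooth[of "\<lambda>i. coeff (p i) m"] by auto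
    \<comment> \<open>Smoothness at the point at infinity: some partial derivative does not vanish
      at the vector of top coefficients.\<close>
    have "coeff (g j) (2 * m) \<noteq> 0"
      unfolding g_def by (subst eval_mpoly_top_coeff[OF hom_deriv]) (use vars_deriv deg j in auto)
    then have deg_g: "degree (g j) \<ge> 2 * m" by (rule le_degree)
    have dvd: "g j dvd W j"
      by (rule dvd_if_no_common_root[of "{2, 3, 4}" g])
         (use g_coprime Wg[OF j(1)] in \<open>auto simp: dvd_def mult.commute\<close>)
    have dw: "degree (w a b) < 2 * m" if "a \<in> {2, 3, 4}" "b \<in> {2, 3, 4}" for a b
    proof -
      have "degree (p a * pderiv (p b)) \<le> m + (m - 1)" if "a \<in> {2, 3, 4}" "b \<in> {2, 3, 4}" for a b
        by (rule order.trans[OF degree_mult_le])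
           (use deg[OF that(1)] deg[OF that(2)] in \<open>auto simp: degree_pderiv intro!: add_mono diff_le_mono\<close>)
      from this[OF that] this[OF that(2,1)] have "degree (w a b) \<le> m + (m - 1)"
        unfolding w_def by (intro degree_diff_le)
      then show ?thesis using False by simp
    qed
    have "degree (W j) < 2 * m" using dw by (auto simp: W_def)
    then have "W j = 0" using dvd_imp_degree_le[OF dvd] deg_g by fastforce
    then have "W i * g j = 0" using Wg[OF that j(1)] by simp
    moreover have "g j \<noteq> 0" using \<open>coeff (g j) (2 * m) \<noteq> 0\<close> by auto
    ultimately show ?thesis by simp
  qed
  have w0: "p a * pderiv (p b) = p b * pderiv (p a)" if "a \<in> {2, 3, 4}" "b \<in> {2, 3, 4}" for a b
    using that W0[of 2] W0[of 3] W0[of 4] by (auto simp: W_def w_def)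
  have const: "degree (p j) = 0" if j: "j \<in> {2, 3, 4}" for j
  proof -
    \<comment> \<open>By \<open>w0\<close> the product of each \<open>p i\<close> with
      \<open>pderiv (p j)\<close> is a multiple of \<open>p j\<close>, and the \<open>p i\<close>
      have no common root.\<close>
    have "p j dvd pderiv (p j)"
      by (rule dvd_if_no_common_root[of "{2, 3, 4}" p])
         (use coprime w0[OF _ j] in \<open>auto simp: mult.commute intro!: dvdI\<close>)
    then have "pderiv (p j) = 0"
      using dvd_imp_degree_le[of "p j" "pderiv (p j)"] by (cases "degree (p j) = 0")
        (auto simp: degree_pderiv pderiv_eq_0_iff)
    then show ?thesis by (simp add: pderiv_eq_0_iff)
  qed
  have "P i = Polynomial.smult (coeff (p i) 0) H" if i: "i \<in> {2, 3, 4}" for i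
  proof -
    obtain c where "p i = [:c:]" using const[OF i] degree_eq_zeroE by blast
    then show ?thesis using P[OF i] by (simp add: mult.commute)
  qed
  then have "\<forall>i\<in>{2, 3, 4}. P i = Polynomial.smult (coeff (p i) 0) H" by (rule ballI)
  then show ?thesis by (intro exI)
qed

end

section \<open>Countable algebraically closed subfields\<close>

text \<open>A relatively algebraically closed subfield; inverses arise as roots of linear
  polynomials. Elements outside are transcendental over it, which is how it is used.\<close>

definition root_closed_subring :: "'a::field set \<Rightarrow> bool" where
  "root_closed_subring K \<longleftrightarrow> 1 \<in> K \<and> (\<forall>x\<in>K. \<forall>y\<in>K. x - y \<in> K \<and> x * y \<in> K) \<and>
     (\<forall>p z. p \<noteq> 0 \<longrightarrow> (\<forall>i. coeff p i \<in> K) \<longrightarrow> poly p z = 0 \<longrightarrow> z \<in> K)"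

lemma countable_polys_over:
  assumes "countable (K :: 'a::zero set)"
  shows "countable {p :: 'a poly. \<forall>i. coeff p i \<in> K}"
proof -
  have "{p :: 'a poly. \<forall>i. coeff p i \<in> K} \<subseteq> Poly ` lists K"
  proof
    fix p :: "'a poly" assume "p \<in> {p. \<forall>i. coeff p i \<in> K}"
    then have "set (coeffs p) \<subseteq> K" by (auto simp: coeffs_def)
    then have "coeffs p \<in> lists K" by auto
    then show "p \<in> Poly ` lists K" by (metis Poly_coeffs imageI)
  qed
  then show ?thesis using assms by (meson countable_image countable_lists countable_subset)
qed

text \<open>Each round of adjoining differences, products and roots preserves countability.
  Countably many rounds suffice, since the finitely many coefficients of a polynomial already lie in
  one of them.\<close>

lemma countable_root_closed_subring:
  fixes S :: "'a::field set"
  assumes "countable S"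
  shows "\<exists>K. countable K \<and> S \<subseteq> K \<and> root_closed_subring K"
proof -
  define step where "step K = K \<union> {1} \<union> (\<lambda>(x, y). x - y) ` (K \<times> K) \<union> (\<lambda>(x, y). x * y) ` (K \<times> K) \<union>
    (\<Union>p\<in>{p. \<forall>i. coeff p i \<in> K} - {0}. {z. poly p z = 0})" for K :: "'a set"
  define C where "C n = (step ^^ n) S" for n
  have count_step: "countable (step K)" if "countable K" for K
    unfolding step_def using that countable_polys_over[OF that]
    by (intro countable_Un countable_UN countable_image countable_SIGMA)
       (auto intro: countable_finite poly_roots_finite)
  have "countable (C n)" for n
    by (induction n) (auto simp: C_def assms count_step)
  then have count: "countable (\<Union>n. C n)" by auto
  have CSuc: "C (Suc n) = step (C n)" for n by (simp add: C_def)
  have mono: "C n \<subseteq> C (n + m)" for n m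
    by (induction m) (auto simp: CSuc step_def)
  have mono': "C n \<subseteq> C m" if "n \<le> m" for n m
    using mono[of n "m - n"] that by simp
  have closed: "root_closed_subring (\<Union>n. C n)"
    unfolding root_closed_subring_def
  proof (intro conjI ballI allI impI)
    show "1 \<in> (\<Union>n. C n)" using CSuc[of 0] by (auto simp: step_def intro!: UN_I[of 1])
  next
    fix x y assume "x \<in> (\<Union>n. C n)" "y \<in> (\<Union>n. C n)"
    then obtain n m where "x \<in> C n" "y \<in> C m" by auto
    then have *: "x \<in> C (max n m)" "y \<in> C (max n m)"
      using mono'[of n "max n m"] mono'[of m "max n m"] by auto
    have "x - y \<in> C (Suc (max n m))" "x * y \<in> C (Suc (max n m))"
      unfolding CSuc step_def using * by auto
    then show "x - y \<in> (\<Union>n. C n)" "x * y \<in> (\<Union>n. C n)" by auto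
  next
    fix p z assume p: "p \<noteq> 0" "\<forall>i. coeff p i \<in> (\<Union>n. C n)" "poly p z = 0"
    then have "\<forall>i. \<exists>n. coeff p i \<in> C n" by auto
    then obtain N where N: "\<And>i. coeff p i \<in> C (N i)" by metis
    \<comment> \<open>The index \<open>degree p + 1\<close> is included so that the coefficient 0
      beyond the degree also belongs to \<open>C M\<close>.\<close>
    define M where "M = Max (N ` {..degree p + 1})"
    have "coeff p i \<in> C M" for i
    proof (cases "i \<le> degree p")
      case True
      then have "N i \<le> M" unfolding M_def by (intro Max_ge) auto
      then show ?thesis using N[of i] mono' by blast
    next
      case False
      have "N (degree p + 1) \<le> M" unfolding M_def by (intro Max_ge) auto
      then have "coeff p (degree p + 1) \<in> C M" using N mono' by blast
      then show ?thesis using False by (simp add: coeff_eq_0)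
    qed
    then have "z \<in> C (Suc M)" unfolding CSuc step_def using p by auto
    then show "z \<in> (\<Union>n. C n)" by auto
  qed
  have "S \<subseteq> (\<Union>n. C n)" by (auto simp: C_def intro!: UN_I[of 0])
  with count closed show ?thesis by (intro exI[of _ "\<Union>n. C n"] conjI)
qed

section \<open>Power series and polynomials over a subfield\<close>

locale root_closed =
  fixes K :: "'a::field_char_0 set"
  assumes rc: "root_closed_subring K"
begin

lemma one: "1 \<in> K"
  using rc unfolding root_closed_subring_def by blast

lemma diff: "x \<in> K \<Longrightarrow> y \<in> K \<Longrightarrow> x - y \<in> K"
  using rc unfolding root_closed_subring_def by blast

lemma mult: "x \<in> K \<Longrightarrow> y \<in> K \<Longrightarrow> x * y \<in> K"
  using rc unfolding root_closed_subring_def by blast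

lemma root: "p \<noteq> 0 \<Longrightarrow> (\<And>i. coeff p i \<in> K) \<Longrightarrow> poly p z = 0 \<Longrightarrow> z \<in> K"
  using rc unfolding root_closed_subring_def by blast

lemma zero: "0 \<in> K" using diff[OF one one] by simp

lemma uminus: "x \<in> K \<Longrightarrow> - x \<in> K" using diff[OF zero, of x] by simp

lemma add: "x \<in> K \<Longrightarrow> y \<in> K \<Longrightarrow> x + y \<in> K" using diff[OF _ uminus, of x y] by simp

lemma inverse: assumes "x \<in> K" shows "inverse x \<in> K"
proof (cases "x = 0")
  case False
  have coeff: "coeff [:-1, x:] i \<in> K" for i
    using assms uminus[OF one] zero by (auto simp: coeff_pCons split: nat.splits)
  show ?thesis by (rule root[of "[:-1, x:]"]) (use False coeff in auto)
qed (simp add: zero)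

lemma divide: "x \<in> K \<Longrightarrow> y \<in> K \<Longrightarrow> x / y \<in> K"
  by (simp add: divide_inverse mult inverse)

lemma sum: "(\<And>i. i \<in> A \<Longrightarrow> f i \<in> K) \<Longrightarrow> (\<Sum>i\<in>A. f i) \<in> K"
  by (induction A rule: infinite_finite_induct) (auto simp: zero add)

lemma of_nat: "of_nat n \<in> K"
  by (induction n) (auto simp: zero add one)

definition series_over :: "'a fps set" where
  "series_over = {g. \<forall>i. fps_nth g i \<in> K}"

definition polys_over :: "'a fps poly set" where
  "polys_over = {p. \<forall>i. coeff p i \<in> series_over}"

lemma series_over_add: "g \<in> series_over \<Longrightarrow> h \<in> series_over \<Longrightarrow> g + h \<in> series_over"
  by (auto simp: series_over_def add)

lemma series_over_mult: "g \<in> series_over \<Longrightarrow> h \<in> series_over \<Longrightarrow> g * h \<in> series_over"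
  by (auto simp: series_over_def fps_mult_nth intro!: sum mult)

lemma series_over_0: "0 \<in> series_over" and series_over_1: "1 \<in> series_over"
  by (auto simp: series_over_def zero one)

lemma series_over_sum: "(\<And>i. i \<in> A \<Longrightarrow> f i \<in> series_over) \<Longrightarrow> (\<Sum>i\<in>A. f i) \<in> series_over"
  by (induction A rule: infinite_finite_induct) (auto simp: series_over_0 series_over_add)

lemma series_over_const: "c \<in> K \<Longrightarrow> fps_const c \<in> series_over"
  by (auto simp: series_over_def zero)

lemma series_over_X_power: "fps_X ^ n \<in> series_over"
  by (auto simp: series_over_def fps_X_power_iff zero one)

lemma polys_over_add: "g \<in> polys_over \<Longrightarrow> h \<in> polys_over \<Longrightarrow> g + h \<in> polys_over"
  by (auto simp: polys_over_def series_over_add)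

lemma polys_over_mult: "g \<in> polys_over \<Longrightarrow> h \<in> polys_over \<Longrightarrow> g * h \<in> polys_over"
  by (auto simp: polys_over_def coeff_mult intro!: series_over_sum series_over_mult)

lemma polys_over_pCons: "g \<in> series_over \<Longrightarrow> p \<in> polys_over \<Longrightarrow> pCons g p \<in> polys_over"
  by (auto simp: polys_over_def coeff_pCons split: nat.splits)

lemma polys_over_0: "0 \<in> polys_over" and polys_over_1: "1 \<in> polys_over"
  by (auto simp: polys_over_def series_over_0 series_over_1 one_pCons coeff_pCons split: nat.splits)

lemma polys_over_sum: "(\<And>i. i \<in> A \<Longrightarrow> f i \<in> polys_over) \<Longrightarrow> (\<Sum>i\<in>A. f i) \<in> polys_over"
  by (induction A rule: infinite_finite_induct) (auto simp: polys_over_0 polys_over_add)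

lemma polys_over_power: "p \<in> polys_over \<Longrightarrow> p ^ n \<in> polys_over"
  by (induction n) (auto simp: polys_over_1 polys_over_mult)

lemma polys_over_prod: "(\<And>i. i \<in> A \<Longrightarrow> f i \<in> polys_over) \<Longrightarrow> (\<Prod>i\<in>A. f i) \<in> polys_over"
  by (induction A rule: infinite_finite_induct) (auto simp: polys_over_1 polys_over_mult)

lemma eval_mpoly_polys_over:
  assumes "\<And>m. Poly_Mapping.lookup p m \<in> K" "\<And>i. i \<in> vars p \<Longrightarrow> x i \<in> polys_over"
  shows "eval_mpoly (\<lambda>c. [:fps_const c:]) x p \<in> polys_over"
  unfolding eval_mpoly_def
  by (intro polys_over_sum polys_over_mult polys_over_pCons series_over_const polys_over_0
        polys_over_prod polys_over_power) (use assms in \<open>auto simp: vars_def\<close>)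

text \<open>Splits off the first coefficient outside the subfield.\<close>

lemma series_decompose:
  assumes "K \<noteq> UNIV"
  shows "\<exists>\<alpha> \<beta> z. \<alpha> \<in> series_over \<and> \<beta> \<in> series_over \<and> fps_nth z 0 \<notin> K \<and> b = \<alpha> + \<beta> * z"
proof (cases "b \<in> series_over")
  case True
  obtain c where "c \<notin> K" using assms by auto
  then show ?thesis
    by (intro exI[of _ b] exI[of _ 0] exI[of _ "fps_const c"]) (auto simp: True series_over_0)
next
  case False
  then have ex: "\<exists>j. fps_nth b j \<notin> K" by (auto simp: series_over_def)
  define j where "j = (LEAST j. fps_nth b j \<notin> K)"
  have j: "fps_nth b j \<notin> K" unfolding j_def using ex by (rule LeastI_ex)
  have less: "fps_nth b i \<in> K" if "i < j" for i
    using not_less_Least[OF that[unfolded j_def]] by auto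
  define \<alpha> where "\<alpha> = Abs_fps (\<lambda>i. if i < j then fps_nth b i else 0)"
  define z where "z = Abs_fps (\<lambda>i. fps_nth b (i + j))"
  have "b = \<alpha> + fps_X ^ j * z"
    by (rule fps_ext) (auto simp: \<alpha>_def z_def fps_X_power_mult_nth)
  moreover have "\<alpha> \<in> series_over" by (auto simp: series_over_def \<alpha>_def less zero)
  ultimately show ?thesis
    using j by (intro exI[of _ \<alpha>] exI[of _ "fps_X ^ j"] exI[of _ z]) (auto simp: series_over_X_power z_def)
qed

end

section \<open>Polynomials over power series rings\<close>

text \<open>The residue map of the Gauss valuation, that is, of the order in the series variable
  extended to polynomials.\<close>

definition reduct :: "'a::comm_ring_1 fps poly \<Rightarrow> 'a poly" where
  "reduct p = map_poly (\<lambda>g. fps_nth g 0) p"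

lemma coeff_reduct: "coeff (reduct p) i = fps_nth (coeff p i) 0"
  unfolding reduct_def by (simp add: coeff_map_poly)

lemma comm_ring_hom_reduct: "comm_ring_hom (reduct :: 'a::comm_ring_1 fps poly \<Rightarrow> _)"
proof
  show "reduct (p * q) = reduct p * reduct q" for p q :: "'a fps poly"
    by (rule poly_eqI) (simp add: coeff_reduct coeff_mult fps_sum_nth)
qed (auto intro!: poly_eqI simp: coeff_reduct one_pCons coeff_pCons split: nat.splits)

lemma poly_nth_0: "fps_nth (poly p t) 0 = poly (reduct p) (fps_nth t (0::nat) :: 'a::comm_ring_1)"
proof (induction p)
  case 0
  then show ?case by (simp add: reduct_def)
next
  case (pCons a p)
  have "reduct (pCons a p) = pCons (fps_nth a 0) (reduct p)"
    by (rule poly_eqI) (auto simp: coeff_reduct coeff_pCons split: nat.splits)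
  then show ?case using pCons by (simp add: mult.commute)
qed

text \<open>The exponent \<open>n\<close> is the least Gauss order in the family: the smallest order
  of any coefficient of any member.\<close>

lemma factor_X_power:
  fixes P :: "nat \<Rightarrow> 'a::comm_ring_1 fps poly"
  assumes "finite I" "i0 \<in> I" "P i0 \<noteq> 0"
  shows "\<exists>n Q. (\<forall>i\<in>I. P i = [:fps_X ^ n:] * Q i) \<and> (\<exists>i\<in>I. reduct (Q i) \<noteq> 0)"
proof -
  let ?S = "{n. \<exists>i\<in>I. \<exists>j. fps_nth (coeff (P i) j) n \<noteq> 0}"
  obtain j where "coeff (P i0) j \<noteq> 0" using assms(3) by (metis leading_coeff_0_iff)
  then obtain n0 where "fps_nth (coeff (P i0) j) n0 \<noteq> 0" by (auto simp: fps_eq_iff)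
  then have ne: "n0 \<in> ?S" using assms(2) by auto
  define n where "n = (LEAST n. n \<in> ?S)"
  have n: "n \<in> ?S" unfolding n_def using ne by (rule LeastI)
  have less: "fps_nth (coeff (P i) j) m = 0" if "m < n" "i \<in> I" for m i j
    using not_less_Least[OF that(1)[unfolded n_def]] that(2) by auto
  define Q where "Q i = map_poly (\<lambda>g. fps_shift n g) (P i)" for i
  have cQ: "coeff (Q i) j = fps_shift n (coeff (P i) j)" for i j
    unfolding Q_def by (rule coeff_map_poly) simp
  have "P i = [:fps_X ^ n:] * Q i" if "i \<in> I" for i
    by (rule poly_eqI) (auto simp: cQ intro!: fps_ext simp: fps_X_power_mult_nth less[OF _ that])
  moreover have "\<exists>i\<in>I. reduct (Q i) \<noteq> 0"
  proof -
    obtain i j where "i \<in> I" "fps_nth (coeff (P i) j) n \<noteq> 0" using n by auto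
    then have "coeff (reduct (Q i)) j \<noteq> 0" by (simp add: coeff_reduct cQ)
    then show ?thesis using \<open>i \<in> I\<close> by (metis coeff_0)
  qed
  ultimately show ?thesis by blast
qed

section \<open>Hensel's lemma\<close>

lemma poly_taylor_2:
  fixes p :: "'a::{comm_ring_1, semiring_no_zero_divisors} poly"
  shows "\<exists>r. poly p (t + h) = poly p t + h * poly (pderiv p) t + h * h * r"
proof (induction p)
  case 0
  show ?case by (intro exI[of _ 0]) simp
next
  case (pCons a p)
  then obtain r where r: "poly p (t + h) = poly p t + h * poly (pderiv p) t + h * h * r" by blast
  have "poly (pCons a p) (t + h) = poly (pCons a p) t + h * poly (pderiv (pCons a p)) t +
     h * h * (poly (pderiv p) t + (t + h) * r)"
    by (simp add: r pderiv_pCons) (simp add: algebra_simps)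
  then show ?case by blast
qed

lemma fps_X_power_dvd_iff: "fps_X ^ n dvd (g :: 'a::comm_ring_1 fps) \<longleftrightarrow> (\<forall>i<n. fps_nth g i = 0)"
proof
  assume "\<forall>i<n. fps_nth g i = 0"
  then have "g = fps_X ^ n * fps_shift n g"
    by (intro fps_ext) (simp add: fps_X_power_mult_nth)
  then show "fps_X ^ n dvd g" by (metis dvd_triv_left)
qed (auto simp: dvd_def fps_X_power_mult_nth)

lemma poly_diff_dvd:
  fixes p :: "'a::comm_ring_1 poly"
  shows "x - y dvd poly p x - poly p y"
proof (induction p)
  case (pCons a p)
  have "poly (pCons a p) x - poly (pCons a p) y = x * (poly p x - poly p y) + (x - y) * poly p y"
    by (simp add: algebra_simps)
  then show ?case using pCons by (auto intro: dvd_add dvd_mult dvd_mult2)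
qed simp

lemma nth_const_X_power_mult:
  "fps_nth (fps_const c * fps_X ^ n * g) i = (if i < n then 0 else c * fps_nth g (i - n))"
  for c :: "'a::comm_ring_1"
  by (simp add: mult.assoc fps_X_power_mult_nth)

lemma hensel:
  fixes p :: "'a::field fps poly"
  assumes "poly (reduct p) t0 = 0" "poly (pderiv (reduct p)) t0 \<noteq> 0"
  shows "\<exists>t. poly p t = 0 \<and> fps_nth t 0 = t0"
proof -
  define d where "d = poly (pderiv (reduct p)) t0"
  have red_deriv: "reduct (pderiv p) = pderiv (reduct p)"
    by (rule poly_eqI) (simp add: coeff_reduct coeff_pderiv fps_of_nat[symmetric] del: of_nat_Suc)
  \<comment> \<open>Each increment cancels the coefficient of \<open>poly p (T n)\<close> at
    \<open>Suc n\<close>. The derivative has the same constant term \<open>d\<close> at all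
    approximations, so the denominator never changes.\<close>
  define T where "T = rec_nat (fps_const t0) (\<lambda>n t.
    t + fps_const (- fps_nth (poly p t) (Suc n) / d) * fps_X ^ Suc n)"
  have T0: "T 0 = fps_const t0" and TSuc: "T (Suc n) = T n +
     fps_const (- fps_nth (poly p (T n)) (Suc n) / d) * fps_X ^ Suc n" for n
    by (simp_all add: T_def)
  have nth0: "fps_nth (T n) 0 = t0" for n by (induction n) (auto simp: T0 TSuc)
  have zero: "fps_X ^ Suc n dvd poly p (T n)" for n
  proof (induction n)
    case 0
    have "fps_nth (poly p (T 0)) 0 = 0" using assms(1) by (simp add: T0 poly_nth_0)
    then show ?case unfolding fps_X_power_dvd_iff by (simp add: less_Suc_eq)
  next
    case (Suc n)
    let ?c = "- fps_nth (poly p (T n)) (Suc n) / d"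
    let ?h = "fps_const ?c * fps_X ^ Suc n"
    obtain r where r: "poly p (T (Suc n)) = poly p (T n) + ?h * poly (pderiv p) (T n) + ?h * ?h * r"
      using poly_taylor_2[of p "T n" ?h] unfolding TSuc by blast
    have nth_hh: "fps_nth (?h * ?h * r) i = 0" if "i \<le> Suc n" for i
      unfolding mult.assoc[of ?h ?h] nth_const_X_power_mult using that by simp
    have "fps_nth (poly p (T (Suc n))) i = 0" if "i < Suc (Suc n)" for i
    proof (cases "i = Suc n")
      case True
      have "fps_nth (poly (pderiv p) (T n)) 0 = d"
        by (simp add: poly_nth_0 red_deriv nth0 d_def)
      then show ?thesis
        using True assms(2) nth_hh[of i] unfolding r fps_add_nth nth_const_X_power_mult by (simp add: d_def)
    next
      case False
      then have "i < Suc n" using that by simp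
      moreover have "fps_nth (poly p (T n)) i = 0"
        using Suc.IH \<open>i < Suc n\<close> unfolding fps_X_power_dvd_iff by blast
      ultimately show ?thesis using nth_hh[of i] unfolding r fps_add_nth nth_const_X_power_mult by simp
    qed
    then show ?case unfolding fps_X_power_dvd_iff by blast
  qed
  \<comment> \<open>The limit is taken along the diagonal: the coefficient at \<open>n\<close> no
    longer changes after the \<open>n\<close>-th approximation.\<close>
  define t where "t = Abs_fps (\<lambda>n. fps_nth (T n) n)"
  have stable: "fps_nth (T (n + m)) i = fps_nth (T n) i" if "i \<le> n" for n m i
    using that by (induction m) (auto simp: TSuc fps_X_power_mult_nth simp del: power_Suc)
  have close: "fps_X ^ Suc n dvd t - T n" for n
    unfolding fps_X_power_dvd_iff
  proof (intro allI impI)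
    fix i assume "i < Suc n"
    then show "fps_nth (t - T n) i = 0" using stable[of i i "n - i"] by (simp add: t_def)
  qed
  have "poly p t = 0"
  proof (rule fps_ext)
    fix n
    have "fps_X ^ Suc n dvd poly p t - poly p (T n)"
      using close poly_diff_dvd by (rule dvd_trans)
    with zero[of n] have "fps_X ^ Suc n dvd poly p t" by (metis diff_add_cancel dvd_add)
    then show "fps_nth (poly p t) n = fps_nth 0 n" unfolding fps_X_power_dvd_iff by auto
  qed
  moreover have "fps_nth t 0 = t0" by (simp add: t_def T0)
  ultimately show ?thesis by blast
qed

section \<open>Changing the uniformizer\<close>

lemma comm_ring_hom_fps_compose:
  assumes "fps_nth c 0 = (0 :: 'a::idom)"
  shows "comm_ring_hom (\<lambda>g. g oo c)"
  by unfold_locales (auto simp: fps_compose_add_distrib fps_compose_mult_distrib[OF assms])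

text \<open>Hensel's lemma for \<open>T^m - g\<close> at an \<open>m\<close>-th root
  \<open>c\<close> of the constant term; the derivative there is \<open>m c^(m - 1)\<close>, nonzero
  in characteristic 0.\<close>

lemma fps_unit_root:
  fixes g :: "'a::{alg_closed_field, field_char_0} fps"
  assumes "fps_nth g 0 \<noteq> 0" "m > 0"
  shows "\<exists>w. w ^ m = g \<and> fps_nth w 0 \<noteq> 0"
proof -
  have "degree (monom 1 m + [:- fps_nth g 0:]) = m"
    using assms(2) by (subst degree_add_eq_left) (auto simp: degree_monom_eq)
  moreover have "monom 1 m - [:fps_nth g 0:] = monom 1 m + [:- fps_nth g 0:]"
    by (rule poly_eqI) (simp add: coeff_pCons split: nat.splits)
  ultimately have "degree (monom 1 m - [:fps_nth g 0:]) = m" by (simp only:)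
  then obtain c where "poly (monom 1 m - [:fps_nth g 0:]) c = 0"
    using alg_closed_imp_poly_has_root[of "monom 1 m - [:fps_nth g 0:]"] assms(2) by auto
  then have c: "c ^ m = fps_nth g 0" by (simp add: poly_monom)
  then have c0: "c \<noteq> 0" using assms by (auto simp: power_0_left split: if_splits)
  let ?p = "monom 1 m - [:g:]"
  have red: "reduct ?p = monom 1 m - [:fps_nth g 0:]"
    by (rule poly_eqI) (auto simp: coeff_reduct coeff_pCons split: nat.splits)
  have "poly (pderiv (reduct ?p)) c \<noteq> 0"
    unfolding red using c0 assms(2) by (simp add: pderiv_diff pderiv_monom pderiv_pCons poly_monom)
  then obtain w where "poly ?p w = 0" "fps_nth w 0 = c"
    using hensel[of ?p c] c by (auto simp: red poly_monom)
  then show ?thesis using c0 by (intro exI[of _ w]) (auto simp: poly_monom)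
qed

text \<open>For \<open>i < j\<close> and \<open>m = j - i\<close>, the quotient of the two series is
  the \<open>m\<close>-th power of a uniformizer \<theta>, namely \<open>fps_X\<close> times an
  \<open>m\<close>-th root of \<open>v / u\<close>. Substituting the compositional inverse of
  \<theta> turns the quotient into \<open>fps_X ^ m\<close>, so both series acquire the same unit
  \<open>w\<close>.\<close>

lemma change_uniformizer:
  fixes u v :: "'a::{alg_closed_field, field_char_0} fps"
  assumes u0: "fps_nth u 0 \<noteq> 0" and v0: "fps_nth v 0 \<noteq> 0" and ij: "i \<noteq> j"
  shows "\<exists>c w. fps_nth c 0 = 0 \<and> fps_nth c 1 \<noteq> 0 \<and> fps_nth w 0 \<noteq> 0 \<and>
    (fps_X ^ i * u) oo c = fps_X ^ i * w \<and> (fps_X ^ j * v) oo c = fps_X ^ j * w"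
proof -
  have main: "\<exists>c w. fps_nth c 0 = 0 \<and> fps_nth c 1 \<noteq> 0 \<and> fps_nth w 0 \<noteq> 0 \<and>
    (fps_X ^ i * u) oo c = fps_X ^ i * w \<and> (fps_X ^ j * v) oo c = fps_X ^ j * w"
    if u0: "fps_nth u 0 \<noteq> 0" and v0: "fps_nth v 0 \<noteq> 0" and ij: "i < j" for u v :: "'a fps" and i j
  proof -
    define m where "m = j - i"
    have m: "m > 0" "j = i + m" using ij by (auto simp: m_def)
    have uu: "u * inverse u = 1" using u0 by (rule inverse_mult_eq_1')
    have "fps_nth (v * inverse u) 0 \<noteq> 0" using u0 v0 by simp
    from fps_unit_root[OF this m(1)] obtain r where r: "r ^ m = v * inverse u" "fps_nth r 0 \<noteq> 0"
      by blast
    define \<theta> where "\<theta> = fps_X * r"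
    have \<theta>: "fps_nth \<theta> 0 = 0" "fps_nth \<theta> 1 \<noteq> 0" using r(2) by (auto simp: \<theta>_def)
    define c where "c = fps_inv \<theta>"
    have c0: "fps_nth c 0 = 0" by (simp add: c_def fps_inv_def)
    have \<theta>c: "\<theta> oo c = fps_X" unfolding c_def by (rule fps_inv_right[OF \<theta>])
    have cm: "(g * h) oo c = (g oo c) * (h oo c)" for g h
      by (rule fps_compose_mult_distrib[OF c0])
    have cr: "c * (r oo c) = fps_X" using \<theta>c unfolding \<theta>_def cm by (simp add: fps_X_fps_compose_startby0[OF c0])
    have c1: "fps_nth c 1 \<noteq> 0"
    proof
      assume "fps_nth c 1 = 0"
      then have "fps_nth (c * (r oo c)) 1 = 0" using c0 by (simp add: fps_mult_nth)
      then show False by (simp add: cr)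
    qed
    define c' where "c' = fps_shift 1 c"
    have cc': "c = fps_X * c'" using c0 unfolding c'_def
      by (intro fps_ext) (auto simp: not_less fps_X_mult_nth)
    define w where "w = c' ^ i * (u oo c)"
    have "(fps_X ^ i * u) oo c = fps_X ^ i * w"
      unfolding cm fps_compose_power[OF c0, symmetric] fps_X_fps_compose_startby0[OF c0]
      by (simp add: w_def cc' power_mult_distrib mult.assoc)
    moreover have "(fps_X ^ j * v) oo c = fps_X ^ j * w"
    proof -
      have "v = r ^ m * u" using uu r(1) by (simp add: mult.assoc mult.commute[of "inverse u"])
      then have "fps_X ^ j * v = \<theta> ^ m * (fps_X ^ i * u)"
        by (simp add: \<theta>_def m(2) power_add power_mult_distrib algebra_simps)
      then have "(fps_X ^ j * v) oo c = fps_X ^ m * (fps_X ^ i * w)"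
        using \<open>(fps_X ^ i * u) oo c = fps_X ^ i * w\<close>
        by (simp only: cm[of "\<theta> ^ m"] fps_compose_power[OF c0, symmetric] \<theta>c)
      then show ?thesis by (simp add: m(2) power_add mult.assoc mult.left_commute)
    qed
    moreover have "fps_nth w 0 \<noteq> 0"
      using c1 u0 by (simp add: w_def c'_def)
    ultimately show ?thesis using c0 c1 by blast
  qed
  show ?thesis
  proof (cases "i < j")
    case True
    then show ?thesis using main u0 v0 by blast
  next
    case False
    then have "j < i" using ij by simp
    then show ?thesis using main[OF v0 u0] by blast
  qed
qed

section \<open>Limits of arcs\<close>

locale smooth_cubic_over = smooth_cubic f + root_closed K
  for f :: "'k::{alg_closed_field, field_char_0} mpoly" and K :: "'k set" +
  assumes f_over: "Poly_Mapping.lookup f m \<in> K" and K_proper: "K \<noteq> UNIV"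
begin

text \<open>The residue field of an extension of the valuation of \<open>K((s))\<close> to a simple transcendental
  extension is contained in a rational function field over \<open>K\<close>, so that its points on the
  cubic are \<open>K\<close>-rational.\<close>

lemma arc_limit_over:
  fixes \<psi> :: "nat \<Rightarrow> 'k mpoly" and l x :: "nat \<Rightarrow> 'k fps" and V :: "nat \<Rightarrow> nat \<Rightarrow> 'k"
  assumes psi: "\<And>i. i \<in> {2, 3, 4} \<Longrightarrow> homogeneous e (\<psi> i)"
      "\<And>i m. i \<in> {2, 3, 4} \<Longrightarrow> Poly_Mapping.lookup (\<psi> i) m \<in> K"
      "\<And>i. i \<in> {2, 3, 4} \<Longrightarrow> vars (\<psi> i) \<subseteq> {..<d}"
    and V: "\<And>m j. m < 4 \<Longrightarrow> j < d \<Longrightarrow> V m j \<in> K"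
    and l: "l 0 = fps_const c0 * l 1" "c0 \<in> K" "l 1 = fps_X ^ i1 * u" "l 2 = fps_X ^ i2 * v"
      "fps_nth u 0 \<noteq> 0" "fps_nth v 0 \<noteq> 0" "i1 \<noteq> i2"
    and y: "\<And>j. j < d \<Longrightarrow> y j = (\<Sum>m<4. l m * fps_const (V m j))"
    and rel: "\<And>i j. i \<in> {2, 3, 4} \<Longrightarrow> j \<in> {2, 3, 4} \<Longrightarrow>
      eval_mpoly fps_const y (\<psi> i) * x j = eval_mpoly fps_const y (\<psi> j) * x i"
    and nz: "eval_mpoly fps_const y (\<psi> 2) \<noteq> 0"
    and x2: "fps_nth (x 2) 0 \<noteq> 0"
    and fx: "value_at (\<lambda>i. fps_nth (x i) 0) f = 0"
    and i: "i \<in> {3, 4}"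
  shows "fps_nth (x i) 0 / fps_nth (x 2) 0 \<in> K"
proof -
  \<comment> \<open>In the new parameter the forms 0, 1 and 2 are \<open>w\<close> times a series
    over \<open>K\<close>.\<close>
  obtain c w where c: "fps_nth c 0 = 0" "fps_nth c 1 \<noteq> 0" and w: "fps_nth w 0 \<noteq> 0"
    and cu: "l 1 oo c = fps_X ^ i1 * w" and cv: "l 2 oo c = fps_X ^ i2 * w"
    using change_uniformizer[OF l(5,6,7)] unfolding l(3,4) by blast
  define \<Theta> where "\<Theta> g = g oo c" for g :: "'k fps"
  have hom_\<Theta>: "comm_ring_hom \<Theta>"
    unfolding \<Theta>_def by (rule comm_ring_hom_fps_compose) (rule c)
  interpret \<Theta>: comm_ring_hom \<Theta> by (rule hom_\<Theta>)
  have \<Theta>_const: "\<Theta> (fps_const a) = fps_const a" for a by (simp add: \<Theta>_def)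
  have \<Theta>_0: "fps_nth (\<Theta> g) 0 = fps_nth g 0" for g by (simp add: \<Theta>_def)
  have w0: "w \<noteq> 0" using w by auto
  \<comment> \<open>The fourth form is the only source of elements outside \<open>K\<close>, and it
    enters through the single series \<open>z\<close>, whose constant term is transcendental over
    \<open>K\<close>.\<close>
  obtain \<alpha> \<beta> z where ab: "\<alpha> \<in> series_over" "\<beta> \<in> series_over" "fps_nth z 0 \<notin> K"
    and b: "\<Theta> (l 3) * inverse w = \<alpha> + \<beta> * z"
    using series_decompose[OF K_proper] by blast
  have l3: "\<Theta> (l 3) = w * (\<alpha> + \<beta> * z)"
    unfolding b[symmetric] using inverse_mult_eq_1'[OF w] by (simp add: mult.left_commute)
  \<comment> \<open>The forms divided by \<open>w\<close>, with \<open>z\<close> replaced by an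
    indeterminate; all coefficients are series over \<open>K\<close>.\<close>
  define L where "L m = (if m = 0 then [:fps_const c0 * fps_X ^ i1:] else if m = 1 then [:fps_X ^ i1:]
    else if m = 2 then [:fps_X ^ i2:] else [:\<alpha>, \<beta>:])" for m :: nat
  define Y where "Y j = (\<Sum>m<4. L m * [:fps_const (V m j):])" for j
  have L_over: "L m \<in> polys_over" for m
    unfolding L_def using ab l(2)
    by (auto intro!: polys_over_pCons polys_over_0 series_over_mult series_over_const series_over_X_power)
  have Y_over: "Y j \<in> polys_over" if "j < d" for j
    unfolding Y_def using that V
    by (intro polys_over_sum polys_over_mult L_over polys_over_pCons polys_over_0 series_over_const) auto
  have L_eval: "w * poly (L m) z = \<Theta> (l m)" if "m < 4" for m
  proof -
    consider "m = 0" | "m = 1" | "m = 2" | "m = 3" using \<open>m < 4\<close> by linarith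
    then show ?thesis
    proof cases
      case 1
      then show ?thesis
        using cu by (simp add: L_def l(1) \<Theta>.hom_mult \<Theta>_const) (simp add: \<Theta>_def mult.left_commute mult.commute)
    next
      case 2
      then show ?thesis using cu by (simp add: L_def \<Theta>_def mult.commute)
    next
      case 3
      then show ?thesis using cv by (simp add: L_def \<Theta>_def mult.commute)
    next
      case 4
      then show ?thesis using l3 by (simp add: L_def mult.commute)
    qed
  qed
  have Y_eval: "w * poly (Y j) z = \<Theta> (y j)" if "j < d" for j
    unfolding Y_def y[OF that] \<Theta>.hom_sum poly_sum sum_distrib_left
    by (rule sum.cong) (auto simp: L_eval[symmetric] \<Theta>.hom_mult \<Theta>_const mult.assoc mult.commute)
  define G where "G i = eval_mpoly (\<lambda>c. [:fps_const c:]) Y (\<psi> i)" for i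
  have G_over: "G i \<in> polys_over" if "i \<in> {2, 3, 4}" for i
    unfolding G_def using psi(2)[OF that] psi(3)[OF that] Y_over
    by (intro eval_mpoly_polys_over) auto
  have G_eval: "w ^ e * poly (G i) z = \<Theta> (eval_mpoly fps_const y (\<psi> i))" if i: "i \<in> {2, 3, 4}" for i
  proof -
    have "poly (G i) z = eval_mpoly fps_const (\<lambda>j. poly (Y j) z) (\<psi> i)"
      unfolding G_def by (subst eval_mpoly_hom[OF comm_ring_hom_poly_eval]) simp
    then have "w ^ e * poly (G i) z = eval_mpoly fps_const (\<lambda>j. w * poly (Y j) z) (\<psi> i)"
      by (simp add: eval_mpoly_scale[OF psi(1)[OF i]])
    also have "\<dots> = eval_mpoly fps_const (\<lambda>j. \<Theta> (y j)) (\<psi> i)"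
      by (rule eval_mpoly_cong) (use psi(3)[OF i] Y_eval in auto)
    also have "\<dots> = \<Theta> (eval_mpoly fps_const y (\<psi> i))"
      by (subst eval_mpoly_hom[OF hom_\<Theta>]) (simp add: \<Theta>_const)
    finally show ?thesis .
  qed
  have "\<Theta> (eval_mpoly fps_const y (\<psi> 2)) \<noteq> 0"
    using nz c unfolding \<Theta>_def by (subst fps_compose_eq_0_iff) auto
  then have "G 2 \<noteq> 0" using G_eval[of 2] by auto
  \<comment> \<open>Dividing by the common power of the parameter before reducing keeps the residue
    point from being zero.\<close>
  then obtain n Q where GQ: "\<And>i. i \<in> {2, 3, 4} \<Longrightarrow> G i = [:fps_X ^ n:] * Q i"
    and "\<exists>i\<in>{2, 3, 4}. reduct (Q i) \<noteq> 0"
    using factor_X_power[of "{2, 3, 4}" 2 G] by auto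
  then obtain i0 where i0: "i0 \<in> {2, 3, 4}" "reduct (Q i0) \<noteq> 0" by blast
  have Q_over: "Q i \<in> polys_over" if "i \<in> {2, 3, 4}" for i
    unfolding polys_over_def series_over_def
  proof (intro CollectI allI)
    fix k m
    have "fps_nth (coeff (Q i) k) m = fps_nth (coeff (G i) k) (m + n)"
      by (simp add: GQ[OF that] fps_X_power_mult_nth)
    then show "fps_nth (coeff (Q i) k) m \<in> K"
      using G_over[OF that] by (auto simp: polys_over_def series_over_def)
  qed
  define R where "R i = reduct (Q i)" for i
  define z0 where "z0 = fps_nth z 0"
  have R_over: "coeff (R i) k \<in> K" if "i \<in> {2, 3, 4}" for i k
    using Q_over[OF that] by (auto simp: R_def coeff_reduct polys_over_def series_over_def)
  have R_prop: "poly (R i) z0 * fps_nth (x j) 0 = poly (R j) z0 * fps_nth (x i) 0"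
    if ij: "i \<in> {2, 3, 4}" "j \<in> {2, 3, 4}" for i j
  proof -
    have "\<Theta> (eval_mpoly fps_const y (\<psi> i)) * \<Theta> (x j) = \<Theta> (eval_mpoly fps_const y (\<psi> j)) * \<Theta> (x i)"
      using rel[OF ij] by (simp flip: \<Theta>.hom_mult)
    then have "(w ^ e * fps_X ^ n) * (poly (Q i) z * \<Theta> (x j)) =
        (w ^ e * fps_X ^ n) * (poly (Q j) z * \<Theta> (x i))"
      unfolding G_eval[OF ij(1), symmetric] G_eval[OF ij(2), symmetric] GQ[OF ij(1)] GQ[OF ij(2)]
      by (simp add: mult.assoc)
    then have "poly (Q i) z * \<Theta> (x j) = poly (Q j) z * \<Theta> (x i)"
      using w0 by simp
    then have "fps_nth (poly (Q i) z * \<Theta> (x j)) 0 = fps_nth (poly (Q j) z * \<Theta> (x i)) 0" by simp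
    then show ?thesis by (simp add: poly_nth_0 \<Theta>_0 R_def z0_def)
  qed
  \<comment> \<open>A nonzero polynomial over \<open>K\<close> cannot vanish at \<open>z0\<close>,
    which lies outside \<open>K\<close>. The same remark below makes \<open>F\<close> the zero
    polynomial.\<close>
  have "poly (R i0) z0 \<noteq> 0"
    using root[of "R i0" z0] R_over[OF i0(1)] i0(2) ab(3) by (auto simp: R_def z0_def)
  then have R2: "poly (R 2) z0 \<noteq> 0" using R_prop[OF i0(1), of 2] x2 by auto
  define \<kappa> where "\<kappa> = poly (R 2) z0 / fps_nth (x 2) 0"
  have Rk: "poly (R i) z0 = \<kappa> * fps_nth (x i) 0" if "i \<in> {2, 3, 4}" for i
    using R_prop[OF that, of 2] x2 by (simp add: \<kappa>_def field_simps)
  define F where "F = subst_polys R f"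
  have F: "F = reduct (eval_mpoly (\<lambda>c. [:fps_const c:]) Q f)"
  proof -
    have "reduct [:fps_const c:] = [:c:]" for c :: 'k
      by (rule poly_eqI) (auto simp: coeff_reduct coeff_pCons split: nat.splits)
    then show ?thesis
      unfolding F_def R_def by (subst eval_mpoly_hom[OF comm_ring_hom_reduct]) simp
  qed
  have "eval_mpoly (\<lambda>c. [:fps_const c:]) Q f \<in> polys_over"
    by (rule eval_mpoly_polys_over) (use f_over vars Q_over in auto)
  then have F_over: "coeff F k \<in> K" for k
    unfolding F coeff_reduct by (auto simp: polys_over_def series_over_def)
  have "poly F z0 = value_at (\<lambda>i. poly (R i) z0) f"
    unfolding F_def by (subst eval_mpoly_hom[OF comm_ring_hom_poly_eval]) simp
  also have "\<dots> = value_at (\<lambda>i. \<kappa> * fps_nth (x i) 0) f"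
    by (rule eval_mpoly_cong) (use vars Rk in auto)
  also have "\<dots> = 0" by (simp add: eval_mpoly_scale[OF hom] fx)
  finally have "F = 0" using root[of F z0] F_over ab(3) by (auto simp: z0_def)
  \<comment> \<open>Now \<open>R\<close> parametrizes the cubic rationally over \<open>K\<close>. It
    is therefore constant up to a common factor, and ratios of its coefficients give the limit
    point.\<close>
  then have F0: "subst_polys R f = 0" by (simp only: F_def)
  have "R 2 \<noteq> 0" using R2 by auto
  obtain H a where "\<forall>i\<in>{2, 3, 4}. R i = Polynomial.smult (a i) H"
    using rational_point_constant[OF F0 \<open>R 2 \<noteq> 0\<close>] by (elim exE)
  then have H: "R i = Polynomial.smult (a i) H" if "i \<in> {2, 3, 4}" for i
    using that by (rule bspec)
  from \<open>R 2 \<noteq> 0\<close>  obtain k where k: "coeff (R 2) k \<noteq> 0" by (metis leading_coeff_0_iff)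
  have i': "i \<in> {2, 3, 4}" using i by auto
  have a2: "a 2 \<noteq> 0" "poly H z0 \<noteq> 0" "coeff H k \<noteq> 0" using R2 k H[of 2] by auto
  have "fps_nth (x i) 0 / fps_nth (x 2) 0 = poly (R i) z0 / poly (R 2) z0"
    using R_prop[OF i', of 2] R2 x2 by (simp add: field_simps)
  also have "\<dots> = coeff (R i) k / coeff (R 2) k"
    using a2 by (simp add: H[OF i'] H[of 2])
  also have "\<dots> \<in> K" by (intro divide R_over) (use i' in auto)
  finally show ?thesis .
qed

end

section \<open>Polynomials in two variables\<close>

text \<open>The outer variable is the position \<open>t\<close>, the inner one the arc parameter
  \<open>s\<close>. Only \<open>s\<close> is completed, so that \<open>t\<close> can still be
  specialized to an arbitrary power series in \<open>s\<close>.\<close>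

definition to_series :: "'a::comm_ring_1 poly poly \<Rightarrow> 'a fps poly" where
  "to_series p = map_poly fps_of_poly p"

lemma coeff_to_series: "coeff (to_series p) i = fps_of_poly (coeff p i)"
  unfolding to_series_def by (simp add: coeff_map_poly)

lemma comm_ring_hom_to_series: "comm_ring_hom (to_series :: 'a::comm_ring_1 poly poly \<Rightarrow> _)"
proof
  show "to_series (p * q) = to_series p * to_series q" for p q :: "'a poly poly"
    by (rule poly_eqI) (simp add: coeff_to_series coeff_mult fps_of_poly_sum fps_of_poly_mult)
qed (auto intro!: poly_eqI simp: coeff_to_series fps_of_poly_add one_pCons coeff_pCons split: nat.splits)

lemma to_series_eq_0_iff: "to_series p = 0 \<longleftrightarrow> p = 0"
proof
  assume "to_series p = 0"
  then have "fps_of_poly (coeff p i) = fps_of_poly 0" for i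
    by (metis coeff_0 coeff_to_series fps_of_poly_0)
  then show "p = 0" by (intro poly_eqI) (simp only: fps_of_poly_eq_iff coeff_0)
qed (auto intro!: poly_eqI simp: coeff_to_series)

lemma to_series_pCons: "to_series (pCons c p) = pCons (fps_of_poly c) (to_series p)"
  by (rule poly_eqI) (auto simp: coeff_to_series coeff_pCons split: nat.splits)

lemma to_series_0 [simp]: "to_series 0 = 0"
  by (simp add: to_series_eq_0_iff)

definition eval2 :: "'a::comm_ring_1 \<Rightarrow> 'a \<Rightarrow> 'a poly poly \<Rightarrow> 'a" where
  "eval2 t s p = poly (poly p [:t:]) s"

lemma comm_ring_hom_eval2: "comm_ring_hom (eval2 t s)"
  unfolding eval2_def by (rule comm_ring_hom_comp[OF comm_ring_hom_poly_eval comm_ring_hom_poly_eval])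

definition eval_series :: "'a::comm_ring_1 fps \<Rightarrow> 'a poly poly \<Rightarrow> 'a fps" where
  "eval_series t p = poly (to_series p) t"

lemma comm_ring_hom_eval_series: "comm_ring_hom (eval_series t)"
  unfolding eval_series_def by (rule comm_ring_hom_comp[OF comm_ring_hom_poly_eval comm_ring_hom_to_series])

text \<open>Turns relations known at the points of the threefold into identities of polynomials in
  \<open>t\<close> and \<open>s\<close>. The value \<open>t = 0\<close> is left out because the arc
  does not lie in the chart \<open>x 2 \<noteq> 0\<close> there.\<close>

lemma zero_if_eval2_zero:
  fixes p :: "'a::field_char_0 poly poly"
  assumes "\<And>t s. t \<noteq> 0 \<Longrightarrow> eval2 t s p = 0"
  shows "p = 0"
proof (rule ccontr)
  assume "p \<noteq> 0"
  then have "finite {x. poly p x = 0}" by (rule poly_roots_finite)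
  moreover have "(\<lambda>t. [:t:]) ` (UNIV - {0}) \<subseteq> {x. poly p x = 0}"
  proof safe
    fix t :: 'a assume "t \<noteq> 0"
    then show "poly p [:t:] = 0" using assms[of t] by (intro poly_eqI_infinite) (simp add: eval2_def)
  qed
  ultimately have "finite ((\<lambda>t::'a. [:t:]) ` (UNIV - {0}))" by (rule finite_subset[rotated])
  then have "finite (UNIV - {0} :: 'a set)" by (rule finite_imageD) (auto simp: inj_on_def)
  then show False by (simp add: infinite_UNIV_char_0)
qed

section \<open>Values of nonconstant rational functions\<close>

lemma common_factor_2:
  fixes p q :: "'a::field poly"
  assumes "q \<noteq> 0"
  shows "\<exists>H p' q'. H \<noteq> 0 \<and> p = H * p' \<and> q = H * q' \<and> (\<forall>z. poly p' z \<noteq> 0 \<or> poly q' z \<noteq> 0)"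
proof -
  let ?P = "\<lambda>i::nat. if i = 0 then p else q"
  have "(1::nat) \<in> {0, 1}" "?P 1 \<noteq> 0" using assms by auto
  from common_factor[of 1 "{0, 1}" ?P, OF this] obtain H r where "H \<noteq> 0" "\<forall>i\<in>{0, 1}. ?P i = H * r i"
    "\<forall>z. \<exists>i\<in>{0, 1}. poly (r i) z \<noteq> 0" by (elim exE conjE)
  then show ?thesis by (intro exI[of _ H] exI[of _ "r 0"] exI[of _ "r 1"]) auto
qed

text \<open>After removal of the common factor, each of the two polynomials divides its own
  derivative and is therefore constant.\<close>

lemma wronskian_zero:
  fixes p q :: "'a::{alg_closed_field, field_char_0} poly"
  assumes "pderiv p * q = p * pderiv q" "p \<noteq> 0"
  shows "\<exists>c. q = Polynomial.smult c p"
proof -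
  obtain H p' q' where H: "H \<noteq> 0" and q: "q = H * q'" and p: "p = H * p'"
    and coprime: "\<And>z. poly q' z \<noteq> 0 \<or> poly p' z \<noteq> 0"
    using common_factor_2[OF assms(2), of q] by blast
  define r where "r i = (if i = 0 then p' else q')" for i :: nat
  have p: "p = H * r 0" and q: "q = H * r 1" using p q by (simp_all add: r_def)
  have coprime: "\<exists>i\<in>{0, 1}. poly (r i) z \<noteq> 0" for z using coprime[of z] by (auto simp: r_def)
  have "H * H * (pderiv (r 0) * r 1) = H * H * (r 0 * pderiv (r 1))"
    using assms(1) unfolding p q by (simp add: pderiv_mult algebra_simps)
  then have w: "pderiv (r 0) * r 1 = r 0 * pderiv (r 1)" using H by simp
  have const: "degree (r j) = 0" if j: "j \<in> {0, 1}" for j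
  proof -
    have d1: "r 1 dvd pderiv (r 1) * r 0" by (metis w dvd_triv_right mult.commute)
    have d0: "r 0 dvd pderiv (r 0) * r 1" by (metis w dvd_triv_left)
    have "r j dvd pderiv (r j)"
      by (rule dvd_if_no_common_root[of "{0, 1}" r]) (use coprime j d0 d1 in auto)
    then show ?thesis
      using dvd_imp_degree_le[of "r j" "pderiv (r j)"] by (cases "degree (r j) = 0")
        (auto simp: degree_pderiv pderiv_eq_0_iff)
  qed
  obtain a where a: "r 0 = [:a:]" using const[of 0] degree_eq_zeroE by blast
  obtain b where b: "r 1 = [:b:]" using const[of 1] degree_eq_zeroE by blast
  have "a \<noteq> 0" using a p assms(2) by auto
  then show ?thesis by (intro exI[of _ "b / a"]) (simp add: p q a b[unfolded One_nat_def] mult.commute)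
qed

text \<open>Different numbers \<open>N\<close> have disjoint fibres, once common zeros are removed,
  and at most one fibre is empty; so infinitely many points arise and one of them avoids
  \<open>Z\<close>. Zeros of \<open>q\<close> can be put into \<open>Z\<close> to make
  \<open>N\<close> a value of the quotient.\<close>

lemma natural_value:
  fixes p q :: "'a::{alg_closed_field, field_char_0} poly"
  assumes nc: "\<And>c. p \<noteq> Polynomial.smult c q" and q0: "q \<noteq> 0" and Z: "finite Z"
  shows "\<exists>N t. t \<notin> Z \<and> poly p t = of_nat N * poly q t"
proof (rule ccontr)
  assume contra: "\<not> ?thesis"
  obtain H p' q' where H: "H \<noteq> 0" and p: "p = H * p'" and q: "q = H * q'"
    and coprime: "\<And>z. poly p' z \<noteq> 0 \<or> poly q' z \<noteq> 0"
    using common_factor_2[OF q0, of p] by blast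
  define h where "h N = p' - Polynomial.smult (of_nat N) (q')" for N
  have distinct: "N = M" if "poly (h N) t = 0" "poly (h M) t = 0" for N M t
  proof (rule ccontr)
    assume "N \<noteq> M"
    have "of_nat N * poly (q') t = of_nat M * poly (q') t" using that by (simp add: h_def)
    then have "poly (q') t = 0" using \<open>N \<noteq> M\<close> by auto
    moreover from this have "poly (p') t = 0" using that by (simp add: h_def)
    ultimately show False using coprime[of t] by simp
  qed
  \<comment> \<open>Two constant differences would make numerator and denominator constant, hence
    proportional.\<close>
  have deg: "N = M" if N: "degree (h N) = 0" and M: "degree (h M) = 0" for N M
  proof (rule ccontr)
    assume NM: "N \<noteq> M"
    obtain a where a: "h N = [:a:]" using N degree_eq_zeroE by blast
    obtain b where b: "h M = [:b:]" using M degree_eq_zeroE by blast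
    define e where "e = (of_nat M - of_nat N :: 'a)"
    have e: "e \<noteq> 0" using NM by (simp add: e_def)
    have "Polynomial.smult e (q') = h N - h M"
      by (rule poly_eqI) (simp add: h_def e_def algebra_simps)
    then have "Polynomial.smult (inverse e) (Polynomial.smult e (q')) = Polynomial.smult (inverse e) [:a - b:]"
      by (simp add: a b)
    then have r1: "q' = [:inverse e * (a - b):]" using e by simp
    have "p' = h N + Polynomial.smult (of_nat N) (q')" by (simp add: h_def)
    then obtain a' where r0: "p' = [:a':]" unfolding a r1 by simp
    define b' where "b' = inverse e * (a - b)"
    have b': "b' \<noteq> 0" using q0 r1 by (auto simp: q b'_def)
    have "p = Polynomial.smult (a' / b') q"
      unfolding p q r0 r1 b'_def[symmetric] using b' by (simp add: mult.commute)
    then show False using nc by blast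
  qed
  have "\<forall>N. degree (h N) > 0 \<longrightarrow> (\<exists>t. poly (h N) t = 0)" using alg_closed_root by blast
  then obtain t where t: "\<And>N. degree (h N) > 0 \<Longrightarrow> poly (h N) (t N) = 0" by metis
  define S where "S = {N. degree (h N) > 0}"
  have "inj_on t S" using t distinct unfolding S_def inj_on_def by (metis mem_Collect_eq)
  moreover have "t ` S \<subseteq> Z"
  proof safe
    fix N assume "N \<in> S"
    then have "poly p (t N) = of_nat N * poly q (t N)"
      using t[of N] by (simp add: S_def h_def p q)
    then show "t N \<in> Z" using contra by blast
  qed
  ultimately have "finite S" using Z by (metis finite_imageD finite_subset)
  moreover have "finite (- S)"
  proof (cases "- S = {}")
    case False
    then obtain M where "M \<in> - S" by auto
    then have "- S \<subseteq> {M}" using deg by (auto simp: S_def)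
    then show ?thesis by (rule finite_subset) simp
  qed simp
  ultimately have "finite (S \<union> - S)" by blast
  then show False by simp
qed

text \<open>The multiplicities add up to 3, so one of them is odd. Oddness is all that the sign
  change of \<open>s\<close> requires; the slice of the cubic may be tangent.\<close>

lemma cubic_odd_root:
  fixes q :: "'a::alg_closed_field poly"
  assumes "degree q = 3"
  shows "\<exists>\<xi> g r. odd r \<and> q = [:- \<xi>, 1:] ^ r * g \<and> poly g \<xi> \<noteq> 0"
proof -
  have factor: "\<exists>z h. p = [:- z, 1:] * h \<and> degree h = n" if d: "degree p = Suc n" for p :: "'a poly" and n
  proof -
    obtain z where "poly p z = 0" using alg_closed_root[of p] d by auto
    then obtain h where h: "p = [:- z, 1:] * h" by (auto simp: poly_eq_0_iff_dvd)
    then have "h \<noteq> 0" using d by auto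
    then have "degree p = Suc (degree h)" unfolding h by (subst degree_mult_eq) auto
    then show ?thesis using h d by auto
  qed
  obtain r1 h1 where h1: "q = [:- r1, 1:] * h1" "degree h1 = 2"
    using factor[of q 2] assms by auto
  obtain r2 h2 where h2: "h1 = [:- r2, 1:] * h2" "degree h2 = 1"
    using factor[of h1 1] h1(2) by auto
  obtain r3 h3 where h3: "h2 = [:- r3, 1:] * h3" "degree h3 = 0"
    using factor[of h2 0] h2(2) by auto
  obtain c where c: "h3 = [:c:]" using h3(2) degree_eq_zeroE by blast
  have c0: "c \<noteq> 0" using h2(2) h3(1) c by auto
  have q: "q = [:- r1, 1:] * ([:- r2, 1:] * ([:- r3, 1:] * [:c:]))" using h1 h2 h3 c by simp
  show ?thesis
  proof (cases "r1 = r2 \<or> r1 = r3")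
    case False
    have "poly h1 r1 = (r1 - r2) * ((r1 - r3) * c)"
      unfolding h2(1) h3(1) c by (simp add: algebra_simps)
    then have "poly h1 r1 \<noteq> 0" using False c0 by simp
    then show ?thesis by (intro exI[of _ r1] exI[of _ h1] exI[of _ 1]) (simp only: h1(1), simp)
  next
    case True
    \<comment> \<open>The root left over when two of the three coincide; it is simple unless all
      three are equal.\<close>
    define s where "s = (if r1 = r2 then r3 else r2)"
    have qs: "q = [:- s, 1:] * ([:- r1, 1:] * ([:- r1, 1:] * [:c:]))"
      unfolding q s_def using True by (auto simp only: mult.left_commute if_True if_False split: if_splits)
    show ?thesis
    proof (cases "s = r1")
      case True
      then show ?thesis
        by (intro exI[of _ r1] exI[of _ "[:c:]"] exI[of _ 3])
           (simp only: qs, simp add: c0 power3_eq_cube mult.assoc del: mult_pCons_left mult_pCons_right)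
    next
      case False
      then show ?thesis
        by (intro exI[of _ s] exI[of _ "[:- r1, 1:] * ([:- r1, 1:] * [:c:])"] exI[of _ 1])
           (simp only: qs, simp add: c0 del: mult_pCons_left mult_pCons_right)
    qed
  qed
qed

section \<open>Arcs through the cubic curve\<close>

definition swap01 :: "(nat \<Rightarrow> 'a) \<Rightarrow> nat \<Rightarrow> 'a" where
  "swap01 x = (\<lambda>i. if i = 0 then x 1 else if i = 1 then x 0 else x i)"

definition scale01 :: "'a::times \<Rightarrow> 'a \<Rightarrow> (nat \<Rightarrow> 'a) \<Rightarrow> nat \<Rightarrow> 'a" where
  "scale01 b c x = (\<lambda>i. if i = 0 then b * x 0 else if i = 1 then c * x 1 else x i)"

text \<open>On the line \<open>(1, \<alpha> + \<delta> X, X)\<close> put \<open>X = \<xi> + s\<^sup>2\<close>, where \<open>\<xi>\<close> is an \<open>r\<close>-fold zero of \<open>f\<close>, and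
  distribute the zero of order \<open>2 r\<close> in \<open>s\<close> evenly over the first two coordinates; the last argument is
  the remaining factor.  For odd \<open>r\<close> the central involution becomes \<open>s \<mapsto> - s\<close>.\<close>

definition arc :: "('a \<Rightarrow> 'b::comm_ring_1) \<Rightarrow> nat \<Rightarrow> 'a \<Rightarrow> 'a \<Rightarrow> 'a \<Rightarrow> 'b \<Rightarrow> 'b \<Rightarrow> 'b \<Rightarrow> nat \<Rightarrow> 'b" where
  "arc h r \<alpha> \<delta> \<xi> t s g = (\<lambda>i. if i = 0 then s ^ r * t ^ 2 else if i = 1 then s ^ r * g
     else if i = 2 then t else if i = 3 then (h \<alpha> + h \<delta> * (h \<xi> + s ^ 2)) * t
     else (h \<xi> + s ^ 2) * t)"

lemma arc_hom:
  assumes "comm_ring_hom \<theta>"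
  shows "\<theta> (arc h r \<alpha> \<delta> \<xi> t s g i) = arc (\<lambda>c. \<theta> (h c)) r \<alpha> \<delta> \<xi> (\<theta> t) (\<theta> s) (\<theta> g) i"
proof -
  interpret comm_ring_hom \<theta> by fact
  show ?thesis by (auto simp: arc_def hom_mult hom_add hom_power)
qed

lemma swap01_hom: "\<theta> (swap01 x i) = swap01 (\<lambda>i. \<theta> (x i)) i"
  by (auto simp: swap01_def)

lemma scale01_hom:
  assumes "comm_ring_hom \<theta>"
  shows "\<theta> (scale01 b c x i) = scale01 (\<theta> b) (\<theta> c) (\<lambda>i. \<theta> (x i)) i"
proof -
  interpret comm_ring_hom \<theta> by fact
  show ?thesis by (auto simp: scale01_def hom_mult)
qed

text \<open>With \<open>t'\<close> the inverse of \<open>t\<close>: the reflection moves the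
  position from \<open>t\<close> to \<open>g / t\<close>, up to the scalar \<open>t^2 / g\<close>,
  which is invisible projectively. Denominators are cleared to stay in a ring.\<close>

lemma arc_scale:
  assumes "t * t' = 1"
  shows "g * swap01 (arc h r \<alpha> \<delta> \<xi> t s g) i = t ^ 2 * arc h r \<alpha> \<delta> \<xi> (g * t') s g i"
proof -
  have t: "t * (t' * u) = u" for u using assms by (metis mult.assoc mult_1_left)
  show ?thesis by (auto simp: arc_def swap01_def power2_eq_square t assms algebra_simps)
qed

text \<open>The rotation by \<open>b\<close> moves the position from \<open>t\<close> to
  \<open>b * t\<close>, up to the scalar \<open>b\<close>.\<close>

lemma arc_scale_tau:
  assumes "b * b' = 1"
  shows "b * scale01 b b' (arc h r \<alpha> \<delta> \<xi> t s g) i = arc h r \<alpha> \<delta> \<xi> (b * t) s g i"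
proof -
  have t: "b * (b' * u) = u" for u using assms by (metis mult.assoc mult_1_left)
  show ?thesis
    by (auto simp: arc_def scale01_def power2_eq_square t algebra_simps)
qed

section \<open>Line sections of the cubic\<close>

context smooth_cubic
begin

definition slice :: "'k \<Rightarrow> 'k \<Rightarrow> 'k poly" where
  "slice \<delta> \<alpha> = subst_polys
     (\<lambda>i. if i = 2 then 1 else if i = 3 then [:\<alpha>, \<delta>:] else [:0, 1:]) f"

lemma poly_slice: "poly (slice \<delta> \<alpha>) s =
  value_at (\<lambda>i. if i = 2 then 1 else if i = 3 then \<alpha> + \<delta> * s else s) f"
  unfolding slice_def
  by (subst eval_mpoly_hom[OF comm_ring_hom_poly_eval], rule eval_mpoly_cong) (auto simp: mult.commute)

lemma eval_f_slice:
  "value_at (\<lambda>i. if i = 2 then t else if i = 3 then (\<alpha> + \<delta> * s) * t else s * t) f =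
    t ^ 3 * poly (slice \<delta> \<alpha>) s"
  unfolding poly_slice eval_mpoly_scale[OF hom, symmetric]
  by (rule eval_mpoly_cong) (auto simp: mult.commute)

text \<open>The leading coefficient is the value of \<open>f\<close> at the point at infinity of the
  line, which depends on \<delta> but not on \<alpha>.\<close>

lemma degree_slice:
  assumes "value_at (\<lambda>i. if i = 2 then 0 else if i = 3 then \<delta> else 1) f \<noteq> 0"
  shows "degree (slice \<delta> \<alpha>) = 3"
proof (rule antisym)
  let ?x = "\<lambda>i::nat. if i = 2 then 1 else if i = 3 then [:\<alpha>, \<delta>:] else [:0, 1:]"
  have "coeff (slice \<delta> \<alpha>) (3 * 1) = value_at (\<lambda>i. coeff (?x i) 1) f"
    unfolding slice_def by (rule eval_mpoly_top_coeff[OF hom]) auto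
  also have "(\<lambda>i. coeff (?x i) 1) = (\<lambda>i. if i = 2 then 0 else if i = 3 then \<delta> else 1)"
    by (auto simp: fun_eq_iff)
  finally show "degree (slice \<delta> \<alpha>) \<ge> 3" using assms by (intro le_degree) simp
  show "degree (slice \<delta> \<alpha>) \<le> 3"
    unfolding slice_def eval_mpoly_def
  proof (rule degree_sum_le)
    fix m assume m: "m \<in> Poly_Mapping.keys f"
    have "degree (\<Prod>i\<in>Poly_Mapping.keys m. ?x i ^ Poly_Mapping.lookup m i) \<le>
        (\<Sum>i\<in>Poly_Mapping.keys m. Poly_Mapping.lookup m i)"
      using coeff_prod_bounded[of "Poly_Mapping.keys m" "\<lambda>i. ?x i ^ Poly_Mapping.lookup m i"
          "Poly_Mapping.lookup m"] coeff_power_bounded[of "?x _" 1] by auto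
    also have "\<dots> = 3" using hom m by (auto simp: homogeneous_def)
    finally show "degree ([:Poly_Mapping.lookup f m:] *
        (\<Prod>i\<in>Poly_Mapping.keys m. ?x i ^ Poly_Mapping.lookup m i)) \<le> 3"
      by simp
  qed auto
qed

text \<open>Otherwise \<open>f\<close> vanishes on the whole line \<open>x 2 = 0\<close>. Its
  derivatives along this line vanish too, and the remaining derivative, a binary quadratic form on
  the line, has a zero there, which would be a singular point.\<close>

lemma direction_exists:
  "\<exists>\<delta>. value_at (\<lambda>i. if i = 2 then 0 else if i = 3 then \<delta> else 1) f \<noteq> 0"
proof (rule ccontr)
  assume "\<not> ?thesis"
  then have z1: "value_at (\<lambda>i. if i = 2 then 0 else if i = 3 then \<delta> else 1) f = 0" for \<delta>
    by blast
  define pt where "pt u v = (\<lambda>i::nat. if i = 2 then 0 else if i = 3 then u else v :: 'k)" for u v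
  have z2: "value_at (pt u v) f = 0" if "v \<noteq> 0" for u v
  proof -
    have "value_at (pt u v) f = value_at
        (\<lambda>i. v * (if i = 2 then 0 else if i = 3 then u / v else 1)) f"
      by (rule eval_mpoly_cong) (use that in \<open>auto simp: pt_def\<close>)
    then show ?thesis by (simp only: eval_mpoly_scale[OF hom] z1 mult_zero_right)
  qed
  have pol: "poly (subst_polys x p) s = value_at (\<lambda>i. poly (x i) s) p"
    for x :: "nat \<Rightarrow> 'k poly" and p s
    by (subst eval_mpoly_hom[OF comm_ring_hom_poly_eval]) simp
  have z3: "subst_polys (\<lambda>i. if i = 2 then 0 else if i = 3 then [:u, u':] else [:v, v':]) f = 0"
    if "v \<noteq> 0 \<or> v' \<noteq> 0" for u u' v v'
  proof -
    let ?q = "subst_polys (\<lambda>i. if i = 2 then 0 else if i = 3 then [:u, u':] else [:v, v':]) f"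
    \<comment> \<open>The vanishing is known where the last coordinate is nonzero; the factor
      \<open>[:v, v':]\<close> covers the exceptional parameter.\<close>
    have "poly (?q * [:v, v':]) s = poly 0 s" for s
    proof (cases "poly [:v, v':] s = 0")
      case False
      have "poly ?q s = value_at (pt (poly [:u, u':] s) (poly [:v, v':] s)) f"
        unfolding pol by (rule eval_mpoly_cong) (auto simp: pt_def)
      then show ?thesis using z2[OF False] by simp
    next
      case True
      then show ?thesis by (simp only: poly_mult mult_zero_right poly_0)
    qed
    then have "?q * [:v, v':] = 0" by (rule poly_eqI_infinite)
    moreover have "[:v, v':] \<noteq> 0" using that by auto
    ultimately show ?thesis using mult_eq_0_iff by blast
  qed
  have der: "value_at (pt u v) (partial_deriv 3 f) * u' +
      value_at (pt u v) (partial_deriv 4 f) * v' = 0" if "v \<noteq> 0 \<or> v' \<noteq> 0" for u u' v v'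
  proof -
    let ?x = "\<lambda>i::nat. if i = 2 then 0 else if i = 3 then [:u, u':] else [:v, v':]"
    have "(\<Sum>i\<in>{2, 3, 4}. subst_polys ?x (partial_deriv i f) * pderiv (?x i)) = 0"
      using pderiv_eval_mpoly[OF _ vars, of ?x] z3[OF that, of u u'] by simp
    then have "poly (subst_polys ?x (partial_deriv 3 f) * [:u':] +
      subst_polys ?x (partial_deriv 4 f) * [:v':]) 0 = 0"
      by (simp add: pderiv_pCons)
    moreover have "(\<lambda>i. poly (?x i) 0) = pt u v" by (auto simp: pt_def fun_eq_iff)
    ultimately show ?thesis by (simp add: pol mult.commute)
  qed
  have d3: "value_at (pt u v) (partial_deriv 3 f) = 0"
    and d4: "value_at (pt u v) (partial_deriv 4 f) = 0" for u v
    using der[of v 1 u 0] der[of v 1 u 1] by auto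
  have "\<exists>u v. (u \<noteq> 0 \<or> v \<noteq> 0) \<and> value_at (pt u v) (partial_deriv 2 f) = 0"
  proof -
    define p where "p = subst_polys (\<lambda>i. if i = 2 then 0 else if i = 3 then [:0, 1:] else 1)
      (partial_deriv 2 f)"
    have p: "poly p u = value_at (pt u 1) (partial_deriv 2 f)" for u
      unfolding p_def pol by (rule eval_mpoly_cong) (auto simp: pt_def)
    show ?thesis
    proof (cases "degree p = 0")
      case False
      then obtain u where "poly p u = 0" using alg_closed_root[of p] by auto
      then show ?thesis using p[of u] by (intro exI[of _ u] exI[of _ 1]) simp
    next
      case True
      then obtain c where c: "p = [:c:]" by (rule degree_eq_zeroE)
      \<comment> \<open>If \<open>p\<close> is the constant \<open>c\<close>, the quadratic form is
        \<open>c\<close> times the square of the last coordinate and vanishes at the point missing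
        from this chart.\<close>
      define q where "q = subst_polys (\<lambda>i. if i = 2 then 0 else if i = 3 then 1 else [:0, 1:])
        (partial_deriv 2 f)"
      have q: "poly q v = value_at (pt 1 v) (partial_deriv 2 f)" for v
        unfolding q_def pol by (rule eval_mpoly_cong) (auto simp: pt_def)
      have qc: "poly q v = v ^ 2 * c" if "v \<noteq> 0" for v
      proof -
        have "value_at (pt 1 v) (partial_deriv 2 f) =
            value_at (\<lambda>i. v * pt (1 / v) 1 i) (partial_deriv 2 f)"
          by (rule eval_mpoly_cong) (use that in \<open>auto simp: pt_def\<close>)
        then show ?thesis
          unfolding q eval_mpoly_scale[OF hom_deriv] p[symmetric] c by simp
      qed
      have "q * [:0, 1:] = [:0, 0, c:] * [:0, 1:]"
      proof (rule poly_eqI_infinite)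
        show "poly (q * [:0, 1:]) v = poly ([:0, 0, c:] * [:0, 1:]) v" for v
          using qc[of v] by (cases "v = 0") (auto simp: power2_eq_square)
      qed
      then have "q = [:0, 0, c:]" by (metis mult_cancel_right pCons_eq_0_iff zero_neq_one)
      then have "poly q 0 = 0" by simp
      then show ?thesis using q[of 0] by (intro exI[of _ 1] exI[of _ 0]) simp
    qed
  qed
  then obtain u v where "u \<noteq> 0 \<or> v \<noteq> 0" "value_at (pt u v) (partial_deriv 2 f) = 0"
    by blast
  then show False using smooth[of "pt u v"] d3[of u v] d4[of u v] by (auto simp: pt_def)
qed

end

section \<open>Linearizations in eigencoordinates\<close>

locale linearization_data = smooth_cubic f
  for f :: "'k::{alg_closed_field, field_char_0} mpoly" +
  fixes D D' d :: nat and \<phi> \<psi> :: "nat \<Rightarrow> 'k mpoly" and L V :: "nat \<Rightarrow> nat \<Rightarrow> 'k" and a \<mu> :: 'k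
  assumes unc: "uncountable (UNIV :: 'k set)"
    and phi: "\<And>j. j < d \<Longrightarrow> homogeneous D (\<phi> j)" "\<And>j. j < d \<Longrightarrow> vars (\<phi> j) \<subseteq> {..<5}"
    and psi: "\<And>i. i < 5 \<Longrightarrow> homogeneous D' (\<psi> i)" "\<And>i. i < 5 \<Longrightarrow> vars (\<psi> i) \<subseteq> {..<d}"
    and dual: "\<And>j j'. j < d \<Longrightarrow> j' < d \<Longrightarrow> (\<Sum>m<4. L m j' * V m j) = (if j = j' then 1 else 0)"
    and a0: "a \<noteq> 0" and mu: "\<mu> \<noteq> 1"
begin

text \<open>The pullback of the linear form \<open>L m\<close> along \<phi>. The structure map
  \<open>h\<close> is a parameter so that the same expression makes sense at points, for polynomial
  arcs and for power series arcs.\<close>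

definition lin :: "('k \<Rightarrow> 'b) \<Rightarrow> (nat \<Rightarrow> 'b::comm_ring_1) \<Rightarrow> nat \<Rightarrow> 'b" where
  "lin h x m = (\<Sum>j<d. h (L m j) * eval_mpoly h x (\<phi> j))"

definition comp :: "('k \<Rightarrow> 'b) \<Rightarrow> (nat \<Rightarrow> 'b::comm_ring_1) \<Rightarrow> nat \<Rightarrow> 'b" where
  "comp h x i = eval_mpoly h (\<lambda>j. eval_mpoly h x (\<phi> j)) (\<psi> i)"

abbreviation lin_at :: "(nat \<Rightarrow> 'k) \<Rightarrow> nat \<Rightarrow> 'k" where
  "lin_at \<equiv> lin (\<lambda>c. c)"

abbreviation comp_at :: "(nat \<Rightarrow> 'k) \<Rightarrow> nat \<Rightarrow> 'k" where
  "comp_at \<equiv> comp (\<lambda>c. c)"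

definition on_X :: "(nat \<Rightarrow> 'k) \<Rightarrow> bool" where
  "on_X x \<longleftrightarrow> x 2 \<noteq> 0 \<and> x 0 * x 1 * x 2 + value_at x f = 0"

lemma lin_hom:
  assumes "comm_ring_hom \<theta>"
  shows "\<theta> (lin h x m) = lin (\<lambda>c. \<theta> (h c)) (\<lambda>i. \<theta> (x i)) m"
proof -
  interpret comm_ring_hom \<theta> by fact
  show ?thesis
    unfolding lin_def hom_sum hom_mult by (simp only: eval_mpoly_hom[OF assms])
qed

lemma comp_hom:
  assumes "comm_ring_hom \<theta>"
  shows "\<theta> (comp h x m) = comp (\<lambda>c. \<theta> (h c)) (\<lambda>i. \<theta> (x i)) m"
  unfolding comp_def by (simp only: eval_mpoly_hom[OF assms])

lemma lin_cong: "(\<And>i. i < 5 \<Longrightarrow> x i = y i) \<Longrightarrow> lin h x m = lin h y m"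
  unfolding lin_def using phi(2)
  by (intro sum.cong refl arg_cong2[of _ _ _ _ "(*)"] eval_mpoly_cong) auto

lemma comp_cong: "i < 5 \<Longrightarrow> (\<And>i. i < 5 \<Longrightarrow> x i = y i) \<Longrightarrow> comp h x i = comp h y i"
  unfolding comp_def using phi(2) psi(2) by (intro eval_mpoly_cong refl) auto

lemma lin_scale: "lin h (\<lambda>i. c * x i) m = c ^ D * lin h x m"
  unfolding lin_def sum_distrib_left
  by (intro sum.cong refl) (simp add: eval_mpoly_scale[OF phi(1)] mult.left_commute)

lemma comp_scale:
  assumes "i < 5"
  shows "comp h (\<lambda>i. c * x i) i = c ^ (D * D') * comp h x i"
proof -
  have "comp h (\<lambda>i. c * x i) i = eval_mpoly h (\<lambda>j. c ^ D * eval_mpoly h x (\<phi> j)) (\<psi> i)"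
    unfolding comp_def
    using psi(2)[OF assms] by (intro eval_mpoly_cong refl) (auto intro: eval_mpoly_scale[OF phi(1)])
  then show ?thesis
    unfolding comp_def by (simp add: eval_mpoly_scale[OF psi(1)[OF assms]] power_mult)
qed

lemma recover:
  assumes "comm_ring_hom h" "j < d"
  shows "eval_mpoly h x (\<phi> j) = (\<Sum>m<4. lin h x m * h (V m j))"
proof -
  interpret comm_ring_hom h by fact
  have "(\<Sum>m<4. lin h x m * h (V m j)) =
      (\<Sum>j'<d. eval_mpoly h x (\<phi> j') * (\<Sum>m<4. h (L m j' * V m j)))"
    unfolding lin_def sum_distrib_left sum_distrib_right
    by (subst sum.swap) (simp add: hom_mult ac_simps)
  also have "\<dots> = (\<Sum>j'<d. eval_mpoly h x (\<phi> j') * (if j = j' then 1 else 0))"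
    by (intro sum.cong refl) (simp add: hom_sum[symmetric] dual[OF assms(2)])
  also have "\<dots> = (\<Sum>j'<d. if j = j' then eval_mpoly h x (\<phi> j') else 0)"
    by (intro sum.cong) auto
  also have "\<dots> = eval_mpoly h x (\<phi> j)"
    using assms(2) by (subst sum.delta') auto
  finally show ?thesis by simp
qed

end

text \<open>The quotient of forms 0 and 1 is inverted by the reflection and multiplied by \<mu>
  under the rotation; the quotient of forms 2 and 1 changes sign under the central involution. All
  relations are cross-multiplied, and \<open>birational\<close> carries the factor
  \<open>lin_at x 1\<close>, so that they persist where \<phi> is undefined.\<close>

locale equivariant_linearization = linearization_data f D D' d \<phi> \<psi> L V a \<mu>
  for f :: "'k::{alg_closed_field, field_char_0} mpoly" and D D' d \<phi> \<psi> L V a \<mu> +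
  assumes sigma: "\<And>x. on_X x \<Longrightarrow> lin_at (swap01 x) 0 * lin_at x 0 =
      lin_at (swap01 x) 1 * lin_at x 1"
    and tau: "\<And>x. on_X x \<Longrightarrow> lin_at (scale01 a (inverse a) x) 0 * lin_at x 1 =
      \<mu> * (lin_at (scale01 a (inverse a) x) 1 * lin_at x 0)"
    and iota: "\<And>x. on_X x \<Longrightarrow> lin_at (scale01 (- 1) (- 1) x) 2 * lin_at x 1 =
      - (lin_at (scale01 (- 1) (- 1) x) 1 * lin_at x 2)"
    and birational: "\<And>x i j. on_X x \<Longrightarrow> i < 5 \<Longrightarrow> j < 5 \<Longrightarrow>
      lin_at x 1 * (comp_at x i * x j) = lin_at x 1 * (comp_at x j * x i)"
    and generic: "\<exists>x. on_X x \<and> x 0 \<noteq> 0 \<and> x 1 \<noteq> 0 \<and> (\<forall>m<3. lin_at x m \<noteq> 0) \<and>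
      comp_at x 2 \<noteq> 0"
begin

end

context equivariant_linearization
begin

lemma on_X_arc:
  assumes "slice \<delta> \<alpha> = [:- \<xi>, 1:] ^ r * g" "t \<noteq> 0"
  shows "on_X (arc (\<lambda>c. c) r \<alpha> \<delta> \<xi> t s (- poly g (\<xi> + s ^ 2)))"
proof -
  let ?x = "arc (\<lambda>c. c) r \<alpha> \<delta> \<xi> t s (- poly g (\<xi> + s ^ 2))"
  have "value_at ?x f = value_at (\<lambda>i. if i = 2 then t else if i = 3 then
      (\<alpha> + \<delta> * (\<xi> + s ^ 2)) * t else (\<xi> + s ^ 2) * t) f"
    by (rule eval_mpoly_cong) (use vars in \<open>auto simp: arc_def\<close>)
  also have "\<dots> = t ^ 3 * ((s ^ 2) ^ r * poly g (\<xi> + s ^ 2))"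
    unfolding eval_f_slice assms(1) by simp
  finally show ?thesis
    using assms(2) by (simp add: on_X_def arc_def power2_eq_square power3_eq_cube power_mult_distrib mult_ac)
qed

text \<open>The generic point is moved by varying \<alpha> while its first and last affine
  coordinates \<open>X\<close> and \<open>S\<close> are kept. The required nonvanishing is that of a
  polynomial in \<alpha>, which is nonzero at the original value \<open>\<alpha>0\<close>; the moved
  point lies on the arc for \<alpha>.\<close>

lemma generic_arc:
  "\<exists>B. finite B \<and> (\<forall>\<alpha> \<xi> r g. \<alpha> \<notin> B \<longrightarrow> slice \<delta> \<alpha> = [:- \<xi>, 1:] ^ r * g \<longrightarrow> 0 < r \<longrightarrow>
    (\<exists>t s. t \<noteq> 0 \<and> (let x = arc (\<lambda>c. c) r \<alpha> \<delta> \<xi> t s (- poly g (\<xi> + s ^ 2)) in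
      (\<forall>m<3. lin_at x m \<noteq> 0) \<and> comp_at x 2 \<noteq> 0)))"
proof -
  obtain x where x: "on_X x" "x 0 \<noteq> 0" "x 1 \<noteq> 0" "\<And>m. m < 3 \<Longrightarrow> lin_at x m \<noteq> 0"
    "comp_at x 2 \<noteq> 0"
    using generic by blast
  have x2: "x 2 \<noteq> 0" using x(1) by (simp add: on_X_def)
  define X where "X = x 0 / x 2"
  define S where "S = x 4 / x 2"
  define \<alpha>0 where "\<alpha>0 = x 3 / x 2 - \<delta> * S"
  have X0: "X \<noteq> 0" using x(2) x2 by (simp add: X_def)
  \<comment> \<open>The moved point times \<open>X\<close>, which clears the denominator in the
    coordinate 1, solved from the equation of the threefold.\<close>
  define z where "z = (\<lambda>i::nat. if i = 0 then [:X ^ 2:] else if i = 1 then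
      - subst_polys (\<lambda>i. if i = 2 then 1 else if i = 3 then [:\<delta> * S, 1:] else [:S:]) f
    else if i = 2 then [:X:] else if i = 3 then [:X * \<delta> * S, X:] else [:X * S:])"
  have z1: "poly (z 1) \<alpha> = - poly (slice \<delta> \<alpha>) S" for \<alpha>
    unfolding poly_slice z_def
    by (simp, subst eval_mpoly_hom[OF comm_ring_hom_poly_eval], rule eval_mpoly_cong) (auto simp: add.commute)
  have lin_z: "poly (lin (\<lambda>c. [:c:]) z m) \<alpha> = lin_at (\<lambda>i. poly (z i) \<alpha>) m" for m \<alpha>
    by (subst lin_hom[OF comm_ring_hom_poly_eval]) simp
  have comp_z: "poly (comp (\<lambda>c. [:c:]) z m) \<alpha> = comp_at (\<lambda>i. poly (z i) \<alpha>) m" for m \<alpha>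
    by (subst comp_hom[OF comm_ring_hom_poly_eval]) simp
  have fx: "x 0 * x 1 * x 2 + x 2 ^ 3 * poly (slice \<delta> \<alpha>0) S = 0"
  proof -
    have "value_at x f = value_at (\<lambda>i. if i = 2 then x 2 else if i = 3 then
      (\<alpha>0 + \<delta> * S) * x 2 else S * x 2) f"
      by (rule eval_mpoly_cong) (use vars x2 in \<open>auto simp: \<alpha>0_def S_def\<close>)
    then show ?thesis using x(1) unfolding on_X_def eval_f_slice by simp
  qed
  have z0: "poly (z i) \<alpha>0 = X / x 2 * x i" if "i < 5" for i
  proof -
    consider "i = 0" | "i = 1" | "i = 2" | "i = 3" | "i = 4" using \<open>i < 5\<close> by linarith
    then show ?thesis
    proof cases
      case 2
      have "(poly (slice \<delta> \<alpha>0) S * x 2 ^ 2) * x 2 = (- (x 0 * x 1)) * x 2"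
        using fx by (simp add: power2_eq_square power3_eq_cube algebra_simps add_eq_0_iff)
      then have "poly (slice \<delta> \<alpha>0) S * x 2 ^ 2 = - (x 0 * x 1)"
        using x2 mult_right_cancel by blast
      then have "poly (slice \<delta> \<alpha>0) S = - (x 0 * x 1) / x 2 ^ 2"
        using x2 by (subst eq_divide_eq) simp
      then show ?thesis using 2 x2 z1[of \<alpha>0] by (simp add: X_def power2_eq_square)
    qed (use x2 in \<open>auto simp: z_def X_def S_def \<alpha>0_def power2_eq_square field_simps\<close>)
  qed
  define P where "P = z 1 * lin (\<lambda>c. [:c:]) z 0 * lin (\<lambda>c. [:c:]) z 1 * lin (\<lambda>c. [:c:]) z 2 * comp (\<lambda>c. [:c:]) z 2"
  have "lin_at (\<lambda>i. poly (z i) \<alpha>0) m = (X / x 2) ^ D * lin_at x m" for m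
    unfolding lin_scale[symmetric] by (rule lin_cong) (rule z0)
  moreover have "comp_at (\<lambda>i. poly (z i) \<alpha>0) 2 = (X / x 2) ^ (D * D') * comp_at x 2"
    by (subst comp_scale[symmetric], simp, rule comp_cong) (simp, rule z0)
  moreover have "poly (z 1) \<alpha>0 \<noteq> 0" using z0[of 1] X0 x2 x(3) by simp
  ultimately have "poly P \<alpha>0 \<noteq> 0"
    unfolding P_def poly_mult lin_z comp_z using X0 x2 x(3) x(4)[of 0] x(4)[of 1] x(4)[of 2] x(5)
    by simp
  then have "P \<noteq> 0" by auto
  then have fin: "finite {\<alpha>. poly P \<alpha> = 0}" by (rule poly_roots_finite)
  have "\<exists>t s. t \<noteq> 0 \<and> (let x = arc (\<lambda>c. c) r \<alpha> \<delta> \<xi> t s (- poly g (\<xi> + s ^ 2)) in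
      (\<forall>m<3. lin_at x m \<noteq> 0) \<and> comp_at x 2 \<noteq> 0)"
    if \<alpha>: "poly P \<alpha> \<noteq> 0" and sl: "slice \<delta> \<alpha> = [:- \<xi>, 1:] ^ r * g" and r: "0 < r" for \<alpha> \<xi> r g
  proof -
    have "poly (slice \<delta> \<alpha>) S \<noteq> 0" using \<alpha> z1[of \<alpha>] by (auto simp: P_def)
    then have S: "S \<noteq> \<xi>" using sl r by auto
    have "degree [:- (S - \<xi>), 0, 1:] > 0" by simp
    then obtain s where "poly [:- (S - \<xi>), 0, 1:] s = 0" using alg_closed_root by blast
    then have s: "s ^ 2 = S - \<xi>" by (simp add: power2_eq_square algebra_simps)
    then have s0: "s \<noteq> 0" using S by auto
    \<comment> \<open>Read off from the arc, whose first affine coordinate is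
      \<open>s ^ r * t\<close>; likewise its last one dictates
      \<open>s ^ 2 = S - \<xi>\<close>.\<close>
    define t where "t = X / s ^ r"
    have t0: "t \<noteq> 0" using s0 X0 by (simp add: t_def)
    define y where "y = arc (\<lambda>c. c) r \<alpha> \<delta> \<xi> t s (- poly g (\<xi> + s ^ 2))"
    have sS: "\<xi> + s ^ 2 = S" using s by simp
    have key: "X * y i = t * poly (z i) \<alpha>" if "i < 5" for i
    proof -
      consider "i = 0" | "i = 1" | "i = 2" | "i = 3" | "i = 4" using \<open>i < 5\<close> by linarith
      then show ?thesis
      proof cases
        case 1
        then show ?thesis using s0 by (simp add: y_def arc_def z_def t_def power2_eq_square field_simps)
      next
        case 2
        have "poly (slice \<delta> \<alpha>) S = (s ^ 2) ^ r * poly g S" unfolding sl s by simp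
        then have "poly (slice \<delta> \<alpha>) S = s ^ r * s ^ r * poly g S"
          by (simp add: power2_eq_square power_mult_distrib)
        then show ?thesis using 2 s0 z1[of \<alpha>] by (simp add: y_def arc_def sS t_def field_simps)
      qed (auto simp: y_def arc_def z_def sS algebra_simps)
    qed
    have "X ^ D * lin_at y m = t ^ D * lin_at (\<lambda>i. poly (z i) \<alpha>) m" for m
      unfolding lin_scale[symmetric] by (rule lin_cong) (rule key)
    then have "lin_at y m \<noteq> 0" if "lin_at (\<lambda>i. poly (z i) \<alpha>) m \<noteq> 0" for m
      using that t0 X0 by (metis mult_eq_0_iff power_not_zero)
    moreover have "X ^ (D * D') * comp_at y 2 = t ^ (D * D') * comp_at (\<lambda>i. poly (z i) \<alpha>) 2"
      using comp_scale[of 2 "\<lambda>c. c" X y] comp_scale[of 2 "\<lambda>c. c" t "\<lambda>i. poly (z i) \<alpha>"]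
        comp_cong[of 2 "\<lambda>i. X * y i" "\<lambda>i. t * poly (z i) \<alpha>" "\<lambda>c. c"] key by simp
    then have "comp_at y 2 \<noteq> 0"
      using \<alpha> t0 X0 by (auto simp: P_def comp_z)
    moreover have "lin_at (\<lambda>i. poly (z i) \<alpha>) m \<noteq> 0" if "m < 3" for m
    proof -
      consider "m = 0" | "m = 1" | "m = 2" using \<open>m < 3\<close> by linarith
      then show ?thesis using \<alpha> by cases (auto simp: P_def lin_z)
    qed
    ultimately show ?thesis using t0 unfolding y_def Let_def by blast
  qed
  then show ?thesis using fin by (intro exI[of _ "{\<alpha>. poly P \<alpha> = 0}"]) blast
qed

end

section \<open>Orders and values along the exceptional divisor\<close>

lemma factor_X_power_single:
  fixes p :: "'a::comm_ring_1 fps poly"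
  assumes "p \<noteq> 0"
  shows "\<exists>n q. p = [:fps_X ^ n:] * q \<and> reduct q \<noteq> 0"
  using factor_X_power[of "{0}" 0 "\<lambda>_. p"] assms by auto

lemma X_power_mult_cancel:
  fixes p q :: "'a::idom fps"
  assumes eq: "fps_X ^ m * p = fps_X ^ n * q" and "fps_nth p 0 \<noteq> 0" "fps_nth q 0 \<noteq> 0"
  shows "m = n" "p = q"
proof -
  have "fps_nth (fps_X ^ m * p) i = fps_nth (fps_X ^ n * q) i" for i using eq by simp
  from this[of m] this[of n] show "m = n"
    using assms(2,3) by (cases m n rule: linorder_cases) (auto simp: fps_X_power_mult_nth)
  then show "p = q" using eq by simp
qed

lemma fps_of_poly_linear: "fps_of_poly [:0, 1:] = fps_X"
  by (rule fps_ext) (auto simp: coeff_pCons fps_X_def split: nat.splits)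

lemma eval_series_const: "eval_series t [:p:] = fps_of_poly p"
  by (simp add: eval_series_def to_series_pCons)

lemma eval_series_var: "eval_series t [:0, 1:] = t"
  by (simp add: eval_series_def to_series_pCons)

context equivariant_linearization
begin

theorem no_equivariant_linearization: False
proof -
  obtain \<delta> where \<delta>: "value_at (\<lambda>i. if i = 2 then 0 else if i = 3 then \<delta> else 1) f \<noteq> 0"
    using direction_exists by blast
  \<comment> \<open>The data from which the limit is computed on the way back to the threefold: the
    cubic, the inverse map \<psi>, the dual vectors \<open>V\<close> and the direction
    \<delta>.\<close>
  define coeff_set where "coeff_set = insert \<delta> (Poly_Mapping.lookup f ` Poly_Mapping.keys f \<union>
    (\<Union>i<5. Poly_Mapping.lookup (\<psi> i) ` Poly_Mapping.keys (\<psi> i)) \<union> (\<Union>m<4. V m ` {..<d}))"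
  have "finite coeff_set" by (simp add: coeff_set_def)
  then obtain K where K: "countable K" "coeff_set \<subseteq> K" "root_closed_subring K"
    using countable_root_closed_subring[OF countable_finite] by blast
  interpret K: root_closed K by unfold_locales (rule K)
  have lookup_K: "Poly_Mapping.lookup p m \<in> K" if "Poly_Mapping.lookup p ` Poly_Mapping.keys p \<subseteq> K"
    for p :: "'k mpoly" and m
    using that K.zero by (cases "m \<in> Poly_Mapping.keys p") (auto simp: in_keys_iff)
  have f_K: "Poly_Mapping.lookup f m \<in> K" for m
    by (rule lookup_K) (use K(2) in \<open>auto simp: coeff_set_def\<close>)
  have K_proper: "K \<noteq> UNIV" using K(1) unc by auto
  interpret K: smooth_cubic_over f K
    by unfold_locales (rule f_K, rule K_proper)
  have \<delta>_K: "\<delta> \<in> K" using K(2) by (auto simp: coeff_set_def)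
  obtain B where B: "finite B" "\<And>\<alpha> \<xi> r g. \<alpha> \<notin> B \<Longrightarrow> slice \<delta> \<alpha> = [:- \<xi>, 1:] ^ r * g \<Longrightarrow> 0 < r \<Longrightarrow>
    (\<exists>t s. t \<noteq> 0 \<and> (let x = arc (\<lambda>c. c) r \<alpha> \<delta> \<xi> t s (- poly g (\<xi> + s ^ 2)) in
      (\<forall>m<3. lin_at x m \<noteq> 0) \<and> comp_at x 2 \<noteq> 0))"
    using generic_arc[of \<delta>] by blast
  have "countable (K \<union> B)" using K(1) B(1) by (simp add: countable_finite)
  \<comment> \<open>Uncountability of the ground field is used here: \<alpha> avoids the countable
    set \<open>K\<close> and the finite set \<open>B\<close>.\<close>
  then obtain \<alpha> where \<alpha>: "\<alpha> \<notin> K" "\<alpha> \<notin> B" using unc by (metis UNIV_I UnI1 UnI2 countable_subset subsetI)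
  obtain \<xi> g r where r: "odd r" and sl: "slice \<delta> \<alpha> = [:- \<xi>, 1:] ^ r * g" and g: "poly g \<xi> \<noteq> 0"
    using cubic_odd_root[OF degree_slice[OF \<delta>]] by blast
  have r0: "0 < r" using r by (cases r) auto
  define gh where "gh = - pcompose g [:\<xi>, 0, 1:]"
  have gh: "poly gh s = - poly g (\<xi> + s ^ 2)" for s
    by (simp add: gh_def poly_pcompose power2_eq_square)
  let ?arc = "\<lambda>t s. arc (\<lambda>c. c) r \<alpha> \<delta> \<xi> t s (poly gh s)"
  have onX: "on_X (?arc t s)" if "t \<noteq> 0" for t s
    unfolding gh by (rule on_X_arc[OF sl that])
  define hh where "hh = (\<lambda>c::'k. [:[:c:]:])"
  define \<gamma> where "\<gamma> = arc hh r \<alpha> \<delta> \<xi> [:0, 1:] [:[:0, 1:]:] [:gh:]"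
  \<comment> \<open>The arc \<gamma> has indeterminate position and parameter. Relations are checked
    on its values at numbers and then read on its values at power series.\<close>
  have ev_hh: "eval2 t s (hh c) = c" for t s c by (simp add: eval2_def hh_def)
  have ev_\<gamma>: "(\<lambda>i. eval2 t s (\<gamma> i)) = ?arc t s" for t s
    unfolding \<gamma>_def by (rule ext, subst arc_hom[OF comm_ring_hom_eval2]) (simp add: ev_hh, simp add: eval2_def)
  have ev_lin: "eval2 t s (lin hh x m) = lin_at (\<lambda>i. eval2 t s (x i)) m" for t s x m
    by (subst lin_hom[OF comm_ring_hom_eval2]) (simp add: ev_hh)
  have ev_comp: "eval2 t s (comp hh x m) = comp_at (\<lambda>i. eval2 t s (x i)) m" for t s x m
    by (subst comp_hom[OF comm_ring_hom_eval2]) (simp add: ev_hh)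
  interpret ev: comm_ring_hom "eval2 t s" for t s :: 'k by (rule comm_ring_hom_eval2)
  have ev_swap: "(\<lambda>i. eval2 t s (swap01 \<gamma> i)) = swap01 (?arc t s)" for t s
    unfolding ev_\<gamma>[symmetric] by (rule ext, rule swap01_hom)
  have ev_scale: "(\<lambda>i. eval2 t s (scale01 (hh b) (hh c) \<gamma> i)) = scale01 b c (?arc t s)" for t s b c
    unfolding ev_\<gamma>[symmetric] by (rule ext, subst scale01_hom[OF comm_ring_hom_eval2]) (simp add: ev_hh)
  define U where "U m = lin hh \<gamma> m" for m
  have sig2: "lin hh (swap01 \<gamma>) 0 * U 0 - lin hh (swap01 \<gamma>) 1 * U 1 = 0"
    by (rule zero_if_eval2_zero)
      (simp add: U_def ev.hom_minus ev.hom_mult ev_lin ev_\<gamma> ev_swap sigma[OF onX] del: One_nat_def)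
  have tau2: "lin hh (scale01 (hh a) (hh (inverse a)) \<gamma>) 0 * U 1 -
      hh \<mu> * (lin hh (scale01 (hh a) (hh (inverse a)) \<gamma>) 1 * U 0) = 0"
    by (rule zero_if_eval2_zero)
      (simp add: U_def ev.hom_minus ev.hom_mult ev_lin ev_\<gamma> ev_scale ev_hh tau[OF onX] del: One_nat_def)
  have iota2: "lin hh (scale01 (hh (- 1)) (hh (- 1)) \<gamma>) 2 * U 1 +
      lin hh (scale01 (hh (- 1)) (hh (- 1)) \<gamma>) 1 * U 2 = 0"
    by (rule zero_if_eval2_zero)
      (simp add: U_def ev.hom_add ev.hom_mult ev_lin ev_\<gamma> ev_scale iota[OF onX] del: One_nat_def)
  have bir2: "U 1 * (comp hh \<gamma> i * \<gamma> j) - U 1 * (comp hh \<gamma> j * \<gamma> i) = 0" if "i < 5" "j < 5" for i j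
  proof (rule zero_if_eval2_zero)
    fix t s :: 'k assume "t \<noteq> 0"
    have "eval2 t s (\<gamma> i) = ?arc t s i" for i using fun_cong[OF ev_\<gamma>] .
    then show "eval2 t s (U 1 * (comp hh \<gamma> i * \<gamma> j) - U 1 * (comp hh \<gamma> j * \<gamma> i)) = 0"
      using birational[OF onX[OF \<open>t \<noteq> 0\<close>] that, of s]
      by (simp add: U_def ev.hom_minus ev.hom_mult ev_lin ev_comp ev_\<gamma> del: One_nat_def)
  qed
  obtain t1 s1 where "\<And>m. m < 3 \<Longrightarrow> lin_at (?arc t1 s1) m \<noteq> 0" "comp_at (?arc t1 s1) 2 \<noteq> 0"
    using B(2)[OF \<alpha>(2) sl r0] unfolding Let_def gh by blast
  then have "eval2 t1 s1 (U m) \<noteq> 0" "eval2 t1 s1 (comp hh \<gamma> 2) \<noteq> 0" if "m < 3" for m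
    using that by (simp_all add: U_def ev_lin ev_comp ev_\<gamma>)
  then have U0: "U m \<noteq> 0" and C0: "comp hh \<gamma> 2 \<noteq> 0" if "m < 3" for m
    using that by (metis ev.hom_zero)+
  define \<Gamma> where "\<Gamma> t = arc fps_const r \<alpha> \<delta> \<xi> t fps_X (fps_of_poly gh)" for t
  have es_hh: "eval_series t (hh c) = fps_const c" for t c
    by (simp add: hh_def eval_series_const fps_of_poly_const)
  have es_\<gamma>: "(\<lambda>i. eval_series t (\<gamma> i)) = \<Gamma> t" for t
    unfolding \<gamma>_def \<Gamma>_def
    by (rule ext, subst arc_hom[OF comm_ring_hom_eval_series])
      (simp add: es_hh eval_series_const eval_series_var fps_of_poly_linear)
  have es_lin: "eval_series t (lin hh x m) = lin fps_const (\<lambda>i. eval_series t (x i)) m" for t x m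
    by (subst lin_hom[OF comm_ring_hom_eval_series]) (simp add: es_hh)
  have es_comp: "eval_series t (comp hh x m) = comp fps_const (\<lambda>i. eval_series t (x i)) m" for t x m
    by (subst comp_hom[OF comm_ring_hom_eval_series]) (simp add: es_hh)
  interpret es: comm_ring_hom "eval_series t" for t :: "'k fps" by (rule comm_ring_hom_eval_series)
  have es_swap: "(\<lambda>i. eval_series t (swap01 \<gamma> i)) = swap01 (\<Gamma> t)" for t
    unfolding es_\<gamma>[symmetric] by (rule ext, rule swap01_hom)
  have es_scale: "(\<lambda>i. eval_series t (scale01 (hh b) (hh c) \<gamma> i)) =
      scale01 (fps_const b) (fps_const c) (\<Gamma> t)" for t b c
    unfolding es_\<gamma>[symmetric] by (rule ext, subst scale01_hom[OF comm_ring_hom_eval_series]) (simp add: es_hh)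
  define u where "u t m = lin fps_const (\<Gamma> t) m" for t m
  have es_U: "eval_series t (U m) = u t m" for t m by (simp add: U_def es_lin es_\<gamma> u_def)
  have "\<forall>m. \<exists>n q. m < 3 \<longrightarrow> to_series (U m) = [:fps_X ^ n:] * q \<and> reduct q \<noteq> 0"
    using factor_X_power_single U0 by (metis to_series_eq_0_iff)
  \<comment> \<open>The order of the form \<open>m\<close> along the exceptional divisor is
    \<open>n m\<close>; the reduction of \<open>W m\<close> is its leading term as a function of the
    position on the exceptional line.\<close>
  then obtain n W where W: "\<And>m. m < 3 \<Longrightarrow> to_series (U m) = [:fps_X ^ n m:] * W m"
    "\<And>m. m < 3 \<Longrightarrow> reduct (W m) \<noteq> 0" by metis
  define A where "A m = reduct (W m)" for m
  have A0: "A m \<noteq> 0" if "m < 3" for m using W(2)[OF that] by (simp add: A_def)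
  have uW: "u t m = fps_X ^ n m * poly (W m) t" if "m < 3" for t m
    unfolding es_U[symmetric] eval_series_def W(1)[OF that] by simp
  have WA: "fps_nth (poly (W m) t) 0 = poly (A m) (fps_nth t 0)" for m t
    by (simp add: A_def poly_nth_0)
  obtain nc Wc where Wc: "to_series (comp hh \<gamma> 2) = [:fps_X ^ nc:] * Wc" "reduct Wc \<noteq> 0"
    using factor_X_power_single[of "to_series (comp hh \<gamma> 2)"] C0[of 0] by (auto simp: to_series_eq_0_iff)
  have g0: "fps_nth (fps_of_poly gh) 0 \<noteq> 0" using g gh[of 0] by (simp add: poly_0_coeff_0)
  define G where "G = fps_of_poly gh"
  define c0 where "c0 = fps_nth G 0"
  have c0: "c0 \<noteq> 0" using g0 by (simp add: c0_def G_def)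
  have fin_roots: "finite {t. poly p t = 0}" if "p \<noteq> 0" for p :: "'k poly"
    using that by (rule poly_roots_finite)
  \<comment> \<open>\<open>\<sigma>\<close> forces the orders of the first two forms to agree.\<close>
  have n01: "n 0 = n 1"
  proof -
    \<comment> \<open>The reflection moves the position \<open>t0\<close> to \<open>c0 / t0\<close>
      on the divisor; both positions have to avoid the zeros of \<open>A 0\<close> and
      \<open>A 1\<close>.\<close>
    have "finite ({0} \<union> {t. poly (A 0) t = 0} \<union> {t. poly (A 1) t = 0} \<union>
      (\<lambda>z. c0 / z) ` {t. poly (A 0) t = 0} \<union> (\<lambda>z. c0 / z) ` {t. poly (A 1) t = 0})" (is "finite ?Z")
      using fin_roots[OF A0[of 0]] fin_roots[OF A0[of 1]] by simp
    then obtain t0 where t0: "t0 \<notin> ?Z" using infinite_UNIV_char_0[where 'a = 'k] by (metis ex_new_if_finite)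
    have t00: "t0 \<noteq> 0" using t0 by simp
    define t where "t = fps_const t0"
    define t' where "t' = fps_const (inverse t0)"
    have tt': "t * t' = 1" using t00 by (simp add: t_def t'_def)
    have "eval_series t (lin hh (swap01 \<gamma>) 0 * U 0 - lin hh (swap01 \<gamma>) 1 * U 1) = 0"
      unfolding sig2 by (rule es.hom_zero)
    then have e: "lin fps_const (swap01 (\<Gamma> t)) 0 * u t 0 = lin fps_const (swap01 (\<Gamma> t)) 1 * u t 1"
      by (simp add: es.hom_minus es.hom_mult es_U es_lin es_swap del: One_nat_def)
    have sc: "G ^ D * lin fps_const (swap01 (\<Gamma> t)) m = (t ^ 2) ^ D * u (G * t') m" for m
    proof -
      have "(\<lambda>i. G * swap01 (\<Gamma> t) i) = (\<lambda>i. t ^ 2 * \<Gamma> (G * t') i)"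
        unfolding \<Gamma>_def G_def by (rule ext, rule arc_scale[OF tt'])
      then show ?thesis unfolding u_def lin_scale[symmetric] by simp
    qed
    have "(t ^ 2) ^ D * (u (G * t') 0 * u t 0) = (t ^ 2) ^ D * (u (G * t') 1 * u t 1)"
      unfolding mult.assoc[symmetric] sc[symmetric] using e by (simp add: mult.assoc)
    then have "u (G * t') 0 * u t 0 = u (G * t') 1 * u t 1" using t00 by (simp add: t_def)
    then have "fps_X ^ (n 0 + n 0) * (poly (W 0) (G * t') * poly (W 0) t) =
        fps_X ^ (n 1 + n 1) * (poly (W 1) (G * t') * poly (W 1) t)"
      by (simp add: uW power_add mult_ac)
    moreover have "fps_nth (poly (W m) (G * t') * poly (W m) t) 0 \<noteq> 0" if "m \<in> {0, 1}" for m
    proof -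
      have "poly (A m) t0 \<noteq> 0" using t0 that by auto
      moreover have "poly (A m) (c0 / t0) \<noteq> 0"
      proof
        assume "poly (A m) (c0 / t0) = 0"
        then have "t0 \<in> (\<lambda>z. c0 / z) ` {t. poly (A m) t = 0}"
          using c0 t00 by (intro image_eqI[of _ _ "c0 / t0"]) auto
        then show False using t0 that by auto
      qed
      ultimately show ?thesis
        by (simp add: WA t_def t'_def c0_def divide_inverse)
    qed
    from this[of 0] this[of 1]
    have "fps_nth (poly (W 0) (G * t') * poly (W 0) t) 0 \<noteq> 0"
      "fps_nth (poly (W 1) (G * t') * poly (W 1) t) 0 \<noteq> 0" by auto
    ultimately have "n 0 + n 0 = n 1 + n 1" by (rule X_power_mult_cancel(1))
    then show ?thesis by simp
  qed
  \<comment> \<open>\<open>\<tau>\<close> moves the value of their quotient on the exceptional divisor.\<close>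
  have tau_A: "poly (A 0) (a * t0) * poly (A 1) t0 = \<mu> * (poly (A 1) (a * t0) * poly (A 0) t0)" for t0
  proof -
    define t where "t = fps_const t0"
    have "eval_series t (lin hh (scale01 (hh a) (hh (inverse a)) \<gamma>) 0 * U 1 -
      hh \<mu> * (lin hh (scale01 (hh a) (hh (inverse a)) \<gamma>) 1 * U 0)) = 0"
      unfolding tau2 by (rule es.hom_zero)
    then have e: "lin fps_const (scale01 (fps_const a) (fps_const (inverse a)) (\<Gamma> t)) 0 * u t 1 =
      fps_const \<mu> * (lin fps_const (scale01 (fps_const a) (fps_const (inverse a)) (\<Gamma> t)) 1 * u t 0)"
      by (simp add: es.hom_minus es.hom_mult es_U es_lin es_scale es_hh del: One_nat_def)
    have sc: "fps_const a ^ D * lin fps_const (scale01 (fps_const a) (fps_const (inverse a)) (\<Gamma> t)) m =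
        u (fps_const a * t) m" for m
    proof -
      have "(\<lambda>i. fps_const a * scale01 (fps_const a) (fps_const (inverse a)) (\<Gamma> t) i) = \<Gamma> (fps_const a * t)"
        unfolding \<Gamma>_def by (rule ext, rule arc_scale_tau) (simp add: a0)
      then show ?thesis unfolding u_def lin_scale[symmetric] by simp
    qed
    have "u (fps_const a * t) 0 * u t 1 = fps_const \<mu> * (u (fps_const a * t) 1 * u t 0)"
      unfolding sc[symmetric] mult.assoc e by (simp add: mult_ac)
    then have "fps_X ^ (n 0 + n 1) * (poly (W 0) (fps_const a * t) * poly (W 1) t) =
        fps_X ^ (n 0 + n 1) * (fps_const \<mu> * (poly (W 1) (fps_const a * t) * poly (W 0) t))"
      by (simp add: uW power_add mult_ac)
    then have "poly (W 0) (fps_const a * t) * poly (W 1) t =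
        fps_const \<mu> * (poly (W 1) (fps_const a * t) * poly (W 0) t)" by simp
    then have "fps_nth (poly (W 0) (fps_const a * t) * poly (W 1) t) 0 =
        fps_nth (fps_const \<mu> * (poly (W 1) (fps_const a * t) * poly (W 0) t)) 0" by simp
    then show ?thesis by (simp add: WA t_def)
  qed
  \<comment> \<open>A constant quotient \<open>c\<close> would be nonzero and satisfy
    \<open>c = \<mu> * c\<close>.\<close>
  have nonconst: "A 0 \<noteq> Polynomial.smult c (A 1)" for c
  proof
    assume c: "A 0 = Polynomial.smult c (A 1)"
    have "c * (1 - \<mu>) * (poly (A 1) (a * t0) * poly (A 1) t0) = 0" for t0
      using tau_A[of t0] unfolding c by (simp add: algebra_simps)
    moreover have "c \<noteq> 0" using A0[of 0] c by auto
    ultimately have z: "poly (A 1) (a * t0) * poly (A 1) t0 = 0" for t0 using mu by auto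
    have "finite ({t. poly (A 1) t = 0} \<union> (\<lambda>z. z / a) ` {t. poly (A 1) t = 0})"
      using fin_roots[OF A0[of 1]] by simp
    then obtain t0 where t0: "t0 \<notin> {t. poly (A 1) t = 0} \<union> (\<lambda>z. z / a) ` {t. poly (A 1) t = 0}"
      using infinite_UNIV_char_0[where 'a = 'k] by (metis ex_new_if_finite)
    have "poly (A 1) (a * t0) = 0" using z[of t0] t0 by simp
    then have "t0 \<in> (\<lambda>z. z / a) ` {t. poly (A 1) t = 0}"
      using a0 by (intro image_eqI[of _ _ "a * t0"]) auto
    then show False using t0 by simp
  qed
  \<comment> \<open>The central involution changes the sign of the uniformizer.\<close>
  have n12: "n 1 \<noteq> n 2"
  proof
    assume n12: "n 1 = n 2"
    have "finite ({t. poly (A 1) t = 0} \<union> {t. poly (A 2) t = 0})"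
      using fin_roots[OF A0[of 1]] fin_roots[OF A0[of 2]] by simp
    then obtain t0 where t0: "poly (A 1) t0 \<noteq> 0" "poly (A 2) t0 \<noteq> 0"
      using infinite_UNIV_char_0[where 'a = 'k] by (metis (mono_tags, lifting) UnI1 UnI2 ex_new_if_finite mem_Collect_eq)
    define t where "t = fps_const t0"
    have "eval_series t (lin hh (scale01 (hh (- 1)) (hh (- 1)) \<gamma>) 2 * U 1 +
      lin hh (scale01 (hh (- 1)) (hh (- 1)) \<gamma>) 1 * U 2) = 0"
      unfolding iota2 by (rule es.hom_zero)
    then have e: "lin fps_const (scale01 (fps_const (- 1)) (fps_const (- 1)) (\<Gamma> t)) 2 * u t 1 +
       lin fps_const (scale01 (fps_const (- 1)) (fps_const (- 1)) (\<Gamma> t)) 1 * u t 2 = 0"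
      by (simp add: es.hom_add es.hom_mult es_U es_lin es_scale del: One_nat_def fps_const_neg)
    let ?X = "- fps_X :: 'k fps"
    have homX: "comm_ring_hom (\<lambda>g. g oo ?X)" by (rule comm_ring_hom_fps_compose) simp
    interpret X: comm_ring_hom "\<lambda>g. g oo ?X" by (rule homX)
    have XX: "fps_X oo ?X = ?X" by (rule fps_X_fps_compose_startby0) simp
    \<comment> \<open>The factor \<open>gh\<close> contains \<open>s\<close> only through its square
      and is even.\<close>
    have GX: "G oo ?X = G"
    proof (rule fps_ext)
      fix i
      have "coeff gh i = 0" if "odd i"
      proof -
        have "pcompose gh [:0, -1:] = gh"
          by (rule poly_eqI_infinite) (simp add: poly_pcompose gh)
        moreover have "coeff (pcompose gh [:0, -1:]) i = (- 1) ^ i * coeff gh i"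
          by (simp add: coeff_pcompose_linear)
        ultimately show ?thesis using that by simp
      qed
      then show "fps_nth (G oo ?X) i = fps_nth G i"
        by (cases "odd i") (auto simp: G_def fps_compose_uminus')
    qed
    have \<Gamma>X: "(\<lambda>i. \<Gamma> t i oo ?X) = scale01 (fps_const (- 1)) (fps_const (- 1)) (\<Gamma> t)"
    proof
      fix i
      have "\<Gamma> t i oo ?X = arc fps_const r \<alpha> \<delta> \<xi> t ?X G i"
        unfolding \<Gamma>_def G_def[symmetric]
        by (subst arc_hom[OF homX]) (simp add: XX GX t_def)
      also have "\<dots> = scale01 (fps_const (- 1)) (fps_const (- 1)) (\<Gamma> t) i"
        using r by (simp add: arc_def scale01_def \<Gamma>_def G_def flip: fps_const_neg)
      finally show "\<Gamma> t i oo ?X = scale01 (fps_const (- 1)) (fps_const (- 1)) (\<Gamma> t) i" .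
    qed
    have "lin fps_const (scale01 (fps_const (- 1)) (fps_const (- 1)) (\<Gamma> t)) m = u t m oo ?X" for m
      unfolding u_def lin_hom[OF homX] \<Gamma>X by simp
    then have "(u t 2 oo ?X) * u t 1 + (u t 1 oo ?X) * u t 2 = 0" using e by simp
    have uX: "u t m oo ?X = (- 1) ^ n m * (fps_X ^ n m * (poly (W m) t oo ?X))" if "m < 3" for m
      unfolding uW[OF that] X.hom_mult X.hom_power XX by (subst power_minus) (simp add: mult.assoc)
    \<comment> \<open>With equal orders both forms acquire the same sign under
      \<open>s \<mapsto> - s\<close>, so the leading terms add up to twice \<open>A 1 * A 2\<close>
      instead of cancelling.\<close>
    have "(- 1) ^ n 2 * (fps_X ^ n 2 * (poly (W 2) t oo ?X)) * (fps_X ^ n 2 * poly (W 1) t) +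
        (- 1) ^ n 2 * (fps_X ^ n 2 * (poly (W 1) t oo ?X)) * (fps_X ^ n 2 * poly (W 2) t) = 0"
      using \<open>(u t 2 oo ?X) * u t 1 + (u t 1 oo ?X) * u t 2 = 0\<close> uX[of 1] uX[of 2] uW[of 1 t] uW[of 2 t] n12
      by (simp only: numeral_less_iff one_less_numeral_iff semiring_norm simp_thms)
    then have "((- 1) ^ n 2 * fps_X ^ n 2 * fps_X ^ n 2) *
        ((poly (W 2) t oo ?X) * poly (W 1) t + (poly (W 1) t oo ?X) * poly (W 2) t) = 0"
      by (simp only: distrib_left mult_ac)
    then have "(poly (W 2) t oo ?X) * poly (W 1) t + (poly (W 1) t oo ?X) * poly (W 2) t = 0" by simp
    then have "fps_nth ((poly (W 2) t oo ?X) * poly (W 1) t + (poly (W 1) t oo ?X) * poly (W 2) t) 0 = 0"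
      by simp
    then have "2 * (poly (A 1) t0 * poly (A 2) t0) = 0" by (simp add: WA t_def)
    then show False using t0 by simp
  qed
  \<comment> \<open>The numerator of the derivative of \<open>A 0 / A 1\<close>. Away from its zeros
    the equation for a prescribed value has simple roots, as Hensel's lemma demands.\<close>
  define Wr where "Wr = pderiv (A 0) * A 1 - A 0 * pderiv (A 1)"
  have "Wr \<noteq> 0"
  proof
    assume "Wr = 0"
    then have "pderiv (A 1) * A 0 = A 1 * pderiv (A 0)" by (simp add: Wr_def mult.commute)
    then show False using wronskian_zero[of "A 1" "A 0"] A0[of 1] nonconst by auto
  qed
  \<comment> \<open>Excluding these positions keeps the orders of the forms 1 and 2 on the arc equal
    to \<open>n 1\<close> and \<open>n 2\<close>, the composite map defined on it, its limit in the
    chart \<open>x 2 \<noteq> 0\<close>, and the root \<open>t0\<close> simple.\<close>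
  define Z where "Z = {0} \<union> {t. poly (A 1) t = 0} \<union> {t. poly (A 2) t = 0} \<union>
    {t. poly (reduct Wc) t = 0} \<union> {t. poly Wr t = 0}"
  have "finite Z"
    unfolding Z_def using fin_roots[OF A0[of 1]] fin_roots[OF A0[of 2]] fin_roots[OF Wc(2)] fin_roots[OF \<open>Wr \<noteq> 0\<close>]
    by simp
  then obtain N t0 where t0: "t0 \<notin> Z" and N: "poly (A 0) t0 = of_nat N * poly (A 1) t0"
    using natural_value[of "A 0" "A 1" Z] nonconst A0[of 1] by auto
  \<comment> \<open>A root of \<open>p\<close> is a position varying with \<open>s\<close> for which
    the first form is \<open>N\<close> times the second to all orders. The factors
    \<open>fps_X ^ n 0\<close> and \<open>fps_X ^ n 1\<close> agree and drop out.\<close>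
  define p where "p = W 0 - [:fps_const (of_nat N):] * W 1"
  have red_p: "reduct p = A 0 - Polynomial.smult (of_nat N) (A 1)"
    by (rule poly_eqI) (simp add: p_def A_def coeff_reduct fps_of_nat)
  have "poly (pderiv (reduct p)) t0 * poly (A 1) t0 = poly Wr t0"
    using N by (simp add: red_p Wr_def pderiv_diff pderiv_smult algebra_simps)
  then have "poly (pderiv (reduct p)) t0 \<noteq> 0" using t0 by (auto simp: Z_def)
  moreover have "poly (reduct p) t0 = 0" using N by (simp add: red_p)
  ultimately obtain t where t: "poly p t = 0" "fps_nth t 0 = t0" using hensel by blast
  have u01: "u t 0 = fps_const (of_nat N) * u t 1"
    using t(1) by (simp add: uW p_def n01 mult_ac)
  have u1: "u t 1 \<noteq> 0"
  proof
    assume "u t 1 = 0"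
    then have "poly (W 1) t = 0" by (simp add: uW)
    then have "poly (A 1) t0 = 0" using WA[of 1 t] t(2) by simp
    then show False using t0 by (simp add: Z_def)
  qed
  define x where "x = \<Gamma> t"
  define y where "y j = eval_mpoly fps_const x (\<phi> j)" for j
  have comp_y: "comp fps_const x i = eval_mpoly fps_const y (\<psi> i)" for i
    unfolding comp_def y_def ..
  have es_cx: "eval_series t (comp hh \<gamma> i) = comp fps_const x i" for i
    by (simp add: es_comp es_\<gamma> x_def)
  have es_x: "eval_series t (\<gamma> i) = x i" for i using fun_cong[OF es_\<gamma>] by (simp add: x_def)
  have rel: "eval_mpoly fps_const y (\<psi> i) * x j = eval_mpoly fps_const y (\<psi> j) * x i"
    if "i < 5" "j < 5" for i j
  proof -
    have "eval_series t (U 1 * (comp hh \<gamma> i * \<gamma> j) - U 1 * (comp hh \<gamma> j * \<gamma> i)) = 0"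
      unfolding bir2[OF that] by (rule es.hom_zero)
    then have "u t 1 * (comp fps_const x i * x j) = u t 1 * (comp fps_const x j * x i)"
      by (simp add: es.hom_minus es.hom_mult es_U es_cx es_x del: One_nat_def)
    then show ?thesis using u1 by (simp add: comp_y)
  qed
  have nz: "eval_mpoly fps_const y (\<psi> 2) \<noteq> 0"
  proof
    assume "eval_mpoly fps_const y (\<psi> 2) = 0"
    then have "eval_series t (comp hh \<gamma> 2) = 0" by (simp add: es_cx comp_y)
    then have "poly Wc t = 0" by (simp add: eval_series_def Wc(1))
    then have "poly (reduct Wc) t0 = 0" using poly_nth_0[of Wc t] t(2) by simp
    then show False using t0 by (simp add: Z_def)
  qed
  have x_0: "fps_nth (x 2) 0 = t0" "fps_nth (x 3) 0 = (\<alpha> + \<delta> * \<xi>) * t0" "fps_nth (x 4) 0 = \<xi> * t0"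
    by (simp_all add: x_def \<Gamma>_def arc_def t(2))
  have t00: "t0 \<noteq> 0" using t0 by (simp add: Z_def)
  have psi_K: "Poly_Mapping.lookup (\<psi> i) m \<in> K" if "i < 5" for i m
  proof (rule lookup_K)
    have "Poly_Mapping.lookup (\<psi> i) ` Poly_Mapping.keys (\<psi> i) \<subseteq> coeff_set"
      using that unfolding coeff_set_def by blast
    then show "Poly_Mapping.lookup (\<psi> i) ` Poly_Mapping.keys (\<psi> i) \<subseteq> K" using K(2) by blast
  qed
  have V_K: "V m j \<in> K" if "m < 4" "j < d" for m j
    using K(2) that unfolding coeff_set_def by blast
  have limit: "fps_nth (x i) 0 / fps_nth (x 2) 0 \<in> K" if i: "i \<in> {3, 4}" for i
  proof (rule K.arc_limit_over[where \<psi> = \<psi> and y = y and e = D' and d = d and V = V and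
        l = "u t" and ?c0.0 = "of_nat N" and ?i1.0 = "n 1" and ?i2.0 = "n 2" and
        u = "poly (W 1) t" and v = "poly (W 2) t"])
    show "value_at (\<lambda>i. fps_nth (x i) 0) f = 0"
    proof -
      have "value_at (\<lambda>i. fps_nth (x i) 0) f = value_at
        (\<lambda>i. if i = 2 then t0 else if i = 3 then (\<alpha> + \<delta> * \<xi>) * t0 else \<xi> * t0) f"
        by (rule eval_mpoly_cong) (use vars x_0 in auto)
      then show ?thesis unfolding eval_f_slice sl using r0 by simp
    qed
    show "y j = (\<Sum>m<4. u t m * fps_const (V m j))" if "j < d" for j
      unfolding y_def u_def x_def by (rule recover[OF comm_ring_hom_fps_const that])
    show "fps_nth (poly (W 1) t) 0 \<noteq> 0" "fps_nth (poly (W 2) t) 0 \<noteq> 0"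
      using t0 by (auto simp: WA t(2) Z_def)
    show "vars (\<psi> j) \<subseteq> {..<d}" if "j \<in> {2, 3, 4}" for j
      using that psi(2)[of 2] psi(2)[of 3] psi(2)[of 4] by (elim insertE) simp_all
  qed (use i psi(1) psi_K V_K u01 K.of_nat uW n12 rel nz x_0 t00 in auto)
  \<comment> \<open>Both affine coordinates of the limit lie in \<open>K\<close>, and together with
    \<delta> they determine \<alpha>.\<close>
  have "\<xi> \<in> K" using limit[of 4] t00 by (simp add: x_0)
  moreover have "\<alpha> + \<delta> * \<xi> \<in> K" using limit[of 3] t00 by (simp add: x_0)
  ultimately have "(\<alpha> + \<delta> * \<xi>) - \<delta> * \<xi> \<in> K" using \<delta>_K by (intro K.diff K.mult)
  then show False using \<alpha>(1) by simp
qed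

end

section \<open>Dihedral representations\<close>

text \<open>Matrices are functions on all pairs of indices, so their identities are plain equations
  of functions and need no conditions on formats.\<close>

definition mm :: "nat \<Rightarrow> (nat \<Rightarrow> nat \<Rightarrow> 'a::comm_ring_1) \<Rightarrow> (nat \<Rightarrow> nat \<Rightarrow> 'a) \<Rightarrow> nat \<Rightarrow> nat \<Rightarrow> 'a" where
  "mm d A B = (\<lambda>r s. \<Sum>k<d. A r k * B k s)"

definition scale_mat :: "'a::comm_ring_1 \<Rightarrow> (nat \<Rightarrow> nat \<Rightarrow> 'a) \<Rightarrow> nat \<Rightarrow> nat \<Rightarrow> 'a" where
  "scale_mat c A = (\<lambda>r s. c * A r s)"

definition id_mat :: "nat \<Rightarrow> nat \<Rightarrow> nat \<Rightarrow> 'a::comm_ring_1" where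
  "id_mat d = (\<lambda>r s. if r = s \<and> r < d then 1 else 0)"

lemma mm_assoc: "mm d (mm d A B) C = mm d A (mm d B C)"
  unfolding mm_def sum_distrib_left sum_distrib_right
  by (intro ext, subst sum.swap) (simp add: mult.assoc)

lemma mm_scale_left: "mm d (scale_mat c A) B = scale_mat c (mm d A B)"
  and mm_scale_right: "mm d A (scale_mat c B) = scale_mat c (mm d A B)"
  by (simp_all add: mm_def scale_mat_def sum_distrib_left mult_ac)

lemma mm_sum_left: "mm d (\<lambda>r s. \<Sum>j\<in>J. A j r s) B = (\<lambda>r s. \<Sum>j\<in>J. mm d (A j) B r s)"
  unfolding mm_def sum_distrib_right by (intro ext, subst sum.swap) simp

lemma mm_sum_right: "mm d B (\<lambda>r s. \<Sum>j\<in>J. A j r s) = (\<lambda>r s. \<Sum>j\<in>J. mm d B (A j) r s)"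
  unfolding mm_def sum_distrib_left by (intro ext, subst sum.swap) simp

lemma scale_scale_mat: "scale_mat b (scale_mat c A) = scale_mat (b * c) A"
  by (simp add: scale_mat_def mult.assoc)

lemma sum_periodic_shift:
  fixes g :: "nat \<Rightarrow> 'a::comm_ring_1"
  assumes "\<And>j. g (j + N) = g j"
  shows "(\<Sum>j<N. g (j + i)) = (\<Sum>j<N. g j)"
proof (induction i)
  case (Suc i)
  have "(\<Sum>j<N. g (j + Suc i)) = (\<Sum>j<N. g (Suc j + i))" by simp
  also have "\<dots> = (\<Sum>j<Suc N. g (j + i)) - g (0 + i)" by (subst sum.lessThan_Suc_shift) simp
  also have "\<dots> = (\<Sum>j<N. g (j + i))" using assms[of i] by (simp add: add.commute)
  finally show ?case using Suc by simp
qed simp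

lemma sum_powers_root_of_unity:
  fixes b :: "'a::field"
  assumes "b ^ N = 1" "b \<noteq> 1"
  shows "(\<Sum>i<N. b ^ i) = 0"
proof -
  have "(b - 1) * (\<Sum>i<N. b ^ i) = b ^ N - 1" by (rule power_diff_1_eq[symmetric])
  then show ?thesis using assms by simp
qed

text \<open>Here \<open>M i\<close> is the \<open>i\<close>-th power of the rotation, and
  \<open>(2 * n - 1) * j\<close> plays the role of \<open>- j\<close> modulo \<open>2 * n\<close>.
  Of faithfulness only two traces are kept: the rotation has an eigenvalue other than 1 and -1, and
  the central involution is not scalar.\<close>

locale dihedral_rep =
  fixes d n :: nat and a :: "'k::field_char_0" and M :: "nat \<Rightarrow> nat \<Rightarrow> nat \<Rightarrow> 'k" and S :: "nat \<Rightarrow> nat \<Rightarrow> 'k"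
  assumes n: "n > 0" and prim: "primitive_root_of_unity (2 * n) a"
    and M_mult: "mm d (M i) (M j) = M (i + j)" and M_0: "M 0 = id_mat d"
    and M_period: "M (i + 2 * n) = M i"
    and E_left: "mm d (id_mat d) (M i) = M i" "mm d (id_mat d) S = S"
    and S_S: "mm d S S = id_mat d" and S_M: "mm d S (M j) = mm d (M ((2 * n - 1) * j)) S"
    and M_2: "M 2 \<noteq> id_mat d" and M_n: "M n \<noteq> scale_mat c (id_mat d)"
begin

abbreviation times_mat (infixl "**" 70) where "times_mat \<equiv> mm d"

lemma a_root: "a ^ (2 * n) = 1" and a0: "a \<noteq> 0"
  using prim n by (auto simp: primitive_root_of_unity_def power_0_left)

lemma M_periods: "M (k * (2 * n) + j) = M j"
proof (induction k)
  case (Suc k)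
  have "Suc k * (2 * n) + j = (k * (2 * n) + j) + 2 * n" by simp
  then show ?case by (simp only: M_period Suc)
qed simp

text \<open>For a root of unity \<open>z\<close> this is \<open>2 * n\<close> times the projection
  to the eigenspace of the rotation for \<open>z\<close>; the missing normalization explains the
  scalar in \<open>projector_square\<close>.\<close>

definition projector :: "'k \<Rightarrow> nat \<Rightarrow> nat \<Rightarrow> 'k" where
  "projector z = (\<lambda>r s. \<Sum>j<2 * n. scale_mat (inverse z ^ j) (M j) r s)"

lemma projector_eigen:
  assumes z: "z ^ (2 * n) = 1"
  shows "M i ** projector z = scale_mat (z ^ i) (projector z)"
    and "projector z ** M i = scale_mat (z ^ i) (projector z)"
proof -
  have z0: "z \<noteq> 0" using z n by (auto simp: power_0_left)
  have per: "scale_mat (inverse z ^ (j + 2 * n)) (M (j + 2 * n)) r s = scale_mat (inverse z ^ j) (M j) r s" for j r s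
    using z by (simp add: scale_mat_def M_period power_add power_inverse)
  have *: "(\<lambda>r s. \<Sum>j<2 * n. scale_mat (inverse z ^ j) (M (j + i)) r s) = scale_mat (z ^ i) (projector z)"
  proof (intro ext)
    fix r s
    have "(\<Sum>j<2 * n. scale_mat (inverse z ^ j) (M (j + i)) r s) =
      (\<Sum>j<2 * n. z ^ i * scale_mat (inverse z ^ (j + i)) (M (j + i)) r s)"
      using z0 by (intro sum.cong) (auto simp: scale_mat_def power_add power_inverse field_simps)
    also have "\<dots> = z ^ i * (\<Sum>j<2 * n. scale_mat (inverse z ^ j) (M j) r s)"
      unfolding sum_distrib_left[symmetric]
      using sum_periodic_shift[where g = "\<lambda>j. scale_mat (inverse z ^ j) (M j) r s" and N = "2 * n" and i = i, OF per]
      by (simp only:)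
    finally show "(\<Sum>j<2 * n. scale_mat (inverse z ^ j) (M (j + i)) r s) = scale_mat (z ^ i) (projector z) r s"
      by (simp add: projector_def scale_mat_def)
  qed
  show "M i ** projector z = scale_mat (z ^ i) (projector z)"
    unfolding *[symmetric] unfolding projector_def mm_sum_right mm_scale_right M_mult by (simp add: add.commute)
  show "projector z ** M i = scale_mat (z ^ i) (projector z)"
    unfolding *[symmetric] unfolding projector_def mm_sum_left mm_scale_left M_mult by simp
qed

lemma projector_square:
  assumes z: "z ^ (2 * n) = 1"
  shows "projector z ** projector z = scale_mat (of_nat (2 * n)) (projector z)"
proof -
  have z0: "z \<noteq> 0" using z n by (auto simp: power_0_left)
  have "projector z ** projector z = (\<lambda>r s. \<Sum>j<2 * n. (scale_mat (inverse z ^ j) (M j) ** projector z) r s)"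
    by (subst (1) projector_def) (rule mm_sum_left)
  also have "\<dots> = (\<lambda>r s. \<Sum>j<2 * n. projector z r s)"
    unfolding mm_scale_left projector_eigen(1)[OF z] scale_scale_mat
    using z0 by (simp add: scale_mat_def power_inverse)
  finally show ?thesis by (simp add: scale_mat_def fun_eq_iff)
qed

lemma sum_projectors: "(\<Sum>i<2 * n. projector (a ^ i) r s) = of_nat (2 * n) * id_mat d r s"
proof -
  have "(\<Sum>i<2 * n. projector (a ^ i) r s) = (\<Sum>j<2 * n. (\<Sum>i<2 * n. inverse (a ^ i) ^ j) * M j r s)"
    unfolding projector_def scale_mat_def sum_distrib_right by (rule sum.swap)
  also have "\<dots> = (\<Sum>j<2 * n. (if j = 0 then of_nat (2 * n) else 0) * M j r s)"
  proof (rule sum.cong[OF refl])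
    fix j assume j: "j \<in> {..<2 * n}"
    have "(\<Sum>i<2 * n. inverse (a ^ i) ^ j) = (\<Sum>i<2 * n. (inverse a ^ j) ^ i)"
      by (intro sum.cong refl) (simp add: power_inverse flip: power_mult, simp add: mult.commute)
    also have "\<dots> = (if j = 0 then of_nat (2 * n) else 0)"
    proof (cases "j = 0")
      case False
      then have "a ^ j \<noteq> 1" using prim j by (auto simp: primitive_root_of_unity_def)
      then have "inverse a ^ j \<noteq> 1" by (metis inverse_eq_1_iff power_inverse)
      moreover have "(inverse a ^ j) ^ (2 * n) = 1"
        using a_root by (metis mult.commute power_inverse power_mult power_one inverse_1)
      ultimately show ?thesis using False sum_powers_root_of_unity by simp
    qed simp
    finally show "(\<Sum>i<2 * n. inverse (a ^ i) ^ j) * M j r s =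
      (if j = 0 then of_nat (2 * n) else 0) * M j r s" by simp
  qed
  also have "\<dots> = (\<Sum>j<2 * n. if j = 0 then of_nat (2 * n) * M j r s else 0)"
    by (intro sum.cong) auto
  also have "\<dots> = of_nat (2 * n) * id_mat d r s" using n by (simp add: sum.delta M_0)
  finally show ?thesis .
qed

text \<open>The projectors add up to a multiple of the identity. If only those for 1 and -1 were
  nonzero, \<open>M 2\<close> would fix all of them and be the identity.\<close>

lemma nonzero_projector: "\<exists>z. z ^ (2 * n) = 1 \<and> z ^ 2 \<noteq> 1 \<and> (\<exists>r s. projector z r s \<noteq> 0)"
proof (rule ccontr)
  assume contra: "\<not> ?thesis"
  have root: "(a ^ i) ^ (2 * n) = 1" for i
    using a_root by (metis mult.commute power_mult power_one)
  have fixed: "M 2 ** projector (a ^ i) = projector (a ^ i)" for i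
  proof (cases "(a ^ i) ^ 2 = 1")
    case True
    then show ?thesis unfolding projector_eigen(1)[OF root] by (simp add: scale_mat_def)
  next
    case False
    then have "projector (a ^ i) = (\<lambda>r s. 0)" using contra root[of i] by blast
    then show ?thesis by (simp add: mm_def)
  qed
  have id: "id_mat d = scale_mat (inverse (of_nat (2 * n))) (\<lambda>r s. \<Sum>i<2 * n. projector (a ^ i) r s)"
  proof -
    have nz: "(of_nat (2 * n) :: 'k) \<noteq> 0" using n by simp
    show ?thesis
      unfolding sum_projectors scale_mat_def
      by (simp only: mult.assoc[symmetric] left_inverse[OF nz] mult_1_left)
  qed
  have "M 2 ** id_mat d = id_mat d"
    unfolding id mm_scale_right mm_sum_right fixed ..
  moreover have "M 2 ** id_mat d = M 2" unfolding M_0[symmetric] M_mult by simp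
  ultimately show False using M_2 by simp
qed

text \<open>The forms are rows of the projector \<open>P\<close> for \<open>z\<close>, of
  \<open>P ** S\<close> and of \<open>Q = M n - e\<close>; the dual vectors are scaled columns of
  \<open>P\<close>, \<open>S ** P\<close> and \<open>Q\<close>. All mixed products vanish, since
  \<open>z \<noteq> inverse z\<close> and \<open>Q\<close> kills the eigenspace on which the
  involution is \<open>e\<close>. Nonzero entries of \<open>P\<close> and \<open>Q\<close> select
  the rows and columns.\<close>

theorem eigenforms:
  "\<exists>z e l v. z ^ 2 \<noteq> 1 \<and> z \<noteq> 0 \<and> e ^ 2 = 1 \<and>
    (\<forall>s. (\<Sum>k<d. l 0 k * M 1 k s) = z * l 0 s) \<and>
    (\<forall>s. (\<Sum>k<d. l 1 k * M 1 k s) = inverse z * l (1::nat) s) \<and>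
    (\<forall>s. (\<Sum>k<d. l 0 k * S k s) = l 1 s) \<and> (\<forall>s. (\<Sum>k<d. l 1 k * S k s) = l 0 s) \<and>
    (\<forall>s. (\<Sum>k<d. l 1 k * M n k s) = e * l 1 s) \<and>
    (\<forall>s. (\<Sum>k<d. l 2 k * M n k s) = - e * l 2 s) \<and>
    (\<forall>m<3. \<forall>m'<3. (\<Sum>k<d. l m k * v m' k) = (if m = m' then 1 else 0))"
proof -
  obtain z q i where z: "z ^ (2 * n) = 1" "z ^ 2 \<noteq> 1" and qi: "projector z q i \<noteq> 0"
    using nonzero_projector by blast
  have z0: "z \<noteq> 0" using z n by (auto simp: power_0_left)
  define e where "e = z ^ n"
  have e2: "e * e = 1" using z(1) by (simp add: e_def mult_2 power_add)
  define P where "P = projector z"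
  have MP: "M i ** P = scale_mat (z ^ i) P" and PM: "P ** M i = scale_mat (z ^ i) P" for i
    unfolding P_def by (rule projector_eigen[OF z(1)])+
  have PP: "P ** P = scale_mat (of_nat (2 * n)) P" unfolding P_def by (rule projector_square[OF z(1)])
  have zz: "z ^ (2 * n - 1) = inverse z"
    using z(1) n z0 by (metis One_nat_def Suc_pred inverse_unique nat_0_less_mult_iff power_Suc zero_less_numeral)
  define Q where "Q = (\<lambda>r s. M n r s - e * id_mat d r s)"
  have PE: "P ** id_mat d = P" unfolding M_0[symmetric] PM by (simp add: scale_mat_def)
  have EP: "id_mat d ** P = P" unfolding M_0[symmetric] MP by (simp add: scale_mat_def)
  have diffL: "(\<lambda>r s. A r s - c * B r s) ** C = (\<lambda>r s. (A ** C) r s - c * (B ** C) r s)" for A B C c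
    by (simp add: mm_def left_diff_distrib sum_subtractf sum_distrib_left mult.assoc)
  have diffR: "C ** (\<lambda>r s. A r s - c * B r s) = (\<lambda>r s. (C ** A) r s - c * (C ** B) r s)" for A B C c
    by (simp add: mm_def right_diff_distrib sum_subtractf sum_distrib_left mult_ac)
  have ME: "M i ** id_mat d = M i" for i unfolding M_0[symmetric] M_mult by simp
  have SE: "S ** id_mat d = S" using S_M[of 0] E_left(2) by (simp add: M_0)
  have PQ: "P ** Q = (\<lambda>r s. 0)"
    unfolding Q_def diffR PM PE by (simp add: scale_mat_def e_def)
  have QP: "Q ** P = (\<lambda>r s. 0)"
    unfolding Q_def diffL MP EP by (simp add: scale_mat_def e_def)
  have M2n: "M (n + n) = id_mat d" using M_period[of 0] M_0 by (simp add: mult_2)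
  have QM: "Q ** M n = scale_mat (- e) Q"
    unfolding Q_def diffL M_mult M2n E_left(1) using e2
    by (simp add: scale_mat_def fun_eq_iff algebra_simps mult.assoc[symmetric])
  have QQ: "Q ** Q = scale_mat (- 2 * e) Q"
  proof -
    have "Q ** Q = (\<lambda>r s. (Q ** M n) r s - e * (Q ** id_mat d) r s)" by (subst (2) Q_def) (rule diffR)
    moreover have "Q ** id_mat d = Q" unfolding Q_def diffL ME using ME[of 0] by (simp add: M_0)
    ultimately show ?thesis unfolding QM by (simp add: scale_mat_def fun_eq_iff algebra_simps)
  qed
  have SMn: "S ** M n = M n ** S"
  proof -
    \<comment> \<open>Modulo \<open>2 * n\<close>, the number \<open>n\<close> is its own negative,
      so the involution is central.\<close>
    have "(2 * n - 1) * n = (n - 1) * (2 * n) + n" using n by (cases n) (simp_all add: algebra_simps)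
    then show ?thesis unfolding S_M[of n] by (simp only: M_periods)
  qed
  have SQ: "S ** Q = Q ** S"
    unfolding Q_def diffL diffR SMn SE E_left(2) ..
  have MS: "M 1 ** S = S ** M (2 * n - 1)"
  proof -
    have "S ** (S ** M (2 * n - 1)) = M (2 * n - 1)"
      unfolding mm_assoc[symmetric] S_S by (rule E_left(1))
    moreover have "S ** M (2 * n - 1) = M ((2 * n - 1) * (2 * n - 1)) ** S" by (rule S_M)
    moreover have "(2 * n - 1) * (2 * n - 1) = (2 * n - 2) * (2 * n) + 1" using n by (cases n) (simp_all add: algebra_simps)
    ultimately have "M (2 * n - 1) = S ** (M 1 ** S)" by (simp only: M_periods)
    then have "S ** M (2 * n - 1) = S ** S ** (M 1 ** S)" by (simp only: mm_assoc)
    also have "\<dots> = M 1 ** S" unfolding S_S mm_assoc[symmetric] E_left(1) ..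
    finally show ?thesis ..
  qed
  have PSP: "P ** S ** P = (\<lambda>r s. 0)"
  proof -
    \<comment> \<open>Moving \<open>M 1\<close> through this product to the left gives the
      eigenvalue \<open>z\<close>, to the right, across \<open>S\<close>, its inverse.\<close>
    have "P ** (M 1 ** (S ** P)) = P ** (S ** (M (2 * n - 1) ** P))"
      unfolding mm_assoc[of d "M 1", symmetric] MS by (simp only: mm_assoc)
    then have eq: "scale_mat z (P ** S ** P) = scale_mat (inverse z) (P ** S ** P)"
      unfolding mm_assoc[of d P "M 1", symmetric] PM MP zz mm_scale_left mm_scale_right mm_assoc by simp
    have "z * (P ** S ** P) r s = inverse z * (P ** S ** P) r s" for r s
      using fun_cong[OF fun_cong[OF eq, of r], of s] by (simp only: scale_mat_def)
    moreover have "z \<noteq> inverse z"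
    proof
      assume "z = inverse z"
      then have "z * z = 1" using z0 by (metis right_inverse)
      then show False using z(2) by (simp add: power2_eq_square)
    qed
    ultimately show ?thesis by (intro ext) (metis mult_cancel_right)
  qed
  have PSM: "P ** S ** M j = scale_mat (z ^ ((2 * n - 1) * j)) (P ** S)" for j
    unfolding mm_assoc S_M by (simp only: mm_assoc[symmetric] PM mm_scale_left)
  obtain q' i' where qi': "Q q' i' \<noteq> 0"
  proof -
    have "\<exists>r s. M n r s \<noteq> scale_mat e (id_mat d) r s" using M_n[of e] by (metis ext)
    then show ?thesis using that by (auto simp: Q_def scale_mat_def)
  qed
  \<comment> \<open>The scalars \<open>p\<close> and \<open>p'\<close> are the entries of
    \<open>P ** P\<close> and \<open>Q ** Q\<close> at the chosen positions, by \<open>PP\<close>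
    and \<open>QQ\<close>; dividing by them gives dual pairs.\<close>
  define p where "p = of_nat (2 * n) * P q i"
  have p0: "p \<noteq> 0" using qi n by (simp add: p_def P_def)
  define p' where "p' = - 2 * e * Q q' i'"
  have p'0: "p' \<noteq> 0" using qi' e2 by (auto simp: p'_def)
  define l where "l m = (if m = 0 then P q else if m = 1 then (P ** S) q else Q q')" for m :: nat
  define v where "v m = (\<lambda>k. if m = 0 then P k i / p else if m = 1 then (S ** P) k i / p else Q k i' / p')" for m :: nat
  have dot: "(\<Sum>k<d. A r k * (B k s / c)) = (A ** B) r s / c"
    for A B :: "nat \<Rightarrow> nat \<Rightarrow> 'k" and r s c
    unfolding mm_def sum_divide_distrib by simp
  have PSSP: "P ** S ** (S ** P) = P ** P"
    by (metis mm_assoc S_S EP)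
  have PSQ: "P ** S ** Q = (\<lambda>r s. 0)"
    unfolding mm_assoc SQ unfolding mm_assoc[symmetric] PQ by (simp add: mm_def)
  have QSP: "Q ** (S ** P) = (\<lambda>r s. 0)"
    unfolding mm_assoc[symmetric] SQ[symmetric] unfolding mm_assoc QP by (simp add: mm_def)
  have PSP': "P ** (S ** P) = (\<lambda>r s. 0)" using PSP by (simp only: mm_assoc)
  have "(\<Sum>k<d. l m k * v m' k) = (if m = m' then 1 else 0)" if "m < 3" "m' < 3" for m m'
  proof -
    have "m = 0 \<or> m = 1 \<or> m = 2" "m' = 0 \<or> m' = 1 \<or> m' = 2" using that by auto
    then show ?thesis
      using p0 p'0
      by (elim disjE; simp add: l_def v_def dot PP PSP PSP' PQ PSSP PSQ QP QSP QQ del: times_divide_eq_right)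
        (simp_all add: scale_mat_def p_def p'_def)
  qed
  moreover have "(\<Sum>k<d. A r k * B k s) = (A ** B) r s" for A B :: "nat \<Rightarrow> nat \<Rightarrow> 'k" and r s by (simp add: mm_def)
  note dot' = this
  have "(\<Sum>k<d. l 0 k * M 1 k s) = z * l 0 s" for s
    unfolding l_def by (simp add: dot' PM scale_mat_def)
  moreover have "(\<Sum>k<d. l 1 k * M 1 k s) = inverse z * l 1 s" for s
    unfolding l_def using PSM[of 1] zz by (simp add: dot' scale_mat_def)
  moreover have "(\<Sum>k<d. l 0 k * S k s) = l 1 s" for s
    unfolding l_def by (simp add: dot')
  moreover have "(\<Sum>k<d. l 1 k * S k s) = l 0 s" for s
    unfolding l_def by (simp add: dot' mm_assoc S_S PE)
  moreover have "(\<Sum>k<d. l 1 k * M n k s) = e * l 1 s" for s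
  proof -
    have "P ** S ** M n = scale_mat e (P ** S)"
      unfolding mm_assoc SMn unfolding mm_assoc[symmetric] PM mm_scale_left e_def ..
    then show ?thesis unfolding l_def by (simp add: dot' scale_mat_def)
  qed
  moreover have "(\<Sum>k<d. l 2 k * M n k s) = - e * l 2 s" for s
    unfolding l_def by (simp add: dot' QM scale_mat_def)
  ultimately show ?thesis
    using z(2) z0 e2 by (intro exI[of _ z] exI[of _ e] exI[of _ l] exI[of _ v]) (simp add: power2_eq_square)
qed

end

section \<open>Linear algebra in dimension at most four\<close>

lemma more_unknowns_than_equations:
  fixes a :: "nat \<Rightarrow> nat \<Rightarrow> 'a::field"
  shows "\<exists>c. (\<exists>i<5. c i \<noteq> 0) \<and> (\<forall>r<4. (\<Sum>i<5. a r i * c i) = 0)"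
proof -
  \<comment> \<open>A fifth row of zeros makes the system square; the transpose then annihilates the
    last unit vector, so the determinant is zero.\<close>
  define A where "A = mat 5 5 (\<lambda>(r, i). if r < 4 then a r i else 0)"
  have A: "A \<in> carrier_mat 5 5" by (simp add: A_def)
  have "transpose_mat A *\<^sub>v unit_vec 5 4 = 0\<^sub>v 5"
    by (rule eq_vecI) (auto simp: A_def scalar_prod_def unit_vec_def intro!: sum.neutral)
  moreover have "unit_vec 5 4 \<in> (carrier_vec 5 :: 'a vec set)" "unit_vec 5 4 \<noteq> (0\<^sub>v 5 :: 'a vec)"
    by (auto simp: unit_vec_def vec_eq_iff)
  moreover have "transpose_mat A \<in> carrier_mat 5 5" using A by simp
  ultimately have "det (transpose_mat A) = 0"
    using det_0_iff_vec_prod_zero_field[of "transpose_mat A" 5] by blast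
  then have "det A = 0" using det_transpose[OF A] by simp
  then obtain v where v: "v \<in> carrier_vec 5" "v \<noteq> 0\<^sub>v 5" "A *\<^sub>v v = 0\<^sub>v 5"
    using det_0_iff_vec_prod_zero_field[OF A] by auto
  have "\<exists>i<5. v $ i \<noteq> 0" using v(1,2) by (metis carrier_vecD eq_vecI index_zero_vec)
  moreover have "(\<Sum>i<5. a r i * v $ i) = 0" if "r < 4" for r
  proof -
    have "(A *\<^sub>v v) $ r = (\<Sum>i<5. a r i * v $ i)"
      using that v(1) by (auto simp: A_def scalar_prod_def atLeast0LessThan intro!: sum.cong)
    then show ?thesis using v(3) that by simp
  qed
  ultimately show ?thesis by (intro exI[of _ "\<lambda>i. v $ i"]) blast
qed

text \<open>The remainder \<open>res\<close> of the identity maps into the common kernel of the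
  three forms, whose dimension is at most 1 because \<open>d \<le> 4\<close>. So it has rank at most
  one, and its two factors are the fourth form and the fourth vector; for \<open>d = 3\<close> their
  product is zero.\<close>

lemma complete_dual_system:
  fixes l v :: "nat \<Rightarrow> nat \<Rightarrow> 'a::field"
  assumes d: "d \<le> 4"
    and dual: "\<And>m m'. m < 3 \<Longrightarrow> m' < 3 \<Longrightarrow> (\<Sum>k<d. l m k * v m' k) = (if m = m' then 1 else 0)"
  shows "\<exists>L V. (\<forall>m<3. L m = l m) \<and>
    (\<forall>j<d. \<forall>j'<d. (\<Sum>m<4. L m j' * V m j) = (if j = j' then 1 else 0))"
proof -
  define ker where "ker w \<longleftrightarrow> (\<forall>m<3. (\<Sum>k<d. l m k * w k) = 0)" for w
  define res where "res j = (\<lambda>k. (if k = j then 1 else 0) - (\<Sum>m<3. l m j * v m k))" for j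
  have ker_res: "ker (res j)" if "j < d" for j
    unfolding ker_def
  proof (intro allI impI)
    fix m :: nat assume m: "m < 3"
    have "(\<Sum>k<d. l m k * res j k) = (\<Sum>k<d. l m k * (if k = j then 1 else 0)) -
        (\<Sum>k<d. \<Sum>m'<3. l m' j * (l m k * v m' k))"
      unfolding res_def right_diff_distrib sum_subtractf sum_distrib_left
      by (simp add: mult.left_commute)
    also have "(\<Sum>k<d. l m k * (if k = j then 1 else 0)) = (\<Sum>k<d. if k = j then l m k else 0)"
      by (intro sum.cong) auto
    also have "\<dots> = l m j" using that by (subst sum.delta) auto
    also have "(\<Sum>k<d. \<Sum>m'<3. l m' j * (l m k * v m' k)) = (\<Sum>m'<3. l m' j * (if m = m' then 1 else 0))"
      by (subst sum.swap) (intro sum.cong refl, simp add: sum_distrib_left[symmetric] dual[OF m])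
    also have "\<dots> = (\<Sum>m'<3. if m = m' then l m' j else 0)" by (intro sum.cong) auto
    also have "\<dots> = l m j" using m by (subst sum.delta') auto
    finally show "(\<Sum>k<d. l m k * res j k) = 0" by simp
  qed
  have "\<exists>w0 g. \<forall>j<d. \<forall>k<d. res j k = g j * w0 k"
  proof (cases "\<forall>j<d. \<forall>k<d. res j k = 0")
    case True
    then show ?thesis by (intro exI[of _ "\<lambda>_. 0"]) simp
  next
    case False
    then obtain j0 p where jp: "j0 < d" "p < d" "res j0 p \<noteq> 0" by blast
    define w0 where "w0 = res j0"
    have R: "res j k = res j p / w0 p * w0 k" if j: "j < d" and k: "k < d" for j k
    proof (rule ccontr)
      assume ne: "res j k \<noteq> res j p / w0 p * w0 k"
      \<comment> \<open>If the remainder had larger rank, \<open>u\<close> and \<open>w0\<close>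
        would be independent in the kernel and, with the three vectors \<open>v m\<close>, give five
        independent vectors with four coordinates.\<close>
      define u where "u = (\<lambda>k. res j k - res j p / w0 p * w0 k)"
      have up: "u p = 0" using jp(3) by (simp add: u_def w0_def)
      have uk: "u k \<noteq> 0" using ne by (simp add: u_def)
      have ker_u: "(\<Sum>k<d. l m k * u k) = 0" if "m < 3" for m
      proof -
        have "(\<Sum>k<d. l m k * u k) = (\<Sum>k<d. l m k * res j k) - res j p / w0 p * (\<Sum>k<d. l m k * res j0 k)"
          unfolding u_def w0_def right_diff_distrib sum_subtractf sum_distrib_left by (simp add: mult_ac)
        then show ?thesis using ker_res[OF j] ker_res[OF jp(1)] that by (simp add: ker_def)
      qed
      define vec5 where "vec5 i = (if i < 3 then v i else if i = 3 then w0 else u)" for i :: nat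
      obtain c where c: "\<exists>i<5. c i \<noteq> 0" "\<And>r. r < 4 \<Longrightarrow> (\<Sum>i<5. vec5 i r * c i) = 0"
        using more_unknowns_than_equations[of "\<lambda>r i. vec5 i r"] by blast
      have s5: "(\<Sum>i<5. h i) = (\<Sum>i<3. h i) + h 3 + h 4" for h :: "nat \<Rightarrow> 'a"
        by (simp add: eval_nat_numeral)
      have c3: "c m = 0" if m: "m < 3" for m
      proof -
        have "0 = (\<Sum>r<d. l m r * (\<Sum>i<5. vec5 i r * c i))"
          using c(2) d by (intro sum.neutral[symmetric] ballI) auto
        also have "\<dots> = (\<Sum>i<5. c i * (\<Sum>r<d. l m r * vec5 i r))"
          unfolding sum_distrib_left by (subst sum.swap) (simp add: mult_ac)
        also have "\<dots> = (\<Sum>i<3. c i * (if m = i then 1 else 0))"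
          unfolding s5 using ker_u[OF m] ker_res[OF jp(1)] m by (simp add: vec5_def dual ker_def w0_def)
        also have "\<dots> = (\<Sum>i<3. if m = i then c i else 0)" by (intro sum.cong) auto
        also have "\<dots> = c m" using m by (subst sum.delta') auto
        finally show ?thesis by simp
      qed
      have rest: "w0 r * c 3 + u r * c 4 = 0" if "r < d" for r
        using c(2)[of r] that d c3 by (simp add: s5 vec5_def)
      have c30: "c 3 = 0" using rest[OF jp(2)] up jp(3) by (simp add: w0_def)
      then have "c 4 = 0" using rest[OF k] uk by simp
      with c30 c3 have "c i = 0" if "i < 5" for i
      proof -
        have "i < 3 \<or> i = 3 \<or> i = 4" using that by auto
        then show ?thesis using c30 \<open>c 4 = 0\<close> c3 by auto
      qed
      then show False using c(1) by blast
    qed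
    show ?thesis by (intro exI[of _ w0] exI[of _ "\<lambda>j. res j p / w0 p"] allI impI R)
  qed
  then obtain w0 g where wg: "\<And>j k. j < d \<Longrightarrow> k < d \<Longrightarrow> res j k = g j * w0 k" by blast
  define L where "L m = (if m < 3 then l m else g)" for m :: nat
  define V where "V m = (if m < 3 then v m else w0)" for m :: nat
  have "(\<Sum>m<4. L m j' * V m j) = (if j = j' then 1 else 0)" if "j < d" "j' < d" for j j'
  proof -
    have "(\<Sum>m<4. L m j' * V m j) = (\<Sum>m<3. l m j' * v m j) + g j' * w0 j"
      by (simp add: eval_nat_numeral L_def V_def)
    also have "g j' * w0 j = res j' j" using wg[OF that(2,1)] by simp
    finally show ?thesis by (simp add: res_def)
  qed
  then show ?thesis by (intro exI[of _ L] exI[of _ V]) (simp add: L_def)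
qed

section \<open>Functions that are polynomial along lines\<close>

text \<open>A substitute for polynomial functions that is stable under products and substitution
  into forms, yet strong enough to make nonvanishing conditions compatible.\<close>

definition line_poly :: "((nat \<Rightarrow> 'a::comm_ring_1) \<Rightarrow> 'a) \<Rightarrow> bool" where
  "line_poly h \<longleftrightarrow> (\<forall>x v. \<exists>p. \<forall>s. h (\<lambda>i. x i + s * v i) = poly p s)"

lemma line_poly_coord: "line_poly (\<lambda>x. x i)"
  unfolding line_poly_def by (intro allI, rule_tac x = "[:x i, v i:]" in exI) simp

lemma line_poly_const: "line_poly (\<lambda>x. c)"
  unfolding line_poly_def by (intro allI exI[of _ "[:c:]"]) simp

lemma line_poly_mult:
  assumes "line_poly g" "line_poly h"
  shows "line_poly (\<lambda>x. g x * h x)"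
  unfolding line_poly_def
proof (intro allI)
  fix x v
  obtain p q where "\<forall>s. g (\<lambda>i. x i + s * v i) = poly p s" "\<forall>s. h (\<lambda>i. x i + s * v i) = poly q s"
    using assms unfolding line_poly_def by blast
  then show "\<exists>p. \<forall>s. g (\<lambda>i. x i + s * v i) * h (\<lambda>i. x i + s * v i) = poly p s"
    by (intro exI[of _ "p * q"]) simp
qed

lemma line_poly_eval:
  assumes "\<And>i. line_poly (h i)"
  shows "line_poly (\<lambda>x. value_at (\<lambda>i. h i x) p)"
  unfolding line_poly_def
proof (intro allI)
  fix x v
  have "\<forall>i. \<exists>q. \<forall>s. h i (\<lambda>j. x j + s * v j) = poly q s"
    using assms unfolding line_poly_def by simp
  from choice[OF this] obtain q where "\<forall>i. \<forall>s. h i (\<lambda>j. x j + s * v j) = poly (q i) s"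
    by (elim exE)
  then have q: "h i (\<lambda>j. x j + s * v j) = poly (q i) s" for i s by simp
  show "\<exists>r. \<forall>s. value_at (\<lambda>i. h i (\<lambda>j. x j + s * v j)) p = poly r s"
    by (intro exI[of _ "subst_polys q p"] allI, subst eval_mpoly_hom[OF comm_ring_hom_poly_eval])
      (simp add: q)
qed

lemma line_poly_linear: "line_poly (\<lambda>x. \<Sum>k<d. l k * x k)"
  unfolding line_poly_def
proof (intro allI)
  fix x v :: "nat \<Rightarrow> 'a"
  show "\<exists>p. \<forall>s. (\<Sum>k<d. l k * (x k + s * v k)) = poly p s"
    by (intro exI[of _ "\<Sum>k<d. [:l k * x k, l k * v k:]"] allI) (simp add: poly_sum algebra_simps)
qed

text \<open>On the line joining \<open>x\<close> and \<open>y\<close> both functions are nonzero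
  polynomials, and so is their product.\<close>

lemma line_poly_common_nonzero:
  fixes g h :: "(nat \<Rightarrow> 'a::field_char_0) \<Rightarrow> 'a"
  assumes "line_poly g" "line_poly h" "g x \<noteq> 0" "h y \<noteq> 0"
  shows "\<exists>z. g z * h z \<noteq> 0"
proof -
  define v where "v = (\<lambda>i. y i - x i)"
  obtain p q where p: "\<And>s. g (\<lambda>i. x i + s * v i) = poly p s" and q: "\<And>s. h (\<lambda>i. x i + s * v i) = poly q s"
    using assms(1,2) unfolding line_poly_def by meson
  have "poly p 0 \<noteq> 0" "poly q 1 \<noteq> 0"
    using p[of 0] q[of 1] assms(3,4) by (simp_all add: v_def)
  then have "p * q \<noteq> 0" by auto
  then obtain s where "poly (p * q) s \<noteq> 0" by (metis poly_eqI_infinite poly_0)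
  then show ?thesis using p[of s] q[of s] by (intro exI[of _ "\<lambda>i. x i + s * v i"]) simp
qed

section \<open>Dimension\<close>

lemma quadratic_dvd:
  fixes p :: "'a::idom poly"
  shows "[:0, 0, 1:] dvd p \<longleftrightarrow> coeff p 0 = 0 \<and> coeff p 1 = 0"
proof
  assume "[:0, 0, 1:] dvd p"
  then obtain q where "p = [:0, 0, 1:] * q" by (auto simp: dvd_def)
  then show "coeff p 0 = 0 \<and> coeff p 1 = 0" by (simp add: coeff_pCons)
next
  assume c: "coeff p 0 = 0 \<and> coeff p 1 = 0"
  obtain b p' where "p = pCons b p'" by (cases p)
  moreover obtain b' p'' where "p' = pCons b' p''" by (cases p')
  ultimately have "p = [:0, 0, 1:] * p''" using c by simp
  then show "[:0, 0, 1:] dvd p" by (metis dvd_triv_left)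
qed

text \<open>A tangent argument at \<open>y0\<close>. If \<open>d \<ge> 5\<close>, some direction
  \<open>v\<close> annihilates the differentials of four components of \<psi>; the equation of the
  threefold then annihilates the fifth. Since \<phi> inverts \<psi>, to first order \<open>v\<close>
  is a multiple of \<open>y0\<close>. The Euler identity shows, however, that the component 0 is not
  stationary along \<open>y0\<close>.\<close>

lemma dimension_bound:
  fixes f :: "'k::{alg_closed_field, field_char_0} mpoly"
  assumes f: "vars f \<subseteq> {2, 3, 4}"
    and phi: "\<And>j. j < d \<Longrightarrow> vars (\<phi> j) \<subseteq> {..<5}"
    and psi: "\<And>i. i < 5 \<Longrightarrow> homogeneous D' (\<psi> i)" "\<And>i. i < 5 \<Longrightarrow> vars (\<psi> i) \<subseteq> {..<d}"
    and on_X: "\<And>y. (\<exists>j<d. y j \<noteq> 0) \<Longrightarrow> value_at y (\<psi> 0) * value_at y (\<psi> 1) *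
      value_at y (\<psi> 2) + value_at (\<lambda>i. value_at y (\<psi> i)) f = 0"
    and inv: "\<And>y i j. (\<exists>j<d. y j \<noteq> 0) \<Longrightarrow> i < d \<Longrightarrow> j < d \<Longrightarrow>
      value_at y (\<psi> 0) * (value_at (\<lambda>i. value_at y (\<psi> i)) (\<phi> i) * y j -
        value_at (\<lambda>i. value_at y (\<psi> i)) (\<phi> j) * y i) = 0"
    and y0: "j0 < d" "y0 j0 \<noteq> 0" "value_at y0 (\<psi> 0) \<noteq> 0" "value_at y0 (\<psi> 2) \<noteq> 0"
      "j1 < d" "value_at (\<lambda>i. value_at y0 (\<psi> i)) (\<phi> j1) \<noteq> 0"
  shows "d \<le> 4"
proof (rule ccontr)
  assume "\<not> d \<le> 4"
  then have d: "d \<ge> 5" by simp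
  define c where "c i = value_at y0 (\<psi> i)" for i
  have c0: "c 0 \<noteq> 0" and c2: "c 2 \<noteq> 0" using y0 by (simp_all add: c_def)
  let ?q = "[:0, 0, 1:] :: 'k poly"
  define Y where "Y v = (\<lambda>j. [:y0 j, v j:])" for v
  define \<Psi> where "\<Psi> v i = subst_polys (Y v) (\<psi> i)" for v i
  have poly_eval: "poly (subst_polys x p) s = value_at (\<lambda>i. poly (x i) s) p"
    for x :: "nat \<Rightarrow> 'k poly" and p s
    by (subst eval_mpoly_hom[OF comm_ring_hom_poly_eval]) simp
  have poly_\<Psi>: "poly (\<Psi> v i) s = value_at (\<lambda>j. poly (Y v j) s) (\<psi> i)" for v i s
    unfolding \<Psi>_def by (rule poly_eval)
  have \<Psi>0: "poly (\<Psi> v i) 0 = c i" for v i by (simp add: poly_\<Psi> c_def Y_def)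
  have parallel: "y0 i * v j = y0 j * v i"
    if "\<And>i. i \<in> {0, 2, 3, 4} \<Longrightarrow> ?q dvd \<Psi> v i - [:c i:]" and ij: "i < d" "j < d" for v i j
  proof -
    \<comment> \<open>The vector \<open>Y v\<close> may vanish at some parameter; the factor
      \<open>Y v j0\<close>, a nonzero polynomial, covers that value.\<close>
    have zero: "P = 0" if "\<And>s. (\<exists>j<d. poly (Y v j) s \<noteq> 0) \<Longrightarrow> poly P s = 0" for P
    proof -
      have "P * Y v j0 = 0"
        by (rule poly_eqI_infinite) (use that y0(1) in auto)
      moreover have "Y v j0 \<noteq> 0" using y0(2) by (simp add: Y_def)
      ultimately show ?thesis by simp
    qed
    have F: "\<Psi> v 0 * \<Psi> v 1 * \<Psi> v 2 + subst_polys (\<Psi> v) f = 0"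
      by (rule zero) (use on_X in \<open>simp add: poly_eval poly_\<Psi>\<close>)
    have cF: "c 0 * c 1 * c 2 + value_at c f = 0"
      using on_X[of y0] y0(1,2) unfolding c_def by blast
    have const: "subst_polys (\<lambda>i. [:c i:]) p = [:value_at c p:]" for p :: "'k mpoly"
      by (rule eval_mpoly_hom[OF comm_ring_hom_const_poly, symmetric])
    have df: "?q dvd subst_polys (\<Psi> v) f - [:value_at c f:]"
      unfolding const[symmetric] by (rule eval_mpoly_diff_dvd) (use f that(1) in auto)
    \<comment> \<open>The equation expanded around the constants \<open>c\<close>. As
      \<open>c 0 * c 2 \<noteq> 0\<close>, it determines the component 1 from the others to first
      order.\<close>
    have "[:c 0 * c 2:] * (\<Psi> v 1 - [:c 1:]) =
       - ((\<Psi> v 0 - [:c 0:]) * (\<Psi> v 1 * \<Psi> v 2)) - (\<Psi> v 2 - [:c 2:]) * ([:c 0:] * \<Psi> v 1) -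
       (subst_polys (\<Psi> v) f - [:value_at c f:]) +
       ((\<Psi> v 0 * \<Psi> v 1 * \<Psi> v 2 + subst_polys (\<Psi> v) f) -
        [:c 0 * c 1 * c 2 + value_at c f:])"
      by (rule poly_eqI_infinite) (simp add: algebra_simps)
    also have "\<dots> = - ((\<Psi> v 0 - [:c 0:]) * (\<Psi> v 1 * \<Psi> v 2)) - (\<Psi> v 2 - [:c 2:]) * ([:c 0:] * \<Psi> v 1) -
       (subst_polys (\<Psi> v) f - [:value_at c f:])"
      unfolding F cF by simp
    finally have eq: "[:c 0 * c 2:] * (\<Psi> v 1 - [:c 1:]) =
       - ((\<Psi> v 0 - [:c 0:]) * (\<Psi> v 1 * \<Psi> v 2)) - (\<Psi> v 2 - [:c 2:]) * ([:c 0:] * \<Psi> v 1) -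
       (subst_polys (\<Psi> v) f - [:value_at c f:])" .
    have "?q dvd - ((\<Psi> v 0 - [:c 0:]) * (\<Psi> v 1 * \<Psi> v 2))"
      unfolding dvd_minus_iff by (rule dvd_mult2) (rule that(1), simp)
    moreover have "?q dvd (\<Psi> v 2 - [:c 2:]) * ([:c 0:] * \<Psi> v 1)"
      by (rule dvd_mult2) (rule that(1), simp)
    ultimately have "?q dvd [:c 0 * c 2:] * (\<Psi> v 1 - [:c 1:])"
      unfolding eq by (rule dvd_diff[OF dvd_diff df])
    then have d1: "?q dvd \<Psi> v 1 - [:c 1:]"
      using c0 c2 by (simp add: dvd_smult_iff)
    have all: "?q dvd \<Psi> v i - [:c i:]" if "i < 5" for i
    proof -
      have "i \<in> {0, 2, 3, 4} \<or> i = 1" using that by auto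
      then show ?thesis using \<open>\<And>i. i \<in> {0, 2, 3, 4} \<Longrightarrow> ?q dvd \<Psi> v i - [:c i:]\<close> d1 by blast
    qed
    define \<kappa> where "\<kappa> j = value_at c (\<phi> j)" for j
    define \<Phi> where "\<Phi> j = subst_polys (\<Psi> v) (\<phi> j)" for j
    have d\<Phi>: "?q dvd \<Phi> j - [:\<kappa> j:]" if "j < d" for j
      unfolding \<Phi>_def \<kappa>_def const[symmetric] by (rule eval_mpoly_diff_dvd) (use all phi[OF that] in auto)
    have rel: "\<kappa> i * y0 j = \<kappa> j * y0 i \<and> \<kappa> i * v j = \<kappa> j * v i" if "i < d" "j < d" for i j
    proof -
      have "\<Psi> v 0 * (\<Phi> i * Y v j - \<Phi> j * Y v i) = 0"
        by (rule zero) (use inv[OF _ that] in \<open>simp add: poly_\<Psi> \<Phi>_def poly_eval\<close>)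
      moreover have "\<Psi> v 0 \<noteq> 0" using \<Psi>0[of v 0] c0 by auto
      ultimately have z: "\<Phi> i * Y v j - \<Phi> j * Y v i = 0" by simp
      have eq: "[:\<kappa> i:] * Y v j - [:\<kappa> j:] * Y v i =
        (\<Phi> i * Y v j - \<Phi> j * Y v i) - (\<Phi> i - [:\<kappa> i:]) * Y v j + (\<Phi> j - [:\<kappa> j:]) * Y v i"
        by (simp add: algebra_simps)
      have "?q dvd [:\<kappa> i:] * Y v j - [:\<kappa> j:] * Y v i"
        unfolding eq z
        by (rule dvd_add[OF dvd_diff[OF dvd_0_right dvd_mult2[OF d\<Phi>[OF that(1)]]] dvd_mult2[OF d\<Phi>[OF that(2)]]])
      then show ?thesis unfolding quadratic_dvd by (simp add: Y_def mult.commute)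
    qed
    have "c = (\<lambda>i. value_at y0 (\<psi> i))" by (rule ext) (simp add: c_def)
    then have k1: "\<kappa> j1 \<noteq> 0" using y0(6) by (simp add: \<kappa>_def)
    define A B where "A = y0 j1 / \<kappa> j1" and "B = v j1 / \<kappa> j1"
    have "y0 i = \<kappa> i * A \<and> v i = \<kappa> i * B" if "i < d" for i
      using rel[OF that y0(5)] k1 unfolding A_def B_def by (auto simp: field_simps)
    from this[OF ij(1)] this[OF ij(2)] show ?thesis by simp
  qed
  have coeff1: "coeff (\<Psi> v i) 1 = (\<Sum>j<d. value_at y0 (partial_deriv j (\<psi> i)) * v j)" if "i < 5" for v i
  proof -
    have "coeff (\<Psi> v i) 1 = poly (pderiv (\<Psi> v i)) 0" by (simp add: poly_0_coeff_0 coeff_pderiv)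
    also have "\<dots> = (\<Sum>j<d. value_at y0 (partial_deriv j (\<psi> i)) * v j)"
      unfolding \<Psi>_def pderiv_eval_mpoly[OF finite_lessThan psi(2)[OF that]]
      by (simp add: poly_sum poly_eval Y_def pderiv_pCons mult.commute)
    finally show ?thesis .
  qed
  have crit: "?q dvd \<Psi> v i - [:c i:] \<longleftrightarrow> coeff (\<Psi> v i) 1 = 0" for v i
    unfolding quadratic_dvd using \<Psi>0[of v i] by (simp add: poly_0_coeff_0)
  show False
  proof (cases "D' = 0")
    case True
    \<comment> \<open>In degree 0 the components of \<psi> are constant, so \<open>parallel\<close>
      applies to every direction; one is chosen that is not a multiple of \<open>y0\<close>.\<close>
    define j2 where "j2 = (if j0 = 0 then 1 else 0 :: nat)"
    have j2: "j2 < d" "j2 \<noteq> j0" using d by (auto simp: j2_def)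
    define v where "v = (\<lambda>j. if j = j2 then 1 else 0 :: 'k)"
    have "\<Psi> v i = [:c i:]" if "i < 5" for i
    proof -
      have h: "eval_mpoly h x (\<psi> i) = eval_mpoly h (\<lambda>i. 0 * x i) (\<psi> i)" for h :: "'k \<Rightarrow> 'b::comm_ring_1" and x
        using eval_mpoly_scale[OF psi(1)[OF that], of h 0 x] True by simp
      have "\<Psi> v i = subst_polys (\<lambda>i. [:0 * y0 i:]) (\<psi> i)"
        unfolding \<Psi>_def by (subst h) simp
      also have "\<dots> = [:value_at (\<lambda>i. 0 * y0 i) (\<psi> i):]"
        by (rule eval_mpoly_hom[OF comm_ring_hom_const_poly, symmetric])
      also have "value_at (\<lambda>i. 0 * y0 i) (\<psi> i) = c i" unfolding c_def by (rule h[symmetric])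
      finally show ?thesis .
    qed
    then have "y0 j0 * v j2 = y0 j2 * v j0" by (intro parallel) (use y0(1) j2(1) in auto)
    then show False using y0(2) j2 by (simp add: v_def)
  next
    case False
    \<comment> \<open>The four equations skip the component 1, which the equation of the threefold
      controls.\<close>
    define row where "row r = (if r = 0 then 0 else Suc r)" for r :: nat
    obtain b where b: "\<exists>i<5. b i \<noteq> 0" "\<And>r. r < 4 \<Longrightarrow>
        (\<Sum>i<5. value_at y0 (partial_deriv i (\<psi> (row r))) * b i) = 0"
      using more_unknowns_than_equations[of "\<lambda>r i. value_at y0 (partial_deriv i (\<psi> (row r)))"] by blast
    define v where "v j = (if j < 5 then b j else 0)" for j
    have lin: "(\<Sum>j<d. g j * v j) = (\<Sum>i<5. g i * b i)" for g
    proof -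
      have "(\<Sum>j<d. g j * v j) = (\<Sum>j<5. g j * v j)"
        by (rule sum.mono_neutral_right) (use d in \<open>auto simp: v_def\<close>)
      then show ?thesis by (simp add: v_def)
    qed
    have z: "coeff (\<Psi> v i) 1 = 0" if "i \<in> {0, 2, 3, 4}" for i
    proof -
      have i: "i < 5" "i = row (i - 1)" "i - 1 < 4"
        using that by (auto simp: row_def)
      show ?thesis unfolding coeff1[OF i(1)] lin using b(2)[OF i(3)] i(2) by simp
    qed
    have par: "y0 j0 * v j = y0 j * v j0" if "j < d" for j
      by (rule parallel) (use z that y0(1) crit in auto)
    obtain j3 where j3: "j3 < 5" "b j3 \<noteq> 0" using b(1) by blast
    define \<theta> where "\<theta> = v j0 / y0 j0"
    have v\<theta>: "v j = \<theta> * y0 j" if "j < d" for j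
      using par[OF that] y0(2) by (simp add: \<theta>_def field_simps)
    have \<theta>0: "\<theta> \<noteq> 0" using v\<theta>[of j3] j3 d by (auto simp: v_def)
    \<comment> \<open>The derivative along \<open>v\<close>, that is, along a nonzero multiple of
      \<open>y0\<close>, is evaluated by the Euler identity.\<close>
    have "0 = (\<Sum>j<d. value_at y0 (partial_deriv j (\<psi> 0)) * v j)"
      using z[of 0] coeff1[of 0 v] by simp
    also have "\<dots> = \<theta> * (\<Sum>j<d. value_at y0 (partial_deriv j (\<psi> 0)) * y0 j)"
      unfolding sum_distrib_left by (intro sum.cong) (auto simp: v\<theta>)
    also have "\<dots> = \<theta> * (of_nat D' * c 0)"
      using euler_identity[OF finite_lessThan psi(2)[of 0] psi(1)[of 0]] by (simp add: c_def)
    finally show False using \<theta>0 False c0 by simp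
  qed
qed

section \<open>Birational maps in coordinates\<close>

locale linearization_maps = smooth_cubic f
  for f :: "'k::{alg_closed_field, field_char_0} mpoly" +
  fixes D D' d n :: nat and \<phi> \<psi> :: "nat \<Rightarrow> 'k mpoly" and a :: 'k
  assumes unc: "uncountable (UNIV :: 'k set)" and n2: "n \<ge> 2"
    and prim: "primitive_root_of_unity (2 * n) a"
    and phi: "\<And>j. j < d \<Longrightarrow> homogeneous D (\<phi> j)" "\<And>j. j < d \<Longrightarrow> vars (\<phi> j) \<subseteq> {..<5}"
    and psi: "\<And>i. i < 5 \<Longrightarrow> homogeneous D' (\<psi> i)" "\<And>i. i < 5 \<Longrightarrow> vars (\<psi> i) \<subseteq> {..<d}"
begin

definition ph :: "(nat \<Rightarrow> 'k) \<Rightarrow> nat \<Rightarrow> 'k" where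
  "ph x = (\<lambda>j. value_at x (\<phi> j))"

definition ps :: "(nat \<Rightarrow> 'k) \<Rightarrow> nat \<Rightarrow> 'k" where
  "ps y = (\<lambda>i. value_at y (\<psi> i))"

definition F :: "(nat \<Rightarrow> 'k) \<Rightarrow> 'k" where
  "F x = x 0 * x 1 * x 2 + value_at x f"

definition nonz :: "nat \<Rightarrow> (nat \<Rightarrow> 'k) \<Rightarrow> bool" where
  "nonz N x \<longleftrightarrow> (\<exists>i<N. x i \<noteq> 0)"

definition prop_to :: "nat \<Rightarrow> (nat \<Rightarrow> 'k) \<Rightarrow> (nat \<Rightarrow> 'k) \<Rightarrow> bool" where
  "prop_to N x y \<longleftrightarrow> (\<exists>c. c \<noteq> 0 \<and> (\<forall>i<N. y i = c * x i))"

definition act :: "nat \<Rightarrow> (nat \<Rightarrow> 'k) \<Rightarrow> nat \<Rightarrow> 'k" where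
  "act i = scale01 (a ^ i) (inverse (a ^ i))"

definition app :: "(nat \<Rightarrow> nat \<Rightarrow> 'k) \<Rightarrow> (nat \<Rightarrow> 'k) \<Rightarrow> nat \<Rightarrow> 'k" where
  "app A y = (\<lambda>j. \<Sum>k<d. A j k * y k)"

end

locale equivariant_birational_maps = linearization_maps f D D' d n \<phi> \<psi> a
  for f :: "'k::{alg_closed_field, field_char_0} mpoly" and D D' d n \<phi> \<psi> a +
  fixes M :: "nat \<Rightarrow> nat \<Rightarrow> nat \<Rightarrow> 'k" and S :: "nat \<Rightarrow> nat \<Rightarrow> 'k"
  assumes ps_X: "\<And>y. nonz d y \<Longrightarrow> F (ps y) = 0"
    and ps_ph: "\<And>x. nonz 5 x \<Longrightarrow> F x = 0 \<Longrightarrow> nonz d (ph x) \<Longrightarrow> nonz 5 (ps (ph x)) \<Longrightarrow>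
      prop_to 5 x (ps (ph x))"
    and ph_ps: "\<And>y. nonz d y \<Longrightarrow> nonz 5 (ps y) \<Longrightarrow> nonz d (ph (ps y)) \<Longrightarrow>
      prop_to d y (ph (ps y))"
    and point: "\<exists>x. F x = 0 \<and> x 0 * x 1 * x 2 \<noteq> 0 \<and> nonz d (ph x) \<and> nonz 5 (ps (ph x))"
    and equiv_S: "\<And>x. nonz 5 x \<Longrightarrow> F x = 0 \<Longrightarrow> nonz d (ph x) \<Longrightarrow> nonz d (ph (swap01 x)) \<Longrightarrow>
      prop_to d (app S (ph x)) (ph (swap01 x))"
    and equiv_M: "\<And>x i. nonz 5 x \<Longrightarrow> F x = 0 \<Longrightarrow> nonz d (ph x) \<Longrightarrow> nonz d (ph (act i x)) \<Longrightarrow>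
      prop_to d (app (M i) (ph x)) (ph (act i x))"
    and M_mult: "\<And>i j. mm d (M i) (M j) = M (i + j)" and M_0: "M 0 = id_mat d"
    and M_period: "\<And>i. M (i + 2 * n) = M i"
    and E_left: "\<And>i. mm d (id_mat d) (M i) = M i" "mm d (id_mat d) S = S"
    and S_S: "mm d S S = id_mat d" and S_M: "\<And>j. mm d S (M j) = mm d (M ((2 * n - 1) * j)) S"
begin

lemma a0: "a \<noteq> 0"
  using prim n2 by (auto simp: primitive_root_of_unity_def power_0_left)

lemma line_poly_ph: "(\<And>i. line_poly (\<lambda>w. h w i)) \<Longrightarrow> line_poly (\<lambda>w. ph (h w) j)"
  unfolding ph_def by (rule line_poly_eval)

lemma line_poly_ps: "(\<And>i. line_poly (\<lambda>w. h w i)) \<Longrightarrow> line_poly (\<lambda>w. ps (h w) j)"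
  unfolding ps_def by (rule line_poly_eval)

lemma ph_scale: "j < d \<Longrightarrow> ph (\<lambda>i. c * x i) j = c ^ D * ph x j"
  unfolding ph_def by (rule eval_mpoly_scale[OF phi(1)])

lemma ps_scale: "i < 5 \<Longrightarrow> ps (\<lambda>i. c * x i) i = c ^ D' * ps x i"
  unfolding ps_def by (rule eval_mpoly_scale[OF psi(1)])

lemma ph_cong: "j < d \<Longrightarrow> (\<And>i. i < 5 \<Longrightarrow> x i = y i) \<Longrightarrow> ph x j = ph y j"
  unfolding ph_def using phi(2) by (intro eval_mpoly_cong) auto

lemma ps_cong: "i < 5 \<Longrightarrow> (\<And>j. j < d \<Longrightarrow> x j = y j) \<Longrightarrow> ps x i = ps y i"
  unfolding ps_def using psi(2) by (intro eval_mpoly_cong) auto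

lemma ph_prop: "prop_to 5 x y \<Longrightarrow> prop_to d (ph x) (ph y)"
proof -
  assume "prop_to 5 x y"
  then obtain c where c: "c \<noteq> 0" "\<And>i. i < 5 \<Longrightarrow> y i = c * x i" unfolding prop_to_def by blast
  have "ph y j = c ^ D * ph x j" if "j < d" for j
    unfolding ph_scale[OF that, symmetric] by (rule ph_cong[OF that]) (rule c(2))
  then show ?thesis unfolding prop_to_def using c(1) by (intro exI[of _ "c ^ D"]) simp
qed

lemma ps_prop: "prop_to d x y \<Longrightarrow> prop_to 5 (ps x) (ps y)"
proof -
  assume "prop_to d x y"
  then obtain c where c: "c \<noteq> 0" "\<And>i. i < d \<Longrightarrow> y i = c * x i" unfolding prop_to_def by blast
  have "ps y j = c ^ D' * ps x j" if "j < 5" for j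
    unfolding ps_scale[OF that, symmetric] by (rule ps_cong[OF that]) (rule c(2))
  then show ?thesis unfolding prop_to_def using c(1) by (intro exI[of _ "c ^ D'"]) simp
qed

lemma prop_nonz: "prop_to N x y \<Longrightarrow> nonz N x \<Longrightarrow> nonz N y"
  unfolding prop_to_def nonz_def by auto

text \<open>The equation is linear in the coordinate 1; solving for it and clearing denominators
  parametrizes the threefold. This stands in for irreducibility: conditions on points become
  functions polynomial along lines.\<close>

definition par :: "(nat \<Rightarrow> 'k) \<Rightarrow> nat \<Rightarrow> 'k" where
  "par w = (\<lambda>i. if i = 0 then w 0 * (w 0 * w 2) else if i = 1 then - value_at w f
     else w 0 * (w 2 * w i))"

lemma par_X: "F (par w) = 0"
proof -
  have "value_at (par w) f = value_at (\<lambda>i. (w 0 * w 2) * w i) f"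
    by (rule eval_mpoly_cong) (use vars in \<open>auto simp: par_def\<close>)
  also have "\<dots> = (w 0 * w 2) ^ 3 * value_at w f" by (rule eval_mpoly_scale[OF hom])
  finally show ?thesis by (simp add: F_def par_def power3_eq_cube)
qed

lemma par_surj: "F x = 0 \<Longrightarrow> x 0 * x 2 \<noteq> 0 \<Longrightarrow> prop_to 5 x (par x)"
  unfolding prop_to_def
  by (intro exI[of _ "x 0 * x 2"]) (auto simp: par_def F_def algebra_simps add_eq_0_iff)

lemma line_poly_par: "line_poly (\<lambda>w. par w i)"
proof -
  have "line_poly (\<lambda>w :: nat \<Rightarrow> 'k. - 1 * value_at w f)"
    by (intro line_poly_mult line_poly_const line_poly_eval line_poly_coord)
  moreover have "line_poly (\<lambda>w :: nat \<Rightarrow> 'k. w 0 * (w j * w i))" for i j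
    by (intro line_poly_mult line_poly_coord)
  ultimately show ?thesis by (cases "i = 0"; cases "i = 1") (simp_all add: par_def)
qed

lemma F_act: "F (act i x) = F x"
proof -
  have "value_at (act i x) f = value_at x f"
    by (rule eval_mpoly_cong) (use vars in \<open>auto simp: act_def scale01_def\<close>)
  then show ?thesis using a0 by (simp add: F_def act_def scale01_def)
qed

text \<open>Faithfulness passes to the representation: if \<open>M i\<close> acts trivially on
  projective space, the birational map makes \<open>act i\<close> trivial at general points of the
  threefold, and there the ratio of the coordinates 0 and 2 is multiplied by
  \<open>a ^ i\<close>.\<close>

lemma M_scalar:
  assumes "M i = scale_mat c (id_mat d)"
  shows "a ^ i = 1"
proof -
  obtain x where x: "F x = 0" "x 0 * x 1 * x 2 \<noteq> 0" "nonz d (ph x)" "nonz 5 (ps (ph x))"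
    using point by blast
  obtain j1 where j1: "j1 < d" "ph x j1 \<noteq> 0" using x(3) by (auto simp: nonz_def)
  obtain i1 where i1: "i1 < 5" "ps (ph x) i1 \<noteq> 0" using x(4) by (auto simp: nonz_def)
  have x02: "x 0 * x 2 \<noteq> 0" using x(2) by auto
  \<comment> \<open>The preimage of \<open>x\<close> under \<open>act i\<close>: there the condition
    \<open>h\<close>, that \<phi> is defined after the action, certainly holds.\<close>
  define x' where "x' = scale01 (inverse (a ^ i)) (a ^ i) x"
  have act_x': "act i x' j = x j" for j using a0 by (simp add: x'_def act_def scale01_def)
  have x'X: "F x' = 0" using F_act[of i x'] x(1) by (simp add: act_x' ext[of "act i x'" x])
  have x'02: "x' 0 * x' 2 \<noteq> 0" using x02 a0 by (simp add: x'_def scale01_def)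
  define g where "g w = ps (ph (par w)) i1 * (ph (par w) j1 * (w 0 * w 2))" for w
  define h where "h w = ph (act i (par w)) j1" for w
  have "line_poly g"
    unfolding g_def by (intro line_poly_mult line_poly_ps line_poly_ph line_poly_par line_poly_coord)
  moreover have "line_poly (\<lambda>w. act i (par w) j)" for j
  proof -
    have "line_poly (\<lambda>w. b * par w k)" for b k by (intro line_poly_mult line_poly_const line_poly_par)
    then show ?thesis
      using line_poly_par by (cases "j = 0"; cases "j = 1") (simp_all add: act_def scale01_def)
  qed
  then have "line_poly h" unfolding h_def by (rule line_poly_ph)
  moreover have "g x \<noteq> 0"
  proof -
    have p: "prop_to 5 x (par x)" by (rule par_surj[OF x(1) x02])
    obtain b where b: "b \<noteq> 0" "\<And>j. j < d \<Longrightarrow> ph (par x) j = b * ph x j"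
      using ph_prop[OF p] unfolding prop_to_def by blast
    obtain b' where "b' \<noteq> 0" "\<And>j. j < 5 \<Longrightarrow> ps (ph (par x)) j = b' * ps (ph x) j"
      using ps_prop[OF ph_prop[OF p]] unfolding prop_to_def by blast
    then show ?thesis using b j1 i1 x02 by (simp add: g_def)
  qed
  moreover have "h x' \<noteq> 0"
  proof -
    obtain b where b: "b \<noteq> 0" "\<And>i. i < 5 \<Longrightarrow> par x' i = b * x' i"
      using par_surj[OF x'X x'02] unfolding prop_to_def by blast
    have "prop_to 5 x (act i (par x'))"
      unfolding prop_to_def
    proof (intro exI conjI allI impI)
      show "act i (par x') j = b * x j" if "j < 5" for j
        using b(2)[OF that] b(2)[of 0] b(2)[of 1] unfolding act_x'[symmetric] by (auto simp: act_def scale01_def)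
    qed (rule b)
    from ph_prop[OF this] show ?thesis unfolding prop_to_def h_def using j1 by auto
  qed
  ultimately obtain w where w: "g w * h w \<noteq> 0" using line_poly_common_nonzero by blast
  define z where "z = par w"
  have z: "F z = 0" "nonz d (ph z)" "nonz 5 (ps (ph z))" "nonz d (ph (act i z))" "z 0 \<noteq> 0" "z 2 \<noteq> 0"
    using w j1(1) i1(1) par_X[of w] by (auto simp: z_def g_def h_def nonz_def par_def)
  have nz: "nonz 5 z" using z(5) by (auto simp: nonz_def intro!: exI[of _ 0])
  have app: "app (M i) (ph z) j = c * ph z j" if "j < d" for j
  proof -
    have "app (M i) (ph z) j = (\<Sum>k<d. if j = k then c * ph z k else 0)"
      unfolding app_def assms scale_mat_def id_mat_def using that by (intro sum.cong) auto
    then show ?thesis using that by (simp add: sum.delta')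
  qed
  obtain b where b: "b \<noteq> 0" "\<And>j. j < d \<Longrightarrow> ph (act i z) j = b * (c * ph z j)"
    using equiv_M[OF nz z(1,2,4)] app unfolding prop_to_def by auto
  have "b * c \<noteq> 0" using z(4) b(2) by (auto simp: nonz_def)
  then have "prop_to d (ph z) (ph (act i z))"
    unfolding prop_to_def using b(2) by (intro exI[of _ "b * c"]) (simp add: mult.assoc)
  from ps_prop[OF this] have pp: "prop_to 5 (ps (ph z)) (ps (ph (act i z)))" .
  have n5: "nonz 5 (act i z)" using z(6) by (auto simp: nonz_def act_def scale01_def intro!: exI[of _ 2])
  have "prop_to 5 (act i z) (ps (ph (act i z)))"
    by (rule ps_ph[OF n5 _ z(4) prop_nonz[OF pp z(3)]]) (simp add: F_act z(1))
  then obtain b1 where b1: "b1 \<noteq> 0" "\<And>j. j < 5 \<Longrightarrow> ps (ph (act i z)) j = b1 * act i z j"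
    unfolding prop_to_def by blast
  obtain b2 where b2: "b2 \<noteq> 0" "\<And>j. j < 5 \<Longrightarrow> ps (ph z) j = b2 * z j"
    using ps_ph[OF nz z(1-3)] unfolding prop_to_def by blast
  obtain b3 where b3: "b3 \<noteq> 0" "\<And>j. j < 5 \<Longrightarrow> ps (ph (act i z)) j = b3 * ps (ph z) j"
    using pp unfolding prop_to_def by blast
  have e: "b1 * act i z j = b3 * (b2 * z j)" if "j < 5" for j
    using b1(2)[OF that] b2(2)[OF that] b3(2)[OF that] by simp
  \<comment> \<open>The coordinate 2 is fixed by the action and determines the factor of
    proportionality; the coordinate 0 then gives \<open>a ^ i\<close>.\<close>
  have "b1 = b3 * b2" using e[of 2] z(6) by (simp add: act_def scale01_def)
  then show "a ^ i = 1" using e[of 0] z(5) b1(1) by (simp add: act_def scale01_def)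
qed

sublocale rep: dihedral_rep d n a M S
proof
  show "M 2 \<noteq> id_mat d"
  proof
    assume "M 2 = id_mat d"
    then have "M 2 = scale_mat 1 (id_mat d)" by (simp add: scale_mat_def)
    then have "a ^ 2 = 1" by (rule M_scalar)
    then show False using prim n2 by (auto simp: primitive_root_of_unity_def dest: spec[of _ 2])
  qed
  show "M n \<noteq> scale_mat c (id_mat d)" for c
  proof
    assume "M n = scale_mat c (id_mat d)"
    then have "a ^ n = 1" by (rule M_scalar)
    then show False using prim n2 by (auto simp: primitive_root_of_unity_def dest: spec[of _ n])
  qed
qed (use n2 prim M_mult M_0 M_period E_left S_S S_M in auto)

lemma an: "a ^ n = - 1"
proof -
  have "(a ^ n) ^ 2 = 1" using rep.a_root by (simp add: power_mult[symmetric] mult.commute)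
  moreover have "a ^ n \<noteq> 1" using prim n2 by (auto simp: primitive_root_of_unity_def dest: spec[of _ n])
  ultimately show ?thesis by (simp add: power2_eq_1_iff)
qed

theorem contradiction: False
proof -
  obtain x0 where x0: "F x0 = 0" "x0 0 * x0 1 * x0 2 \<noteq> 0" "nonz d (ph x0)" "nonz 5 (ps (ph x0))"
    using point by blast
  define y0 where "y0 = ph x0"
  have nz0: "nonz 5 x0" using x0(2) by (auto simp: nonz_def intro!: exI[of _ 0])
  obtain b where b: "b \<noteq> 0" "\<And>i. i < 5 \<Longrightarrow> ps y0 i = b * x0 i"
    using ps_ph[OF nz0 x0(1,3,4)] unfolding prop_to_def y0_def by blast
  have ps0: "ps y0 0 \<noteq> 0" "ps y0 1 \<noteq> 0" "ps y0 2 \<noteq> 0" using b x0(2) by auto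
  have "prop_to 5 x0 (ps y0)" unfolding prop_to_def using b by blast
  from prop_nonz[OF ph_prop[OF this]] x0(3) have "nonz d (ph (ps y0))" .
  then obtain j1 where j1: "j1 < d" "ph (ps y0) j1 \<noteq> 0" by (auto simp: nonz_def)
  obtain j0 where j0: "j0 < d" "y0 j0 \<noteq> 0" using x0(3) by (auto simp: nonz_def y0_def)
  have inv: "ph (ps y) i * y j = ph (ps y) j * y i" if y: "nonz d y" "nonz 5 (ps y)" and ij: "i < d" "j < d" for y i j
  proof (cases "nonz d (ph (ps y))")
    case True
    obtain c where "c \<noteq> 0" "\<And>j. j < d \<Longrightarrow> ph (ps y) j = c * y j"
      using ph_ps[OF y True] unfolding prop_to_def by blast
    then show ?thesis using ij by simp
  qed (use ij in \<open>auto simp: nonz_def\<close>)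
  have d4: "d \<le> 4"
  proof (rule dimension_bound[where \<phi> = \<phi> and \<psi> = \<psi> and D' = D' and ?y0.0 = y0 and ?j0.0 = j0 and ?j1.0 = j1])
    show "value_at y (\<psi> 0) * value_at y (\<psi> 1) * value_at y (\<psi> 2) +
        value_at (\<lambda>i. value_at y (\<psi> i)) f = 0" if "\<exists>j<d. y j \<noteq> 0" for y
      using ps_X[of y] that by (simp add: nonz_def F_def ps_def)
    show "value_at y (\<psi> 0) * (value_at (\<lambda>i. value_at y (\<psi> i)) (\<phi> i) * y j -
        value_at (\<lambda>i. value_at y (\<psi> i)) (\<phi> j) * y i) = 0"
      if "\<exists>j<d. y j \<noteq> 0" "i < d" "j < d" for y i j
    proof (cases "ps y 0 = 0")
      case False
      then have "nonz 5 (ps y)" by (auto simp: nonz_def intro!: exI[of _ 0])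
      then show ?thesis using inv[of y i j] that by (simp add: nonz_def ph_def ps_def)
    qed (simp add: ps_def)
  qed (use vars phi psi j0 j1 ps0 in \<open>auto simp: ph_def ps_def\<close>)
  obtain z e l v where z: "z ^ 2 \<noteq> 1" "z \<noteq> 0" and e: "e ^ 2 = 1"
    and l0M: "\<And>s. (\<Sum>k<d. l 0 k * M 1 k s) = z * l 0 s"
    and l1M: "\<And>s. (\<Sum>k<d. l 1 k * M 1 k s) = inverse z * l (1::nat) s"
    and l0S: "\<And>s. (\<Sum>k<d. l 0 k * S k s) = l 1 s" and l1S: "\<And>s. (\<Sum>k<d. l 1 k * S k s) = l 0 s"
    and l1n: "\<And>s. (\<Sum>k<d. l 1 k * M n k s) = e * l 1 s"
    and l2n: "\<And>s. (\<Sum>k<d. l 2 k * M n k s) = - e * l 2 s"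
    and dual: "\<And>m m'. m < 3 \<Longrightarrow> m' < 3 \<Longrightarrow> (\<Sum>k<d. l m k * v m' k) = (if m = m' then 1 else 0)"
    using rep.eigenforms by blast
  obtain L V where L: "\<And>m. m < 3 \<Longrightarrow> L m = l m"
    and LV: "\<And>j j'. j < d \<Longrightarrow> j' < d \<Longrightarrow> (\<Sum>m<4. L m j' * V m j) = (if j = j' then 1 else 0)"
    using complete_dual_system[OF d4 dual] by blast
  \<comment> \<open>The forms 0 and 1 have eigenvalues \<open>z\<close> and \<open>inverse z\<close>
    under the rotation, so their quotient is multiplied by \<open>z ^ 2\<close>.\<close>
  interpret data: linearization_data f D D' d \<phi> \<psi> L V a "z ^ 2"
    by unfold_locales (use unc phi psi LV a0 z in auto)
  have lin: "data.lin_at x m = (\<Sum>j<d. L m j * ph x j)" for x m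
    by (simp add: data.lin_def ph_def)
  have comp: "data.comp_at x i = ps (ph x) i" for x i
    by (simp add: data.comp_def ph_def ps_def)
  have onX: "F x = 0" "nonz 5 x" if "data.on_X x" for x
    using that by (auto simp: data.on_X_def F_def nonz_def intro!: exI[of _ 2])
  have lin_app: "(\<Sum>j<d. L m j * app A y j) = (\<Sum>k<d. (\<Sum>j<d. L m j * A j k) * y k)" for m A y
    unfolding app_def sum_distrib_left sum_distrib_right by (subst sum.swap) (simp add: mult.assoc)
  have lin_equiv: "\<exists>c. \<forall>m. data.lin_at x' m = c * (\<Sum>k<d. (\<Sum>j<d. L m j * A j k) * ph x k)"
    if pr: "prop_to d (app A (ph x)) (ph x')" for A x x'
  proof -
    obtain c where "\<And>j. j < d \<Longrightarrow> ph x' j = c * app A (ph x) j" using pr unfolding prop_to_def by blast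
    then have "data.lin_at x' m = c * (\<Sum>j<d. L m j * app A (ph x) j)" for m
      unfolding lin sum_distrib_left by (intro sum.cong) auto
    then show ?thesis unfolding lin_app by blast
  qed
  have lin0: "data.lin_at x m = 0" if "\<not> nonz d (ph x)" for x m
    unfolding lin using that by (intro sum.neutral) (auto simp: nonz_def)
  interpret equivariant_linearization f D D' d \<phi> \<psi> L V a "z ^ 2"
  proof
    fix x assume x: "data.on_X x"
    show "data.lin_at (swap01 x) 0 * data.lin_at x 0 =
        data.lin_at (swap01 x) 1 * data.lin_at x 1"
    proof (cases "nonz d (ph x) \<and> nonz d (ph (swap01 x))")
      case True
      then obtain c where "\<And>m. data.lin_at (swap01 x) m =
          c * (\<Sum>k<d. (\<Sum>j<d. L m j * S j k) * ph x k)"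
        using lin_equiv[OF equiv_S[OF onX(2)[OF x] onX(1)[OF x]]] by blast
      from this[of 0] this[of 1]
      have "data.lin_at (swap01 x) 0 = c * data.lin_at x 1"
        "data.lin_at (swap01 x) 1 = c * data.lin_at x 0"
        unfolding lin[of x] using L[of 0] L[of 1] l0S l1S by simp_all
      then show ?thesis by simp
    qed (auto simp: lin0)
    show "data.lin_at (scale01 a (inverse a) x) 0 * data.lin_at x 1 =
      z ^ 2 * (data.lin_at (scale01 a (inverse a) x) 1 * data.lin_at x 0)"
    proof (cases "nonz d (ph x) \<and> nonz d (ph (act 1 x))")
      case True
      then obtain c where "\<And>m. data.lin_at (act 1 x) m =
          c * (\<Sum>k<d. (\<Sum>j<d. L m j * M 1 j k) * ph x k)"
        using lin_equiv[OF equiv_M[OF onX(2)[OF x] onX(1)[OF x]]] by blast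
      from this[of 0] this[of 1]
      have "data.lin_at (act 1 x) 0 = c * (z * data.lin_at x 0)"
        "data.lin_at (act 1 x) 1 = c * (inverse z * data.lin_at x 1)"
        unfolding lin[of x] using L[of 0] L[of 1] l0M l1M
        by (simp_all add: sum_distrib_left mult.assoc)
      then show ?thesis using z(2) by (simp add: act_def power2_eq_square)
    qed (auto simp: lin0 act_def)
    show "data.lin_at (scale01 (- 1) (- 1) x) 2 * data.lin_at x 1 =
      - (data.lin_at (scale01 (- 1) (- 1) x) 1 * data.lin_at x 2)"
    proof (cases "nonz d (ph x) \<and> nonz d (ph (act n x))")
      case True
      then obtain c where "\<And>m. data.lin_at (act n x) m =
          c * (\<Sum>k<d. (\<Sum>j<d. L m j * M n j k) * ph x k)"
        using lin_equiv[OF equiv_M[OF onX(2)[OF x] onX(1)[OF x]]] by blast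
      from this[of 1] this[of 2]
      have "data.lin_at (act n x) 1 = c * (e * data.lin_at x 1)"
        "data.lin_at (act n x) 2 = c * (- e * data.lin_at x 2)"
        unfolding lin[of x] using L[of 1] L[of 2] l1n l2n
        by (simp_all add: sum_distrib_left mult.assoc sum_negf)
      then show ?thesis by (simp add: act_def an)
    qed (auto simp: lin0 act_def an)
    show "data.lin_at x 1 * (data.comp_at x i * x j) =
        data.lin_at x 1 * (data.comp_at x j * x i)" if "i < 5" "j < 5" for i j
    proof (cases "nonz d (ph x) \<and> nonz 5 (ps (ph x))")
      case True
      then obtain c where "\<And>i. i < 5 \<Longrightarrow> ps (ph x) i = c * x i"
        using ps_ph[OF onX(2)[OF x] onX(1)[OF x]] unfolding prop_to_def by blast
      then show ?thesis using that by (simp add: comp)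
    next
      case False
      then show ?thesis using that by (auto simp: lin0 comp nonz_def)
    qed
  next
    \<comment> \<open>A generic point is sought in the representation and carried over by \<psi>,
      since the three forms are linear there and the dual vectors show that they are
      nonzero.\<close>
    define g where "g y = (ps y 0 * ps y 1) * (ps y 2 * ph (ps y) j1)" for y
    have lg: "line_poly g"
      unfolding g_def by (intro line_poly_mult line_poly_ps line_poly_ph line_poly_coord)
    have g0: "g y0 \<noteq> 0" using ps0 j1 by (simp add: g_def)
    have ll: "line_poly (\<lambda>y. \<Sum>k<d. l m k * y k)" for m by (rule line_poly_linear)
    obtain y1 where y1: "g y1 * (\<Sum>k<d. l 0 k * y1 k) \<noteq> 0"
      using line_poly_common_nonzero[OF lg ll g0, of 0 "v 0"] dual[of 0 0] by auto
    obtain y2 where y2: "g y2 * (\<Sum>k<d. l 0 k * y2 k) * (\<Sum>k<d. l 1 k * y2 k) \<noteq> 0"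
      using line_poly_common_nonzero[OF line_poly_mult[OF lg ll] ll y1, of 1 "v 1"] dual[of 1 1] by auto
    obtain y where y: "g y * (\<Sum>k<d. l 0 k * y k) * (\<Sum>k<d. l 1 k * y k) * (\<Sum>k<d. l 2 k * y k) \<noteq> 0"
      using line_poly_common_nonzero[OF line_poly_mult[OF line_poly_mult[OF lg ll] ll] ll y2, of 2 "v 2"]
        dual[of 2 2] by auto
    have gy: "ps y 0 \<noteq> 0" "ps y 1 \<noteq> 0" "ps y 2 \<noteq> 0" "ph (ps y) j1 \<noteq> 0"
      using y by (auto simp: g_def)
    have ly: "(\<Sum>k<d. L m k * y k) \<noteq> 0" if "m < 3" for m
    proof -
      have "m = 0 \<or> m = 1 \<or> m = 2" using that by auto
      then show ?thesis using y L[of 0] L[of 1] L[of 2] by auto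
    qed
    have ny: "nonz d y"
    proof (rule ccontr)
      assume "\<not> nonz d y"
      then have "(\<Sum>k<d. L 0 k * y k) = 0" by (intro sum.neutral) (auto simp: nonz_def)
      then show False using ly[of 0] by simp
    qed
    have n5: "nonz 5 (ps y)" using gy(1) by (auto simp: nonz_def intro!: exI[of _ 0])
    have nph: "nonz d (ph (ps y))" using gy(4) j1(1) by (auto simp: nonz_def)
    obtain c where c: "c \<noteq> 0" "\<And>j. j < d \<Longrightarrow> ph (ps y) j = c * y j"
      using ph_ps[OF ny n5 nph] unfolding prop_to_def by blast
    have "data.lin_at (ps y) m = c * (\<Sum>k<d. L m k * y k)" for m
      unfolding lin sum_distrib_left by (intro sum.cong) (auto simp: c(2))
    then have "\<forall>m<3. data.lin_at (ps y) m \<noteq> 0" using c(1) ly by simp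
    moreover have "data.comp_at (ps y) 2 \<noteq> 0"
    proof -
      have "ps (ph (ps y)) 2 = ps (\<lambda>j. c * y j) 2" by (rule ps_cong) (auto simp: c(2))
      then show ?thesis unfolding comp using c(1) gy(3) by (simp add: ps_scale)
    qed
    moreover have "data.on_X (ps y)" using ps_X[OF ny] gy(3) by (simp add: data.on_X_def F_def)
    ultimately show "\<exists>x. data.on_X x \<and> x 0 \<noteq> 0 \<and> x 1 \<noteq> 0 \<and> (\<forall>m<3. data.lin_at x m \<noteq> 0) \<and>
      data.comp_at x 2 \<noteq> 0" using gy by blast
  qed
  show False by (rule no_equivariant_linearization)
qed

end

section \<open>The cubic threefolds\<close>

lemma vars_cubic:
  assumes "vars f \<subseteq> {2, 3, 4}"
  shows "vars (cubic_2D4 f :: 'a::field mpoly) \<subseteq> {..<5}"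
proof -
  have "vars (cubic_2D4 f) \<subseteq> vars (Var 0 * Var 1 * Var 2 :: 'a mpoly) \<union> vars f"
    unfolding cubic_2D4_def vars_def using keys_add[of "Var 0 * Var 1 * Var 2 :: 'a mpoly" f] by blast
  then show ?thesis using vars_monomial_3 assms by fastforce
qed

text \<open>The chain rule on the line through \<open>x\<close> in the direction of the coordinate
  \<open>i\<close>; it makes partial derivatives of sums and products computable in one
  variable.\<close>

lemma eval_partial_as_pderiv:
  fixes x :: "nat \<Rightarrow> 'a::field_char_0"
  assumes "finite I" "vars p \<subseteq> I" "i \<in> I"
  shows "value_at x (partial_deriv i p) =
    poly (pderiv (subst_polys (\<lambda>j. [:x j, if j = i then 1 else 0:]) p)) 0"
proof -
  have "poly (pderiv (subst_polys (\<lambda>j. [:x j, if j = i then 1 else 0:]) p)) 0 =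
      (\<Sum>j\<in>I. value_at x (partial_deriv j p) * (if j = i then 1 else 0))"
    unfolding pderiv_eval_mpoly[OF assms(1,2)] poly_sum poly_mult
    by (intro sum.cong refl arg_cong2[of _ _ _ _ "(*)"], subst eval_mpoly_hom[OF comm_ring_hom_poly_eval])
      (auto simp: pderiv_pCons)
  also have "\<dots> = (\<Sum>j\<in>I. if j = i then value_at x (partial_deriv j p) else 0)"
    by (intro sum.cong) auto
  also have "\<dots> = value_at x (partial_deriv i p)" using assms by (subst sum.delta) auto
  finally show ?thesis by simp
qed

lemma eval_partial_cubic:
  fixes x :: "nat \<Rightarrow> 'a::field_char_0"
  assumes f: "vars f \<subseteq> {2, 3, 4}" and i: "i < 5"
  shows "value_at x (partial_deriv i (cubic_2D4 f)) =
    (if i = 0 then x 1 * x 2 else if i = 1 then x 0 * x 2 else if i = 2 then x 0 * x 1 else 0) +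
    value_at x (partial_deriv i f)"
proof -
  have f5: "vars f \<subseteq> {..<5}" using f by auto
  have "i = 0 \<or> i = 1 \<or> i = 2 \<or> i = 3 \<or> i = 4" using i by auto
  then show ?thesis
    using i f5 vars_cubic[OF f]
    by (elim disjE)
      (simp_all add: eval_partial_as_pderiv[of "{..<5}"] eval_cubic_2D4[OF comm_ring_hom_const_poly]
        pderiv_add pderiv_mult pderiv_pCons)
qed

lemma eval_partial_absent:
  fixes x :: "nat \<Rightarrow> 'a::field_char_0"
  assumes f: "vars f \<subseteq> {2, 3, 4}" and i: "i \<in> {0, 1}"
  shows "value_at x (partial_deriv i f) = 0"
proof -
  have "subst_polys (\<lambda>j. [:x j, if j = i then 1 else 0:]) f =
      subst_polys (\<lambda>j. [:x j:]) f"
    by (rule eval_mpoly_cong) (use f i in auto)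
  also have "\<dots> = [:value_at x f:]"
    by (rule eval_mpoly_hom[OF comm_ring_hom_const_poly, symmetric])
  finally show ?thesis
    using f i by (subst eval_partial_as_pderiv[of "{0, 1, 2, 3, 4}"]) (auto simp: pderiv_pCons)
qed

lemma eval_vec_vec:
  assumes "vars p \<subseteq> {..<N}"
  shows "eval_vec p (vec N x) = value_at x p"
  by (rule eval_mpoly_cong) (use assms in auto)

lemma vec_eq_0_iff: "vec N x = 0\<^sub>v N \<longleftrightarrow> (\<forall>i<N. x i = 0)"
  by (auto simp: vec_eq_iff)

lemma vec_obtain: "x \<in> carrier_vec N \<Longrightarrow> \<exists>g. x = vec N g"
  by (intro exI[of _ "\<lambda>i. x $ i"]) auto

lemma same_point_vec:
  "same_point (vec N x) (vec N y) \<longleftrightarrow> (\<exists>c. c \<noteq> 0 \<and> (\<forall>i<N. y i = c * x i))"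
  unfolding same_point_def by (auto simp: vec_eq_iff)

lemma hypersurface_vec:
  assumes "vars f \<subseteq> {2, 3, 4}"
  shows "vec 5 x \<in> hypersurface 5 (cubic_2D4 f) \<longleftrightarrow>
    (\<exists>i<5. x i \<noteq> 0) \<and> x 0 * x 1 * x 2 + value_at x f = (0 :: 'a::field)"
  unfolding hypersurface_def proj_space_def
  by (simp add: eval_vec_vec[OF vars_cubic[OF assms]] vec_eq_0_iff)
    (simp add: eval_cubic_2D4[OF comm_ring_hom_id])

text \<open>The first two coordinate points are singular on the threefold, and a critical point of
  \<open>f\<close> gives a third singular point with first two coordinates zero; the singular locus
  has room for two.\<close>

lemma smooth_cubic_if_2D4:
  fixes f :: "'k::{alg_closed_field, field_char_0} mpoly"
  assumes hom: "homogeneous 3 f" and vars: "vars f \<subseteq> {2, 3, 4}"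
    and sing: "has_2D4_singularities (cubic_2D4 f)"
  shows "smooth_cubic f"
proof
  fix x :: "nat \<Rightarrow> 'k"
  assume crit: "\<And>i. i \<in> {2, 3, 4} \<Longrightarrow> value_at x (partial_deriv i f) = 0"
  show "x 2 = 0 \<and> x 3 = 0 \<and> x 4 = 0"
  proof (rule ccontr)
    assume nz: "\<not> ?thesis"
    have vp: "vars (partial_deriv i f) \<subseteq> {2, 3, 4}" for i
      using vars_partial_deriv[of i f] vars by auto
    have vpc: "vars (partial_deriv i (cubic_2D4 f)) \<subseteq> {..<5}" for i
      using vars_partial_deriv[of i "cubic_2D4 f"] vars_cubic[OF vars] by auto
    have hp: "homogeneous 2 (partial_deriv i f)" for i
      using homogeneous_partial_deriv[of 2 f i] hom by (simp add: numeral_3_eq_3 numeral_2_eq_2)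
    have sing_iff: "vec 5 y \<in> singular_locus 5 (cubic_2D4 f) \<longleftrightarrow>
      (\<exists>i<5. y i \<noteq> 0) \<and> y 0 * y 1 * y 2 + value_at y f = 0 \<and>
      (\<forall>i<5. value_at y (partial_deriv i (cubic_2D4 f)) = 0)" for y
      unfolding singular_locus_def by (simp add: hypersurface_vec[OF vars] eval_vec_vec[OF vpc])
    have zero: "value_at y p = 0"
      if "homogeneous e p" "e > 0" "vars p \<subseteq> {2, 3, 4}" "y 2 = 0" "y 3 = 0" "y 4 = 0"
      for y and p :: "'k mpoly" and e
    proof -
      have "value_at y p = value_at (\<lambda>i. 0 * y i) p"
        by (rule eval_mpoly_cong) (use that in auto)
      also have "\<dots> = 0" unfolding eval_mpoly_scale[OF that(1)] using that(2) by simp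
      finally show ?thesis .
    qed
    define e0 where "e0 = (\<lambda>i::nat. if i = 0 then 1 else 0 :: 'k)"
    define e1 where "e1 = (\<lambda>i::nat. if i = 1 then 1 else 0 :: 'k)"
    define y where "y = (\<lambda>i::nat. if i < 2 then 0 else x i)"
    have s0: "vec 5 e0 \<in> singular_locus 5 (cubic_2D4 f)"
      unfolding sing_iff using zero[OF hom _ vars, of e0] zero[OF hp _ vp, of e0]
      by (auto simp: eval_partial_cubic[OF vars] e0_def intro!: exI[of _ 0])
    have s1: "vec 5 e1 \<in> singular_locus 5 (cubic_2D4 f)"
      unfolding sing_iff using zero[OF hom _ vars, of e1] zero[OF hp _ vp, of e1]
      by (auto simp: eval_partial_cubic[OF vars] e1_def intro!: exI[of _ 1])
    have py: "value_at y (partial_deriv i f) = 0" if "i < 5" for i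
    proof (cases "i < 2")
      case True
      then show ?thesis by (intro eval_partial_absent[OF vars]) auto
    next
      case False
      have "value_at y (partial_deriv i f) = value_at x (partial_deriv i f)"
        by (rule eval_mpoly_cong) (use vp[of i] in \<open>auto simp: y_def\<close>)
      moreover have "i \<in> {2, 3, 4}" using False that by auto
      ultimately show ?thesis using crit by simp
    qed
    \<comment> \<open>By the Euler identity a critical point lies on the hypersurface.\<close>
    have "of_nat 3 * value_at y f = 0"
      using euler_identity[OF _ vars hom, of y] py by simp
    then have sy: "vec 5 y \<in> singular_locus 5 (cubic_2D4 f)"
      unfolding sing_iff using py nz
      by (auto simp: eval_partial_cubic[OF vars] y_def intro: exI[of _ 2] exI[of _ 3] exI[of _ 4])
    obtain p q where pq: "singular_locus 5 (cubic_2D4 f) = {x. same_point p x \<or> same_point q x}"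
      using sing unfolding has_2D4_singularities_def by blast
    \<comment> \<open>Among the three singular points two must represent the same one of
      \<open>p\<close> and \<open>q\<close>, hence be proportional.\<close>
    have share: "\<exists>c. c \<noteq> 0 \<and> (\<forall>i<5. w i = c * u i)"
      if sp: "same_point r (vec 5 u)" "same_point r (vec 5 w)" for r and u w :: "nat \<Rightarrow> 'k"
    proof -
      obtain b c where b: "b \<noteq> 0" "vec 5 u = b \<cdot>\<^sub>v r" and c: "c \<noteq> 0" "vec 5 w = c \<cdot>\<^sub>v r"
        using sp unfolding same_point_def by blast
      have dim: "dim_vec r = 5" using arg_cong[OF b(2), of dim_vec] by simp
      have "w i = c / b * u i" if "i < 5" for i
      proof -
        have "u i = b * r $ i" "w i = c * r $ i"
          using arg_cong[OF b(2), of "\<lambda>v. v $ i"] arg_cong[OF c(2), of "\<lambda>v. v $ i"] that dim by auto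
        then show ?thesis using b(1) by simp
      qed
      then show ?thesis using b(1) c(1) by (intro exI[of _ "c / b"]) simp
    qed
    have "same_point p (vec 5 e0) \<or> same_point q (vec 5 e0)" "same_point p (vec 5 e1) \<or> same_point q (vec 5 e1)"
      "same_point p (vec 5 y) \<or> same_point q (vec 5 y)"
      using s0 s1 sy unfolding pq by auto
    then have "(\<exists>r. same_point r (vec 5 e0) \<and> same_point r (vec 5 e1)) \<or>
      (\<exists>r. same_point r (vec 5 e0) \<and> same_point r (vec 5 y)) \<or>
      (\<exists>r. same_point r (vec 5 e1) \<and> same_point r (vec 5 y))" by blast
    moreover have "\<not> (\<exists>c. c \<noteq> 0 \<and> (\<forall>i<5. e1 i = c * e0 i))"
      by (auto simp: e0_def e1_def dest: spec[of _ 1])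
    moreover have "\<not> (\<exists>c. c \<noteq> 0 \<and> (\<forall>i<5. y i = c * e0 i))"
      by (auto simp: e0_def y_def dest: spec[of _ 0])
    moreover have "\<not> (\<exists>c. c \<noteq> 0 \<and> (\<forall>i<5. y i = c * e1 i))"
      by (auto simp: e1_def y_def dest: spec[of _ 1])
    ultimately show False using share by blast
  qed
qed (use hom vars in auto)

section \<open>The group action\<close>

lemma mult_mat_vec_vec:
  assumes "A \<in> carrier_mat N N"
  shows "A *\<^sub>v vec N x = vec N (\<lambda>r. \<Sum>k<N. A $$ (r, k) * x k)"
  using assms by (intro eq_vecI) (auto simp: scalar_prod_def atLeast0LessThan)

lemma sigma12_vec: "sigma12 *\<^sub>v vec 5 x = vec 5 (swap01 x)"
proof (rule eq_vecI)
  fix i assume "i < dim_vec (vec 5 (swap01 x))"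
  then have "i < 5" by simp
  then consider "i = 0" | "i = 1" | "i = 2" | "i = 3" | "i = 4" by linarith
  then show "(sigma12 *\<^sub>v vec 5 x) $ i = vec 5 (swap01 x) $ i"
    by cases (simp_all add: sigma12_mat scalar_prod_def sum_below_5 swap01_def)
qed (simp add: sigma12_mat)

lemma tau_vec: "tau b *\<^sub>v vec 5 x = vec 5 (scale01 b (inverse b) x)"
proof (rule eq_vecI)
  fix i assume "i < dim_vec (vec 5 (scale01 b (inverse b) x))"
  then have "i < 5" by simp
  then consider "i = 0" | "i = 1" | "i = 2" | "i = 3" | "i = 4" by linarith
  then show "(tau b *\<^sub>v vec 5 x) $ i = vec 5 (scale01 b (inverse b) x) $ i"
    by cases (simp_all add: tau_mat scalar_prod_def sum_below_5 scale01_def)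
qed (simp add: tau_mat)

lemma tau_mult: "tau b * tau c = tau (b * c :: 'a::field)"
  unfolding tau_mat mat_mult_5
  apply (rule cong_mat[OF refl refl])
  apply (drule less_5_cases)+
  apply (elim disjE; hypsubst)
  apply (simp_all only: prod.case sum_below_5)
  apply simp_all
  done

lemma sigma12_tau: "sigma12 * tau b = tau (inverse b) * (sigma12 :: 'a::field mat)"
  unfolding tau_mat sigma12_mat mat_mult_5
  apply (rule cong_mat[OF refl refl])
  apply (drule less_5_cases)+
  apply (elim disjE; hypsubst)
  apply (simp_all only: prod.case sum_below_5)
  apply simp_all
  done

lemma tau_1: "tau 1 = (1\<^sub>m 5 :: 'a::field mat)"
  using tau_mult_inverse[of "1::'a"] by (simp add: tau_mult)

lemma group_GL: "group (GL N :: 'a::field mat monoid)"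
proof -
  interpret ring "ring_mat TYPE('a) N ()" by (rule ring_mat)
  show ?thesis unfolding GL_def by (rule units_group)
qed

lemma GL_simps: "mult (GL N) = (*)" "one (GL N) = (1\<^sub>m N :: 'a::field mat)"
  "A \<in> carrier (GL N) \<Longrightarrow> A \<in> carrier_mat N N"
  by (auto simp: GL_def units_of_def ring_mat_def Units_def)

lemma group_dihedral: "group (dihedral_group a)"
  unfolding dihedral_group_def by (rule group.group_subgroup_generated[OF group_GL])

lemma dihedral_simps: "mult (dihedral_group a) = (*)" "one (dihedral_group a) = (1\<^sub>m 5 :: 'a::field mat)"
  by (simp_all add: dihedral_group_def GL_simps)

lemma sigma12_in_dihedral: "sigma12 \<in> carrier (dihedral_group a)"
  unfolding dihedral_group_def by (simp add: carrier_subgroup_generated sigma12_in_GL generate.incl)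

lemma tau_power_in_dihedral:
  assumes "a \<noteq> 0"
  shows "tau (a ^ i) \<in> carrier (dihedral_group a)"
proof (induction i)
  case 0
  show ?case using group.is_monoid[OF group_dihedral[of a], THEN monoid.one_closed]
    by (simp add: dihedral_simps tau_1)
next
  case (Suc i)
  have "tau a \<in> carrier (dihedral_group a)"
    unfolding dihedral_group_def using tau_in_GL[OF assms]
    by (simp add: carrier_subgroup_generated generate.incl)
  from monoid.m_closed[OF group.is_monoid[OF group_dihedral[of a]] this Suc]
  show ?case by (simp add: dihedral_simps tau_mult)
qed

text \<open>Entries outside the format are set to zero, so that matrix identities become equations
  of functions and the identity matrix becomes \<open>id_mat\<close>.\<close>

definition ent :: "nat \<Rightarrow> 'a::field mat \<Rightarrow> nat \<Rightarrow> nat \<Rightarrow> 'a" where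
  "ent d A = (\<lambda>r s. if r < d \<and> s < d then A $$ (r, s) else 0)"

lemma ent_mult:
  assumes "A \<in> carrier_mat d d" "B \<in> carrier_mat d d"
  shows "ent d (A * B) = mm d (ent d A) (ent d B)"
  using assms by (intro ext) (auto simp: ent_def mm_def scalar_prod_def atLeast0LessThan intro!: sum.cong)

lemma ent_one: "ent d (1\<^sub>m d) = id_mat d"
  by (intro ext) (auto simp: ent_def id_mat_def)

lemma ent_id_left: "mm d (id_mat d) (ent d A) = ent d A"
proof (intro ext)
  fix r s
  have "mm d (id_mat d) (ent d A) r s = (\<Sum>k<d. if r = k then ent d A k s else 0)"
    unfolding mm_def id_mat_def by (intro sum.cong) auto
  then show "mm d (id_mat d) (ent d A) r s = ent d A r s"
    by (simp add: sum.delta' ent_def)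
qed

theorem proposition5p17:
  fixes f3 :: "'k::{alg_closed_field, field_char_0} mpoly" and a :: 'k and n :: nat
  assumes "uncountable (UNIV :: 'k set)"
    and "homogeneous 3 f3" and "vars f3 \<subseteq> {2, 3, 4}"
    and "has_2D4_singularities (cubic_2D4 f3)"
    and "n \<ge> 2" and "primitive_root_of_unity (2 * n) a"
  shows "\<not> linearizable (dihedral_group a) 5 (\<lambda>g. g) (hypersurface 5 (cubic_2D4 f3))"
proof
  let ?G = "dihedral_group a" and ?X = "hypersurface 5 (cubic_2D4 f3)"
  assume "linearizable ?G 5 (\<lambda>g. g) ?X"
  then obtain d \<rho> where \<rho>: "\<rho> \<in> hom ?G (GL d)"
    and bir: "equivariantly_birational ?G 5 (\<lambda>g. g) ?X d \<rho> (proj_space d)"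
    unfolding linearizable_def by blast
  from bir[unfolded equivariantly_birational_def] obtain \<phi> \<psi>
    where forms: "forms_map 5 d \<phi>" "forms_map d 5 \<psi>"
    and psX': "\<forall>y\<in>proj_space d. apply_forms 5 \<psi> y \<noteq> 0\<^sub>v 5 \<longrightarrow> apply_forms 5 \<psi> y \<in> ?X"
    and dense: "zariski_dense 5 {x\<in>?X. apply_forms d \<phi> x \<noteq> 0\<^sub>v d \<and>
                           apply_forms 5 \<psi> (apply_forms d \<phi> x) \<noteq> 0\<^sub>v 5} ?X"
    and psph': "\<forall>x\<in>?X. apply_forms d \<phi> x \<noteq> 0\<^sub>v d \<longrightarrow>
        apply_forms 5 \<psi> (apply_forms d \<phi> x) \<noteq> 0\<^sub>v 5 \<longrightarrow>
        same_point x (apply_forms 5 \<psi> (apply_forms d \<phi> x))"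
    and phps': "\<forall>y\<in>proj_space d. apply_forms 5 \<psi> y \<noteq> 0\<^sub>v 5 \<longrightarrow>
        apply_forms d \<phi> (apply_forms 5 \<psi> y) \<noteq> 0\<^sub>v d \<longrightarrow>
        same_point y (apply_forms d \<phi> (apply_forms 5 \<psi> y))"
    and equiv': "\<forall>g\<in>carrier ?G. \<forall>x\<in>?X. apply_forms d \<phi> x \<noteq> 0\<^sub>v d \<longrightarrow>
        apply_forms d \<phi> (g *\<^sub>v x) \<noteq> 0\<^sub>v d \<longrightarrow>
        same_point (\<rho> g *\<^sub>v apply_forms d \<phi> x) (apply_forms d \<phi> (g *\<^sub>v x))"
    by (elim exE conjE) (rule that, assumption+)
  note psX = psX'[rule_format] and psph = psph'[rule_format] and phps = phps'[rule_format]
    and equiv = equiv'[rule_format]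
  obtain D where phi: "\<And>j. j < d \<Longrightarrow> homogeneous D (\<phi> j)" "\<And>j. j < d \<Longrightarrow> vars (\<phi> j) \<subseteq> {..<5}"
    using forms(1) unfolding forms_map_def by blast
  obtain D' where psi: "\<And>i. i < 5 \<Longrightarrow> homogeneous D' (\<psi> i)" "\<And>i. i < 5 \<Longrightarrow> vars (\<psi> i) \<subseteq> {..<d}"
    using forms(2) unfolding forms_map_def by blast
  have a0: "a \<noteq> 0" using assms(5,6) by (auto simp: primitive_root_of_unity_def power_0_left)
  have a_root: "a ^ (2 * n) = 1" using assms(6) by (simp add: primitive_root_of_unity_def)
  define M where "M i = ent d (\<rho> (tau (a ^ i)))" for i
  define S where "S = ent d (\<rho> sigma12)"
  have \<rho>_carrier: "\<rho> g \<in> carrier_mat d d" if "g \<in> carrier ?G" for g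
    using \<rho> that by (intro GL_simps(3)) (auto simp: hom_def)
  have \<rho>_mult: "\<rho> (g * h) = \<rho> g * \<rho> h" if "g \<in> carrier ?G" "h \<in> carrier ?G" for g h
    using \<rho> that by (auto simp: hom_def dihedral_simps GL_simps)
  have \<rho>_one: "\<rho> (1\<^sub>m 5) = 1\<^sub>m d"
    using hom_one[OF \<rho> group_dihedral group_GL] by (simp add: dihedral_simps GL_simps)
  note sg = sigma12_in_dihedral[of a] and tg = tau_power_in_dihedral[OF a0]
  interpret smooth_cubic f3 by (rule smooth_cubic_if_2D4[OF assms(2-4)])
  interpret maps: linearization_maps f3 D D' d n \<phi> \<psi> a
    by unfold_locales (use assms phi psi in auto)
  have ph: "apply_forms d \<phi> (vec 5 x) = vec d (maps.ph x)" for x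
    unfolding apply_forms_def maps.ph_def by (rule eq_vecI) (auto simp: eval_vec_vec[OF phi(2)])
  have ps: "apply_forms 5 \<psi> (vec d y) = vec 5 (maps.ps y)" for y
    unfolding apply_forms_def maps.ps_def by (rule eq_vecI) (auto simp: eval_vec_vec[OF psi(2)])
  have nz: "vec N x \<noteq> 0\<^sub>v N \<longleftrightarrow> maps.nonz N x" for N and x :: "nat \<Rightarrow> 'k"
    by (auto simp: vec_eq_0_iff maps.nonz_def)
  have X: "vec 5 x \<in> ?X \<longleftrightarrow> maps.nonz 5 x \<and> maps.F x = 0" for x
    by (simp add: hypersurface_vec[OF assms(3)] maps.nonz_def maps.F_def)
  have sp: "same_point (vec N x) (vec N y) \<longleftrightarrow> maps.prop_to N x y" for N and x y :: "nat \<Rightarrow> 'k"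
    by (simp add: same_point_vec maps.prop_to_def)
  have PS: "vec d y \<in> proj_space d \<longleftrightarrow> maps.nonz d y" for y
    by (auto simp: proj_space_def nz)
  have app: "\<rho> g *\<^sub>v vec d y = vec d (maps.app (ent d (\<rho> g)) y)" if "g \<in> carrier ?G" for g y
    unfolding mult_mat_vec_vec[OF \<rho>_carrier[OF that]] maps.app_def
    by (rule eq_vecI) (auto simp: ent_def intro!: sum.cong)
  interpret equivariant_birational_maps f3 D D' d n \<phi> \<psi> a M S
  proof
    show "maps.F (maps.ps y) = 0" if "maps.nonz d y" for y
    proof (cases "maps.nonz 5 (maps.ps y)")
      case True
      then show ?thesis using psX[of "vec d y"] that by (simp add: PS ps nz X)
    next
      case False
      \<comment> \<open>At a point where all components of \<psi> vanish, the equation holds by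
        homogeneity.\<close>
      have "value_at (maps.ps y) f3 = value_at (\<lambda>i. 0 * maps.ps y i) f3"
        by (rule eval_mpoly_cong) (use False vars in \<open>auto simp: maps.nonz_def\<close>)
      also have "\<dots> = 0" unfolding eval_mpoly_scale[OF hom] by simp
      finally show ?thesis using False by (simp add: maps.F_def maps.nonz_def)
    qed
    show "maps.prop_to 5 x (maps.ps (maps.ph x))"
      if "maps.nonz 5 x" "maps.F x = 0" "maps.nonz d (maps.ph x)" "maps.nonz 5 (maps.ps (maps.ph x))" for x
      using psph[of "vec 5 x"] that by (simp add: X ph ps nz sp)
    show "maps.prop_to d y (maps.ph (maps.ps y))"
      if "maps.nonz d y" "maps.nonz 5 (maps.ps y)" "maps.nonz d (maps.ph (maps.ps y))" for y
      using phps[of "vec d y"] that by (simp add: PS ph ps nz sp)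
    show "\<exists>x. maps.F x = 0 \<and> x 0 * x 1 * x 2 \<noteq> 0 \<and> maps.nonz d (maps.ph x) \<and>
      maps.nonz 5 (maps.ps (maps.ph x))"
    proof -
      let ?U = "{x\<in>?X. apply_forms d \<phi> x \<noteq> 0\<^sub>v d \<and> apply_forms 5 \<psi> (apply_forms d \<phi> x) \<noteq> 0\<^sub>v 5}"
      let ?m = "Var 0 * Var 1 * Var 2 :: 'k mpoly"
      have m5: "vars ?m \<subseteq> {..<5}" using vars_monomial_3[where 'a = 'k] by fastforce
      have m: "eval_vec ?m (vec 5 x) = x 0 * x 1 * x 2" for x
        unfolding eval_vec_vec[OF m5] by (rule eval_monomial_3[OF comm_ring_hom_id])
      obtain \<delta> where "value_at (\<lambda>i. if i = 2 then 0 else if i = 3 then \<delta> else 1) f3 \<noteq> 0"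
        using direction_exists by blast
      from degree_slice[OF this, of 0] have "slice \<delta> 0 \<noteq> 0" by auto
      then obtain s where s: "poly (slice \<delta> 0) s \<noteq> 0" by (metis poly_eqI_infinite poly_0)
      \<comment> \<open>A point of the threefold with the first three coordinates nonzero. Density,
        applied to the monomial in these coordinates, then provides such a point where both maps are
        defined.\<close>
      define w where "w = (\<lambda>i::nat. if i = 0 then 1 else if i = 1 then - poly (slice \<delta> 0) s
        else if i = 2 then 1 else if i = 3 then \<delta> * s else s)"
      have "value_at w f3 = poly (slice \<delta> 0) s"
        unfolding poly_slice by (rule eval_mpoly_cong) (use vars in \<open>auto simp: w_def\<close>)
      then have "vec 5 w \<in> ?X"
        unfolding X by (auto simp: maps.F_def w_def maps.nonz_def intro!: exI[of _ 0])
      moreover have "eval_vec ?m (vec 5 w) \<noteq> 0" unfolding m using s by (simp add: w_def)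
      ultimately obtain x where x: "x \<in> ?U" "eval_vec ?m x \<noteq> 0"
        using dense homogeneous_monomial_3[where 'a = 'k] m5 unfolding zariski_dense_def by blast
      have "x \<in> carrier_vec 5" using x(1) by (simp add: hypersurface_def proj_space_def)
      then obtain g where g: "x = vec 5 g" using vec_obtain by blast
      show ?thesis
        using x(1) x(2)[unfolded g m] by (intro exI[of _ g]) (simp add: g X ph ps nz)
    qed
    show "maps.prop_to d (maps.app S (maps.ph x)) (maps.ph (swap01 x))"
      if "maps.nonz 5 x" "maps.F x = 0" "maps.nonz d (maps.ph x)" "maps.nonz d (maps.ph (swap01 x))" for x
      using equiv[OF sg, of "vec 5 x"] that by (simp add: X ph nz sp sigma12_vec app[OF sg] S_def)
    show "maps.prop_to d (maps.app (M i) (maps.ph x)) (maps.ph (maps.act i x))"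
      if "maps.nonz 5 x" "maps.F x = 0" "maps.nonz d (maps.ph x)" "maps.nonz d (maps.ph (maps.act i x))" for x i
      using equiv[OF tg, of "vec 5 x"] that
      by (simp add: X ph nz sp tau_vec app[OF tg] M_def maps.act_def)
    show "mm d (M i) (M j) = M (i + j)" for i j
      unfolding M_def ent_mult[OF \<rho>_carrier[OF tg] \<rho>_carrier[OF tg], symmetric] \<rho>_mult[OF tg tg, symmetric]
      by (simp add: tau_mult power_add)
    show "M 0 = id_mat d" by (simp add: M_def tau_1 \<rho>_one ent_one)
    show "M (i + 2 * n) = M i" for i by (simp add: M_def power_add a_root)
    show "mm d (id_mat d) (M i) = M i" for i unfolding M_def by (rule ent_id_left)
    show "mm d (id_mat d) S = S" unfolding S_def by (rule ent_id_left)
    show "mm d S S = id_mat d"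
      unfolding S_def ent_mult[OF \<rho>_carrier[OF sg] \<rho>_carrier[OF sg], symmetric] \<rho>_mult[OF sg sg, symmetric]
      by (simp add: sigma12_sq \<rho>_one ent_one)
    show "mm d S (M j) = mm d (M ((2 * n - 1) * j)) S" for j
    proof -
      \<comment> \<open>The inverse of the rotation is written as a power with natural exponent, to
        match the indexing of \<open>M\<close>.\<close>
      have "a ^ (2 * n - 1) * a = 1"
        using a_root assms(5) by (metis One_nat_def Suc_pred mult.commute mult_pos_pos pos2 power_Suc
          order.strict_trans2[OF pos2])
      then have "inverse a = a ^ (2 * n - 1)" using a0 by (metis inverse_unique mult.commute)
      then have "inverse (a ^ j) = a ^ ((2 * n - 1) * j)" by (simp add: power_mult flip: power_inverse)
      then have "sigma12 * tau (a ^ j) = tau (a ^ ((2 * n - 1) * j)) * sigma12" by (simp add: sigma12_tau)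
      then have "\<rho> sigma12 * \<rho> (tau (a ^ j)) = \<rho> (tau (a ^ ((2 * n - 1) * j))) * \<rho> sigma12"
        unfolding \<rho>_mult[OF sg tg, symmetric] \<rho>_mult[OF tg sg, symmetric] by simp
      then show ?thesis
        unfolding S_def M_def ent_mult[OF \<rho>_carrier[OF sg] \<rho>_carrier[OF tg], symmetric]
          ent_mult[OF \<rho>_carrier[OF tg] \<rho>_carrier[OF sg], symmetric] by simp
    qed
  qed
  show False by (rule contradiction)
qed

end
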